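(* Let $\mathcal{A}$ be an abelian category with enough projectives and enough injectives, and let $\mathcal{X}$ be a functorially finite subcategory of $\mathcal{A}$ which contains all projective objects and all injective objects of $\mathcal{A}$ and is closed under kernels of epimorphisms and cokernels of monomorphisms. (i) Suppose $\underline{\mathcal{X}}$ has split idempotents. Then: (1) for every $A\in\mathcal{X}$, if $F$ is a direct summand of $\mathrm{Ext}^1_{\mathcal{A}}(A,-)|_{\mathcal{X}}$, then there exists $B\in\mathcal{X}$ such that $F\simeq\mathrm{Ext}^1_{\mathcal{A}}(B,-)|_{\mathcal{X}}$; (2) in particular, if $\mathcal{X}=\mathcal{A}$ is a Krull–Schmidt category, then for every $A\in\mathcal{A}$ every direct summand of the functor $\mathrm{Ext}^1_{\mathcal{A}}(A,-)$ is isomorphic to $\mathrm{Ext}^1_{\mathcal{A}}(B,-)$ for some $B\in\mathcal{A}$. (ii) Suppose $\overline{\mathcal{X}}$ has split idempotents. Then: (1) for every $A\in\mathcal{X}$, if $F$ is a direct summand of $\mathrm{Ext}^1_{\mathcal{A}}(-,A)|_{\mathcal{X}}$, then there exists $B\in\mathcal{X}$ such that $F\simeq\mathrm{Ext}^1_{\mathcal{A}}(-,B)|_{\mathcal{X}}$; (2) in particular, if $\mathcal{X}=\mathcal{A}$ is a Krull–Schmidt category, then for every $A\in\mathcal{A}$ every direct summand of the functor $\mathrm{Ext}^1_{\mathcal{A}}(-,A)$ is isomorphic to $\mathrm{Ext}^1_{\mathcal{A}}(-,B)$ for some $B\in\mathcal{A}$.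
   Context: All subcategories are full, closed under isomorphisms and finite direct sums. Functorially finite means that every object $A\in\mathcal{A}$ admits a right $\mathcal{X}$-approximation (a morphism $X\to A$, $X\in\mathcal{X}$, through which every morphism from an object of $\mathcal{X}$ to $A$ factors) and, dually, a left $\mathcal{X}$-approximation. $\underline{\mathcal{X}}$ (resp. $\overline{\mathcal{X}}$) has the same objects as $\mathcal{X}$, with morphisms modulo those factoring through projective (resp. injective) objects of $\mathcal{A}$. $\mathrm{Ext}^1_{\mathcal{A}}(A,-)|_{\mathcal{X}}$ and $\mathrm{Ext}^1_{\mathcal{A}}(-,A)|_{\mathcal{X}}$ are the restrictions to $\mathcal{X}$ of the usual Ext functors with values in abelian groups; direct summands are taken in the category of additive functors (covariant, resp. contravariant) from $\mathcal{X}$ to abelian groups. *)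

theory Defs
  imports "HOL-Algebra.Ring"
begin

section \<open>Abelian categories\<close>

text \<open>A category enriched with an addition on its hom-sets. Composition and addition are total
  functions on the type of arrows; they are meaningful only for composable, respectively
  parallel, arrows.\<close>

record ('o, 'm) cat =
  Obj :: "'o set"
  Arr :: "'m set"
  Src :: "'m \<Rightarrow> 'o"
  Tgt :: "'m \<Rightarrow> 'o"
  Ident :: "'o \<Rightarrow> 'm"
  Comp :: "'m \<Rightarrow> 'm \<Rightarrow> 'm"  (infixr "\<^bold>\<circ>\<index>" 70)
  Plus :: "'m \<Rightarrow> 'm \<Rightarrow> 'm"  (infixl "\<^bold>+\<index>" 65)
  Zero :: "'o \<Rightarrow> 'o \<Rightarrow> 'm"

definition Hom :: "('o, 'm) cat \<Rightarrow> 'o \<Rightarrow> 'o \<Rightarrow> 'm set" where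
  "Hom C A B = {f \<in> Arr C. Src C f = A \<and> Tgt C f = B}"

definition hom_group :: "('o, 'm) cat \<Rightarrow> 'o \<Rightarrow> 'o \<Rightarrow> 'm monoid" where
  "hom_group C A B = \<lparr>carrier = Hom C A B, monoid.mult = Plus C, one = Zero C A B\<rparr>"

definition end_ring :: "('o, 'm) cat \<Rightarrow> 'o \<Rightarrow> 'm ring" where
  "end_ring C A = \<lparr>carrier = Hom C A A, monoid.mult = Comp C, one = Ident C A,
                   zero = Zero C A A, add = Plus C\<rparr>"

definition op_cat :: "('o, 'm) cat \<Rightarrow> ('o, 'm) cat" where
  "op_cat C = \<lparr>Obj = Obj C, Arr = Arr C, Src = Tgt C, Tgt = Src C, Ident = Ident C,
               Comp = (\<lambda>g f. f \<^bold>\<circ>\<^bsub>C\<^esub> g), Plus = Plus C, Zero = (\<lambda>A B. Zero C B A)\<rparr>"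

locale category =
  fixes C :: "('o, 'm) cat" (structure)
  assumes src_obj: "f \<in> Arr C \<Longrightarrow> Src C f \<in> Obj C"
    and tgt_obj: "f \<in> Arr C \<Longrightarrow> Tgt C f \<in> Obj C"
    and ident_hom: "A \<in> Obj C \<Longrightarrow> Ident C A \<in> Hom C A A"
    and comp_hom: "f \<in> Hom C A B \<Longrightarrow> g \<in> Hom C B D \<Longrightarrow> g \<^bold>\<circ> f \<in> Hom C A D"
    and comp_ident_right: "f \<in> Hom C A B \<Longrightarrow> f \<^bold>\<circ> Ident C A = f"
    and comp_ident_left: "f \<in> Hom C A B \<Longrightarrow> Ident C B \<^bold>\<circ> f = f"
    and comp_assoc: "f \<in> Hom C A B \<Longrightarrow> g \<in> Hom C B D \<Longrightarrow> h \<in> Hom C D E \<Longrightarrow>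
                       (h \<^bold>\<circ> g) \<^bold>\<circ> f = h \<^bold>\<circ> (g \<^bold>\<circ> f)"

locale preadditive_category = category +
  assumes hom_comm_group: "A \<in> Obj C \<Longrightarrow> B \<in> Obj C \<Longrightarrow> comm_group (hom_group C A B)"
    and comp_plus_right: "f \<in> Hom C A B \<Longrightarrow> f' \<in> Hom C A B \<Longrightarrow> g \<in> Hom C B D \<Longrightarrow>
                            g \<^bold>\<circ> (f \<^bold>+ f') = (g \<^bold>\<circ> f) \<^bold>+ (g \<^bold>\<circ> f')"
    and comp_plus_left: "f \<in> Hom C A B \<Longrightarrow> g \<in> Hom C B D \<Longrightarrow> g' \<in> Hom C B D \<Longrightarrow>
                            (g \<^bold>+ g') \<^bold>\<circ> f = (g \<^bold>\<circ> f) \<^bold>+ (g' \<^bold>\<circ> f)"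

definition is_mono :: "('o, 'm) cat \<Rightarrow> 'm \<Rightarrow> bool" where
  "is_mono C f \<longleftrightarrow> f \<in> Arr C \<and>
     (\<forall>D. \<forall>g \<in> Hom C D (Src C f). \<forall>h \<in> Hom C D (Src C f). f \<^bold>\<circ>\<^bsub>C\<^esub> g = f \<^bold>\<circ>\<^bsub>C\<^esub> h \<longrightarrow> g = h)"

definition is_epi :: "('o, 'm) cat \<Rightarrow> 'm \<Rightarrow> bool" where
  "is_epi C f \<longleftrightarrow> f \<in> Arr C \<and>
     (\<forall>D. \<forall>g \<in> Hom C (Tgt C f) D. \<forall>h \<in> Hom C (Tgt C f) D. g \<^bold>\<circ>\<^bsub>C\<^esub> f = h \<^bold>\<circ>\<^bsub>C\<^esub> f \<longrightarrow> g = h)"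

definition is_kernel :: "('o, 'm) cat \<Rightarrow> 'm \<Rightarrow> 'm \<Rightarrow> bool" where
  "is_kernel C k f \<longleftrightarrow> f \<in> Arr C \<and> k \<in> Arr C \<and> Tgt C k = Src C f \<and>
     f \<^bold>\<circ>\<^bsub>C\<^esub> k = Zero C (Src C k) (Tgt C f) \<and>
     (\<forall>D. \<forall>g \<in> Hom C D (Src C f). f \<^bold>\<circ>\<^bsub>C\<^esub> g = Zero C D (Tgt C f) \<longrightarrow>
        (\<exists>!h. h \<in> Hom C D (Src C k) \<and> k \<^bold>\<circ>\<^bsub>C\<^esub> h = g))"

definition is_cokernel :: "('o, 'm) cat \<Rightarrow> 'm \<Rightarrow> 'm \<Rightarrow> bool" where
  "is_cokernel C c f \<longleftrightarrow> f \<in> Arr C \<and> c \<in> Arr C \<and> Src C c = Tgt C f \<and>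
     c \<^bold>\<circ>\<^bsub>C\<^esub> f = Zero C (Src C f) (Tgt C c) \<and>
     (\<forall>D. \<forall>g \<in> Hom C (Tgt C f) D. g \<^bold>\<circ>\<^bsub>C\<^esub> f = Zero C (Src C f) D \<longrightarrow>
        (\<exists>!h. h \<in> Hom C (Tgt C c) D \<and> h \<^bold>\<circ>\<^bsub>C\<^esub> c = g))"

definition is_zero_object :: "('o, 'm) cat \<Rightarrow> 'o \<Rightarrow> bool" where
  "is_zero_object C Z \<longleftrightarrow> Z \<in> Obj C \<and>
     (\<forall>A \<in> Obj C. (\<exists>!f. f \<in> Hom C A Z) \<and> (\<exists>!f. f \<in> Hom C Z A))"

definition is_biproduct ::
    "('o, 'm) cat \<Rightarrow> 'o \<Rightarrow> 'o \<Rightarrow> 'o \<Rightarrow> 'm \<Rightarrow> 'm \<Rightarrow> 'm \<Rightarrow> 'm \<Rightarrow> bool" where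
  "is_biproduct C A B S i\<^sub>1 i\<^sub>2 p\<^sub>1 p\<^sub>2 \<longleftrightarrow> A \<in> Obj C \<and> B \<in> Obj C \<and> S \<in> Obj C \<and>
     i\<^sub>1 \<in> Hom C A S \<and> i\<^sub>2 \<in> Hom C B S \<and> p\<^sub>1 \<in> Hom C S A \<and> p\<^sub>2 \<in> Hom C S B \<and>
     p\<^sub>1 \<^bold>\<circ>\<^bsub>C\<^esub> i\<^sub>1 = Ident C A \<and> p\<^sub>2 \<^bold>\<circ>\<^bsub>C\<^esub> i\<^sub>2 = Ident C B \<and>
     p\<^sub>1 \<^bold>\<circ>\<^bsub>C\<^esub> i\<^sub>2 = Zero C B A \<and> p\<^sub>2 \<^bold>\<circ>\<^bsub>C\<^esub> i\<^sub>1 = Zero C A B \<and>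
     (i\<^sub>1 \<^bold>\<circ>\<^bsub>C\<^esub> p\<^sub>1) \<^bold>+\<^bsub>C\<^esub> (i\<^sub>2 \<^bold>\<circ>\<^bsub>C\<^esub> p\<^sub>2) = Ident C S"

text \<open>\<open>S\<close> is the direct sum of \<open>B 0, \<dots>, B (n - 1)\<close>; since \<^const>\<open>finprod\<close> is taken in
  \<^const>\<open>hom_group\<close>, it denotes the sum of arrows. For \<open>n = 0\<close> the condition says that \<open>S\<close> is a
  zero object.\<close>

definition is_finite_direct_sum :: "('o, 'm) cat \<Rightarrow> nat \<Rightarrow> (nat \<Rightarrow> 'o) \<Rightarrow> 'o \<Rightarrow> bool" where
  "is_finite_direct_sum C n B S \<longleftrightarrow> S \<in> Obj C \<and> (\<forall>k<n. B k \<in> Obj C) \<and>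
     (\<exists>i p. (\<forall>k<n. i k \<in> Hom C (B k) S \<and> p k \<in> Hom C S (B k)) \<and>
        (\<forall>j<n. \<forall>k<n. p j \<^bold>\<circ>\<^bsub>C\<^esub> i k = (if j = k then Ident C (B k) else Zero C (B k) (B j))) \<and>
        finprod (hom_group C S S) (\<lambda>k. i k \<^bold>\<circ>\<^bsub>C\<^esub> p k) {..<n} = Ident C S)"

locale abelian_category = preadditive_category +
  assumes ex_zero_object: "\<exists>Z. is_zero_object C Z"
    and ex_biproduct: "A \<in> Obj C \<Longrightarrow> B \<in> Obj C \<Longrightarrow> \<exists>S i\<^sub>1 i\<^sub>2 p\<^sub>1 p\<^sub>2. is_biproduct C A B S i\<^sub>1 i\<^sub>2 p\<^sub>1 p\<^sub>2"
    and ex_kernel: "f \<in> Arr C \<Longrightarrow> \<exists>k. is_kernel C k f"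
    and ex_cokernel: "f \<in> Arr C \<Longrightarrow> \<exists>c. is_cokernel C c f"
    and mono_is_kernel: "is_mono C f \<Longrightarrow> \<exists>g. is_kernel C f g"
    and epi_is_cokernel: "is_epi C f \<Longrightarrow> \<exists>g. is_cokernel C f g"

definition isomorphic :: "('o, 'm) cat \<Rightarrow> 'o \<Rightarrow> 'o \<Rightarrow> bool" where
  "isomorphic C A B \<longleftrightarrow>
     (\<exists>f \<in> Hom C A B. \<exists>g \<in> Hom C B A. g \<^bold>\<circ>\<^bsub>C\<^esub> f = Ident C A \<and> f \<^bold>\<circ>\<^bsub>C\<^esub> g = Ident C B)"

definition projective :: "('o, 'm) cat \<Rightarrow> 'o \<Rightarrow> bool" where
  "projective C P \<longleftrightarrow> P \<in> Obj C \<and>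
     (\<forall>e. is_epi C e \<longrightarrow>
        (\<forall>f \<in> Hom C P (Tgt C e). \<exists>g \<in> Hom C P (Src C e). e \<^bold>\<circ>\<^bsub>C\<^esub> g = f))"

definition injective :: "('o, 'm) cat \<Rightarrow> 'o \<Rightarrow> bool" where
  "injective C I \<longleftrightarrow> I \<in> Obj C \<and>
     (\<forall>m. is_mono C m \<longrightarrow>
        (\<forall>f \<in> Hom C (Src C m) I. \<exists>g \<in> Hom C (Tgt C m) I. g \<^bold>\<circ>\<^bsub>C\<^esub> m = f))"

definition enough_projectives :: "('o, 'm) cat \<Rightarrow> bool" where
  "enough_projectives C \<longleftrightarrow> (\<forall>A \<in> Obj C. \<exists>P. projective C P \<and> (\<exists>e \<in> Hom C P A. is_epi C e))"

definition enough_injectives :: "('o, 'm) cat \<Rightarrow> bool" where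
  "enough_injectives C \<longleftrightarrow> (\<forall>A \<in> Obj C. \<exists>I. injective C I \<and> (\<exists>m \<in> Hom C A I. is_mono C m))"


section \<open>Subcategories\<close>

text \<open>A full subcategory is given by its set of objects.\<close>

definition subcategory :: "('o, 'm) cat \<Rightarrow> 'o set \<Rightarrow> bool" where
  "subcategory C X \<longleftrightarrow> X \<subseteq> Obj C \<and>
     (\<forall>A \<in> X. \<forall>B. isomorphic C A B \<longrightarrow> B \<in> X) \<and>
     (\<forall>n B S. is_finite_direct_sum C n B S \<and> (\<forall>k<n. B k \<in> X) \<longrightarrow> S \<in> X)"

definition right_approximation :: "('o, 'm) cat \<Rightarrow> 'o set \<Rightarrow> 'o \<Rightarrow> 'm \<Rightarrow> bool" where
  "right_approximation C X A f \<longleftrightarrow> f \<in> Arr C \<and> Src C f \<in> X \<and> Tgt C f = A \<and>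
     (\<forall>X' \<in> X. \<forall>g \<in> Hom C X' A. \<exists>h \<in> Hom C X' (Src C f). f \<^bold>\<circ>\<^bsub>C\<^esub> h = g)"

definition left_approximation :: "('o, 'm) cat \<Rightarrow> 'o set \<Rightarrow> 'o \<Rightarrow> 'm \<Rightarrow> bool" where
  "left_approximation C X A f \<longleftrightarrow> f \<in> Arr C \<and> Src C f = A \<and> Tgt C f \<in> X \<and>
     (\<forall>X' \<in> X. \<forall>g \<in> Hom C A X'. \<exists>h \<in> Hom C (Tgt C f) X'. h \<^bold>\<circ>\<^bsub>C\<^esub> f = g)"

definition functorially_finite :: "('o, 'm) cat \<Rightarrow> 'o set \<Rightarrow> bool" where
  "functorially_finite C X \<longleftrightarrow>
     (\<forall>A \<in> Obj C. (\<exists>f. right_approximation C X A f) \<and> (\<exists>f. left_approximation C X A f))"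

definition closed_kernels_of_epis :: "('o, 'm) cat \<Rightarrow> 'o set \<Rightarrow> bool" where
  "closed_kernels_of_epis C X \<longleftrightarrow>
     (\<forall>f k. is_epi C f \<and> Src C f \<in> X \<and> Tgt C f \<in> X \<and> is_kernel C k f \<longrightarrow> Src C k \<in> X)"

definition closed_cokernels_of_monos :: "('o, 'm) cat \<Rightarrow> 'o set \<Rightarrow> bool" where
  "closed_cokernels_of_monos C X \<longleftrightarrow>
     (\<forall>f c. is_mono C f \<and> Src C f \<in> X \<and> Tgt C f \<in> X \<and> is_cokernel C c f \<longrightarrow> Tgt C c \<in> X)"

definition factors_through :: "('o, 'm) cat \<Rightarrow> ('o \<Rightarrow> bool) \<Rightarrow> 'm \<Rightarrow> bool" where
  "factors_through C \<P> h \<longleftrightarrow>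
     (\<exists>Q. \<P> Q \<and> (\<exists>u \<in> Hom C (Src C h) Q. \<exists>v \<in> Hom C Q (Tgt C h). h = v \<^bold>\<circ>\<^bsub>C\<^esub> u))"

definition stable_class :: "('o, 'm) cat \<Rightarrow> ('o \<Rightarrow> bool) \<Rightarrow> 'm \<Rightarrow> 'm set" where
  "stable_class C \<P> f = {g \<in> Hom C (Src C f) (Tgt C f).
     \<exists>h \<in> Hom C (Src C f) (Tgt C f). factors_through C \<P> h \<and> f = g \<^bold>+\<^bsub>C\<^esub> h}"

text \<open>The full subcategory on \<open>X\<close> modulo the arrows factoring through an object satisfying \<open>\<P>\<close>;
  the operations are computed on chosen representatives.\<close>

definition stable_cat :: "('o, 'm) cat \<Rightarrow> 'o set \<Rightarrow> ('o \<Rightarrow> bool) \<Rightarrow> ('o, 'm set) cat" where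
  "stable_cat C X \<P> = \<lparr>Obj = X,
     Arr = stable_class C \<P> ` {f \<in> Arr C. Src C f \<in> X \<and> Tgt C f \<in> X},
     Src = (\<lambda>u. Src C (SOME f. f \<in> u)),
     Tgt = (\<lambda>u. Tgt C (SOME f. f \<in> u)),
     Ident = (\<lambda>A. stable_class C \<P> (Ident C A)),
     Comp = (\<lambda>v u. stable_class C \<P> ((SOME g. g \<in> v) \<^bold>\<circ>\<^bsub>C\<^esub> (SOME f. f \<in> u))),
     Plus = (\<lambda>u v. stable_class C \<P> ((SOME f. f \<in> u) \<^bold>+\<^bsub>C\<^esub> (SOME g. g \<in> v))),
     Zero = (\<lambda>A B. stable_class C \<P> (Zero C A B))\<rparr>"

definition projectively_stable_cat :: "('o, 'm) cat \<Rightarrow> 'o set \<Rightarrow> ('o, 'm set) cat" where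
  "projectively_stable_cat C X = stable_cat C X (projective C)"

definition injectively_stable_cat :: "('o, 'm) cat \<Rightarrow> 'o set \<Rightarrow> ('o, 'm set) cat" where
  "injectively_stable_cat C X = stable_cat C X (injective C)"

definition has_split_idempotents :: "('o, 'm) cat \<Rightarrow> bool" where
  "has_split_idempotents C \<longleftrightarrow>
     (\<forall>A \<in> Obj C. \<forall>e \<in> Hom C A A. e \<^bold>\<circ>\<^bsub>C\<^esub> e = e \<longrightarrow>
        (\<exists>B \<in> Obj C. \<exists>r \<in> Hom C A B. \<exists>s \<in> Hom C B A. r \<^bold>\<circ>\<^bsub>C\<^esub> s = Ident C B \<and> s \<^bold>\<circ>\<^bsub>C\<^esub> r = e))"

text \<open>A not necessarily commutative ring is local if it is nonzero and the sum of any two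
  non-units is a non-unit.\<close>

definition local_ring :: "('a, 'b) ring_scheme \<Rightarrow> bool" where
  "local_ring R \<longleftrightarrow> ring R \<and> \<one>\<^bsub>R\<^esub> \<noteq> \<zero>\<^bsub>R\<^esub> \<and>
     (\<forall>x \<in> carrier R - Units R. \<forall>y \<in> carrier R - Units R. x \<oplus>\<^bsub>R\<^esub> y \<notin> Units R)"

definition krull_schmidt :: "('o, 'm) cat \<Rightarrow> bool" where
  "krull_schmidt C \<longleftrightarrow>
     (\<forall>A \<in> Obj C. \<exists>n B. is_finite_direct_sum C n B A \<and> (\<forall>k<n. local_ring (end_ring C (B k))))"


section \<open>The functor \<open>Ext\<^sup>1\<close>\<close>

text \<open>The Yoneda description: an extension \<open>0 \<rightarrow> B \<rightarrow> E \<rightarrow> A \<rightarrow> 0\<close> of \<open>A\<close> by \<open>B\<close> is the pair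
  \<open>(i, p)\<close> of its two arrows, and \<open>Ext\<^sup>1(A, B)\<close> is the set of equivalence classes of such
  extensions with the Baer sum.\<close>

definition short_exact :: "('o, 'm) cat \<Rightarrow> 'm \<times> 'm \<Rightarrow> bool" where
  "short_exact C x \<longleftrightarrow> is_kernel C (fst x) (snd x) \<and> is_cokernel C (snd x) (fst x)"

definition extensions :: "('o, 'm) cat \<Rightarrow> 'o \<Rightarrow> 'o \<Rightarrow> ('m \<times> 'm) set" where
  "extensions C A B = {x. short_exact C x \<and> Src C (fst x) = B \<and> Tgt C (snd x) = A}"

definition extension_morphism ::
    "('o, 'm) cat \<Rightarrow> 'm \<times> 'm \<Rightarrow> 'm \<times> 'm \<Rightarrow> 'm \<Rightarrow> 'm \<Rightarrow> 'm \<Rightarrow> bool" where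
  "extension_morphism C x y b e a \<longleftrightarrow>
     b \<in> Hom C (Src C (fst x)) (Src C (fst y)) \<and>
     e \<in> Hom C (Tgt C (fst x)) (Tgt C (fst y)) \<and>
     a \<in> Hom C (Tgt C (snd x)) (Tgt C (snd y)) \<and>
     e \<^bold>\<circ>\<^bsub>C\<^esub> fst x = fst y \<^bold>\<circ>\<^bsub>C\<^esub> b \<and> snd y \<^bold>\<circ>\<^bsub>C\<^esub> e = a \<^bold>\<circ>\<^bsub>C\<^esub> snd x"

definition extension_equiv :: "('o, 'm) cat \<Rightarrow> 'o \<Rightarrow> 'o \<Rightarrow> (('m \<times> 'm) \<times> ('m \<times> 'm)) set" where
  "extension_equiv C A B = {(x, y). x \<in> extensions C A B \<and> y \<in> extensions C A B \<and>
     (\<exists>e. extension_morphism C x y (Ident C B) e (Ident C A))}"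

text \<open>For \<open>b : B \<rightarrow> B'\<close>, the class \<open>b\<^sub>*\<xi>\<close> consists of the extensions \<open>y\<close> by \<open>B'\<close> that receive a
  morphism \<open>(b, e, 1)\<close> from a representative of \<open>\<xi>\<close>; equivalently, \<open>y\<close> is obtained from it by
  pushout along \<open>b\<close>. Dually for the pullback \<open>a\<^sup>*\<xi>\<close> along \<open>a : A' \<rightarrow> A\<close>.\<close>

definition ext_push :: "('o, 'm) cat \<Rightarrow> 'm \<Rightarrow> ('m \<times> 'm) set \<Rightarrow> ('m \<times> 'm) set" where
  "ext_push C b \<xi> = {y. \<exists>x \<in> \<xi>. y \<in> extensions C (Tgt C (snd x)) (Tgt C b) \<and>
     (\<exists>e. extension_morphism C x y b e (Ident C (Tgt C (snd x))))}"

definition ext_pull :: "('o, 'm) cat \<Rightarrow> 'm \<Rightarrow> ('m \<times> 'm) set \<Rightarrow> ('m \<times> 'm) set" where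
  "ext_pull C a \<xi> = {y. \<exists>x \<in> \<xi>. y \<in> extensions C (Src C a) (Src C (fst x)) \<and>
     (\<exists>e. extension_morphism C y x (Ident C (Src C (fst x))) e a)}"

text \<open>The Baer sum \<open>\<nabla>\<^sub>* \<Delta>\<^sup>* (x \<oplus> y)\<close>, with \<open>\<nabla> = p\<^sub>1 + p\<^sub>2 : B \<oplus> B \<rightarrow> B\<close> and
  \<open>\<Delta> = k\<^sub>1 + k\<^sub>2 : A \<rightarrow> A \<oplus> A\<close>. No biproducts are chosen: the class is the union over all choices of
  the biproducts \<open>S = B \<oplus> B\<close>, \<open>T = A \<oplus> A\<close> and \<open>U\<close> (of the two middle terms).\<close>

definition baer_sum ::
    "('o, 'm) cat \<Rightarrow> 'o \<Rightarrow> 'o \<Rightarrow> ('m \<times> 'm) set \<Rightarrow> ('m \<times> 'm) set \<Rightarrow> ('m \<times> 'm) set" where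
  "baer_sum C A B \<xi> \<eta> = {z. \<exists>x \<in> \<xi>. \<exists>y \<in> \<eta>.
     \<exists>S i\<^sub>1 i\<^sub>2 p\<^sub>1 p\<^sub>2 T k\<^sub>1 k\<^sub>2 q\<^sub>1 q\<^sub>2 U j\<^sub>1 j\<^sub>2 r\<^sub>1 r\<^sub>2.
       is_biproduct C B B S i\<^sub>1 i\<^sub>2 p\<^sub>1 p\<^sub>2 \<and> is_biproduct C A A T k\<^sub>1 k\<^sub>2 q\<^sub>1 q\<^sub>2 \<and>
       is_biproduct C (Tgt C (fst x)) (Tgt C (fst y)) U j\<^sub>1 j\<^sub>2 r\<^sub>1 r\<^sub>2 \<and>
       z \<in> ext_push C (p\<^sub>1 \<^bold>+\<^bsub>C\<^esub> p\<^sub>2) (ext_pull C (k\<^sub>1 \<^bold>+\<^bsub>C\<^esub> k\<^sub>2)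
         {((j\<^sub>1 \<^bold>\<circ>\<^bsub>C\<^esub> fst x \<^bold>\<circ>\<^bsub>C\<^esub> p\<^sub>1) \<^bold>+\<^bsub>C\<^esub> (j\<^sub>2 \<^bold>\<circ>\<^bsub>C\<^esub> fst y \<^bold>\<circ>\<^bsub>C\<^esub> p\<^sub>2),
           (k\<^sub>1 \<^bold>\<circ>\<^bsub>C\<^esub> snd x \<^bold>\<circ>\<^bsub>C\<^esub> r\<^sub>1) \<^bold>+\<^bsub>C\<^esub> (k\<^sub>2 \<^bold>\<circ>\<^bsub>C\<^esub> snd y \<^bold>\<circ>\<^bsub>C\<^esub> r\<^sub>2))})}"

definition split_extensions :: "('o, 'm) cat \<Rightarrow> 'o \<Rightarrow> 'o \<Rightarrow> ('m \<times> 'm) set" where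
  "split_extensions C A B = {x \<in> extensions C A B.
     \<exists>s \<in> Hom C A (Src C (snd x)). snd x \<^bold>\<circ>\<^bsub>C\<^esub> s = Ident C A}"

definition Ext1 :: "('o, 'm) cat \<Rightarrow> 'o \<Rightarrow> 'o \<Rightarrow> ('m \<times> 'm) set monoid" where
  "Ext1 C A B = \<lparr>carrier = extensions C A B // extension_equiv C A B,
                 monoid.mult = baer_sum C A B, one = split_extensions C A B\<rparr>"


section \<open>Additive functors to abelian groups\<close>

record ('o, 'm, 'g) ab_functor =
  FObj :: "'o \<Rightarrow> 'g monoid"
  FMap :: "'m \<Rightarrow> 'g \<Rightarrow> 'g"

text \<open>Covariant functors on the full subcategory \<open>X\<close>: only the values on objects and arrows of \<open>X\<close>
  matter, so restriction to \<open>X\<close> leaves the record unchanged. Contravariant functors are functors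
  on \<^const>\<open>op_cat\<close>.\<close>

definition additive_functor :: "('o, 'm) cat \<Rightarrow> 'o set \<Rightarrow> ('o, 'm, 'g) ab_functor \<Rightarrow> bool" where
  "additive_functor C X F \<longleftrightarrow>
     (\<forall>A \<in> X. comm_group (FObj F A)) \<and>
     (\<forall>A \<in> X. \<forall>B \<in> X. \<forall>f \<in> Hom C A B. FMap F f \<in> hom (FObj F A) (FObj F B)) \<and>
     (\<forall>A \<in> X. \<forall>x \<in> carrier (FObj F A). FMap F (Ident C A) x = x) \<and>
     (\<forall>A \<in> X. \<forall>B \<in> X. \<forall>D \<in> X. \<forall>f \<in> Hom C A B. \<forall>g \<in> Hom C B D. \<forall>x \<in> carrier (FObj F A).
        FMap F (g \<^bold>\<circ>\<^bsub>C\<^esub> f) x = FMap F g (FMap F f x)) \<and>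
     (\<forall>A \<in> X. \<forall>B \<in> X. \<forall>f \<in> Hom C A B. \<forall>g \<in> Hom C A B. \<forall>x \<in> carrier (FObj F A).
        FMap F (f \<^bold>+\<^bsub>C\<^esub> g) x = FMap F f x \<otimes>\<^bsub>FObj F B\<^esub> FMap F g x)"

definition functor_iso ::
    "('o, 'm) cat \<Rightarrow> 'o set \<Rightarrow> ('o, 'm, 'g) ab_functor \<Rightarrow> ('o, 'm, 'h) ab_functor \<Rightarrow> bool" where
  "functor_iso C X F G \<longleftrightarrow> (\<exists>\<tau>.
     (\<forall>A \<in> X. \<tau> A \<in> iso (FObj F A) (FObj G A)) \<and>
     (\<forall>A \<in> X. \<forall>B \<in> X. \<forall>f \<in> Hom C A B. \<forall>x \<in> carrier (FObj F A).
        \<tau> B (FMap F f x) = FMap G f (\<tau> A x)))"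

definition functor_sum ::
    "('o, 'm, 'g) ab_functor \<Rightarrow> ('o, 'm, 'h) ab_functor \<Rightarrow> ('o, 'm, 'g \<times> 'h) ab_functor" where
  "functor_sum F G = \<lparr>FObj = (\<lambda>A. FObj F A \<times>\<times> FObj G A),
                      FMap = (\<lambda>f. map_prod (FMap F f) (FMap G f))\<rparr>"

text \<open>\<open>F\<close> is a direct summand of \<open>E\<close> with complement \<open>G\<close>. The complement is an explicit argument
  because HOL cannot quantify existentially over the type of its elements.\<close>

definition direct_summand_compl :: "('o, 'm) cat \<Rightarrow> 'o set \<Rightarrow> ('o, 'm, 'g) ab_functor \<Rightarrow>
    ('o, 'm, 'h) ab_functor \<Rightarrow> ('o, 'm, 'e) ab_functor \<Rightarrow> bool" where
  "direct_summand_compl C X F G E \<longleftrightarrow>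
     additive_functor C X F \<and> additive_functor C X G \<and> functor_iso C X E (functor_sum F G)"

definition Ext1_cov :: "('o, 'm) cat \<Rightarrow> 'o \<Rightarrow> ('o, 'm, ('m \<times> 'm) set) ab_functor" where
  "Ext1_cov C A = \<lparr>FObj = (\<lambda>B. Ext1 C A B), FMap = ext_push C\<rparr>"

definition Ext1_contra :: "('o, 'm) cat \<Rightarrow> 'o \<Rightarrow> ('o, 'm, ('m \<times> 'm) set) ab_functor" where
  "Ext1_contra C A = \<lparr>FObj = (\<lambda>B. Ext1 C B A), FMap = ext_pull C\<rparr>"

end

theory Submission
  imports Defs
begin

text \<open>Let \<open>0 \<rightarrow> K \<rightarrow> P \<rightarrow> A \<rightarrow> 0\<close> be a projective presentation with class \<open>\<xi> \<in> Ext\<^sup>1(A, K)\<close>. Every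
  class in \<open>Ext\<^sup>1(A, Y)\<close> is a pushout of \<open>\<xi>\<close>, so a natural transformation
  \<open>Ext\<^sup>1(A, -) \<rightarrow> Ext\<^sup>1(B, -)\<close> on \<open>\<X>\<close> is determined by the image of \<open>\<xi>\<close>; this image vanishes in
  \<open>Ext\<^sup>1(B, P)\<close>, hence equals \<open>a\<^sup>*\<xi>\<close> for some \<open>a : B \<rightarrow> A\<close>, which is unique up to arrows factoring
  through projectives. The idempotent of \<open>Ext\<^sup>1(A, -)\<close> belonging to a direct summand is therefore
  \<open>a\<^sup>*\<close> for an idempotent \<open>a\<close> of the stable category, and a splitting of \<open>a\<close> through \<open>B\<close> identifies
  the summand with \<open>Ext\<^sup>1(B, -)\<close>.

  In the Krull--Schmidt case idempotents of the stable category split: an idempotent \<open>e\<close> of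
  \<open>A \<oplus> B\<close> with \<open>End(B)\<close> local has a \<open>B\<close>-corner such that it or its complement is invertible; splitting
  off this corner from \<open>e\<close> or \<open>1 - e\<close> leaves an idempotent of \<open>A\<close>, and one inducts on the number of
  summands. The contravariant statements follow by passing to the opposite category, where the
  orders of pushout and pullback in the Baer sum are exchanged.\<close>


section \<open>Preadditive categories\<close>

text \<open>\<open>baer_sum\<close> ranges over all choices of three biproducts and is awkward to
  compute with. Its properties are therefore derived from a presentation: classes written as
  pushouts of \<xi> are added by adding arrows in Hom(K, Y), which is \<open>ext_push_plus\<close>.
  The same presentation explains the closure condition on \<open>X\<close>. Naturality is applied at
  K and along K -> P, so both objects must lie in \<open>X\<close>: P because it is projective, K
  because it is the kernel of an epi from P to A.

  Extensions related by pushout or pullback are handled through the relation \<open>ext_map\<close>.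
  Two factorization lemmas, dual to each other, then take the place of universal properties.

  In the Krull-Schmidt case the obstacle is that an idempotent of the stable category is only given
  up to arrows through projectives. Instead of lifting it, the whole elimination is carried out in
  the stable category. An indecomposable summand may become zero there, so its stable endomorphism
  ring need not be local; what does pass to the quotient is that d or 1 - d is invertible for every
  endomorphism d.\<close>

lemma in_Hom: "f \<in> Hom C A B \<longleftrightarrow> f \<in> Arr C \<and> Src C f = A \<and> Tgt C f = B"
  by (simp add: Hom_def)

context category begin

lemma Hom_objs: "f \<in> Hom C A B \<Longrightarrow> A \<in> Obj C \<and> B \<in> Obj C"
  using src_obj tgt_obj by (auto simp: in_Hom)

lemma comp_typing [simp]:
  assumes "f \<in> Arr C" "g \<in> Arr C" "Tgt C f = Src C g"
  shows "g \<^bold>\<circ> f \<in> Arr C" "Src C (g \<^bold>\<circ> f) = Src C f" "Tgt C (g \<^bold>\<circ> f) = Tgt C g"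
  using comp_hom[of f "Src C f" "Tgt C f" g "Tgt C g"] assms by (auto simp: in_Hom)

lemma ident_typing [simp]:
  assumes "A \<in> Obj C"
  shows "Ident C A \<in> Arr C" "Src C (Ident C A) = A" "Tgt C (Ident C A) = A"
  using ident_hom[OF assms] by (auto simp: in_Hom)

lemma comp_ident [simp]:
  assumes "f \<in> Arr C"
  shows "Src C f = A \<Longrightarrow> f \<^bold>\<circ> Ident C A = f" "Tgt C f = B \<Longrightarrow> Ident C B \<^bold>\<circ> f = f"
  using comp_ident_right[of f "Src C f" "Tgt C f"] comp_ident_left[of f "Src C f" "Tgt C f"] assms
  by (auto simp: in_Hom)

lemma assoc [simp]:
  assumes "f \<in> Arr C" "g \<in> Arr C" "h \<in> Arr C" "Tgt C f = Src C g" "Tgt C g = Src C h"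
  shows "(h \<^bold>\<circ> g) \<^bold>\<circ> f = h \<^bold>\<circ> g \<^bold>\<circ> f"
  using comp_assoc[of f "Src C f" "Tgt C f" g "Tgt C g" h "Tgt C h"] assms by (auto simp: in_Hom)

text \<open>Simplification nests composites to the right, and an equation for \<open>g\<close> after
  \<open>f\<close> no longer matches once a further factor \<open>k\<close> follows. This form
  applies such an equation at the head of a longer composite.\<close>

lemma comp_cong_left:
  assumes "g \<^bold>\<circ> f = h" "f \<in> Arr C" "g \<in> Arr C" "Tgt C f = Src C g" "k \<in> Arr C" "Tgt C k = Src C f"
  shows "g \<^bold>\<circ> f \<^bold>\<circ> k = h \<^bold>\<circ> k"
  using assms assoc[of k f g] by simp

end

context preadditive_category begin

lemma plus_typing [simp]:
  assumes "f \<in> Arr C" "g \<in> Arr C" "Src C f = Src C g" "Tgt C f = Tgt C g"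
  shows "f \<^bold>+ g \<in> Arr C" "Src C (f \<^bold>+ g) = Src C f" "Tgt C (f \<^bold>+ g) = Tgt C f"
proof -
  interpret G: comm_group "hom_group C (Src C f) (Tgt C f)"
    by (rule hom_comm_group) (use assms src_obj tgt_obj in auto)
  from G.m_closed[of f g] assms
  show "f \<^bold>+ g \<in> Arr C" "Src C (f \<^bold>+ g) = Src C f" "Tgt C (f \<^bold>+ g) = Tgt C f"
    by (auto simp: hom_group_def in_Hom)
qed

lemma zero_typing [simp]:
  assumes "A \<in> Obj C" "B \<in> Obj C"
  shows "Zero C A B \<in> Arr C" "Src C (Zero C A B) = A" "Tgt C (Zero C A B) = B"
proof -
  interpret G: comm_group "hom_group C A B" by (rule hom_comm_group) (use assms in auto)
  from G.one_closed show "Zero C A B \<in> Arr C" "Src C (Zero C A B) = A" "Tgt C (Zero C A B) = B"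
    by (auto simp: hom_group_def in_Hom)
qed

lemma plus_assoc:
  assumes "f \<in> Arr C" "g \<in> Arr C" "h \<in> Arr C"
    "Src C f = Src C g" "Tgt C f = Tgt C g" "Src C g = Src C h" "Tgt C g = Tgt C h"
  shows "(f \<^bold>+ g) \<^bold>+ h = f \<^bold>+ (g \<^bold>+ h)"
proof -
  interpret G: comm_group "hom_group C (Src C f) (Tgt C f)"
    by (rule hom_comm_group) (use assms src_obj tgt_obj in auto)
  from G.m_assoc[of f g h] assms show ?thesis by (auto simp: hom_group_def in_Hom)
qed

lemma plus_comm:
  assumes "f \<in> Arr C" "g \<in> Arr C" "Src C f = Src C g" "Tgt C f = Tgt C g"
  shows "f \<^bold>+ g = g \<^bold>+ f"
proof -
  interpret G: comm_group "hom_group C (Src C f) (Tgt C f)"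
    by (rule hom_comm_group) (use assms src_obj tgt_obj in auto)
  from G.m_comm[of f g] assms show ?thesis by (auto simp: hom_group_def in_Hom)
qed

lemma plus_left_comm:
  assumes "f \<in> Arr C" "g \<in> Arr C" "h \<in> Arr C"
    "Src C f = Src C g" "Tgt C f = Tgt C g" "Src C g = Src C h" "Tgt C g = Tgt C h"
  shows "f \<^bold>+ (g \<^bold>+ h) = g \<^bold>+ (f \<^bold>+ h)"
  using assms plus_assoc[of f g h] plus_assoc[of g f h] plus_comm[of f g] by simp

lemma plus_zero [simp]:
  assumes "f \<in> Arr C" "Src C f = A" "Tgt C f = B"
  shows "f \<^bold>+ Zero C A B = f" "Zero C A B \<^bold>+ f = f"
proof -
  interpret G: comm_group "hom_group C A B"
    by (rule hom_comm_group) (use assms src_obj tgt_obj in auto)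
  from G.r_one[of f] G.l_one[of f] assms show "f \<^bold>+ Zero C A B = f" "Zero C A B \<^bold>+ f = f"
    by (auto simp: hom_group_def in_Hom)
qed

definition neg where "neg f = m_inv (hom_group C (Src C f) (Tgt C f)) f"

lemma neg_typing [simp]:
  assumes "f \<in> Arr C"
  shows "neg f \<in> Arr C" "Src C (neg f) = Src C f" "Tgt C (neg f) = Tgt C f"
proof -
  interpret G: comm_group "hom_group C (Src C f) (Tgt C f)"
    by (rule hom_comm_group) (use assms src_obj tgt_obj in auto)
  from G.inv_closed[of f] assms
  show "neg f \<in> Arr C" "Src C (neg f) = Src C f" "Tgt C (neg f) = Tgt C f"
    by (auto simp: hom_group_def in_Hom neg_def)
qed

lemma plus_neg [simp]:
  assumes "f \<in> Arr C"
  shows "f \<^bold>+ neg f = Zero C (Src C f) (Tgt C f)" "neg f \<^bold>+ f = Zero C (Src C f) (Tgt C f)"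
proof -
  interpret G: comm_group "hom_group C (Src C f) (Tgt C f)"
    by (rule hom_comm_group) (use assms src_obj tgt_obj in auto)
  from G.r_inv[of f] G.l_inv[of f] assms
  show "f \<^bold>+ neg f = Zero C (Src C f) (Tgt C f)" "neg f \<^bold>+ f = Zero C (Src C f) (Tgt C f)"
    by (auto simp: hom_group_def in_Hom neg_def)
qed

lemma plus_neg_cancel [simp]:
  assumes "f \<in> Arr C" "g \<in> Arr C" "Src C f = Src C g" "Tgt C f = Tgt C g"
  shows "f \<^bold>+ (neg f \<^bold>+ g) = g" "neg f \<^bold>+ (f \<^bold>+ g) = g"
    "f \<^bold>+ (g \<^bold>+ neg f) = g" "neg f \<^bold>+ (g \<^bold>+ f) = g"
  using assms plus_assoc[of f "neg f" g, symmetric] plus_assoc[of "neg f" f g, symmetric]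
    plus_comm[of g "neg f"] plus_comm[of g f] by (simp_all del: plus_typing)

lemma plus_left_cancel:
  assumes "f \<in> Arr C" "g \<in> Arr C" "h \<in> Arr C"
    "Src C f = Src C g" "Tgt C f = Tgt C g" "Src C g = Src C h" "Tgt C g = Tgt C h"
  shows "f \<^bold>+ g = f \<^bold>+ h \<longleftrightarrow> g = h"
  using assms plus_neg_cancel(2)[of f g] plus_neg_cancel(2)[of f h] by metis

lemma distrib_left:
  assumes "f \<in> Arr C" "f' \<in> Arr C" "g \<in> Arr C" "Src C f = Src C f'" "Tgt C f = Tgt C f'"
    "Tgt C f' = Src C g"
  shows "g \<^bold>\<circ> (f \<^bold>+ f') = g \<^bold>\<circ> f \<^bold>+ g \<^bold>\<circ> f'"
  using comp_plus_right[of f "Src C f" "Tgt C f" f' g "Tgt C g"] assms by (auto simp: in_Hom)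

lemma distrib_right:
  assumes "f \<in> Arr C" "g' \<in> Arr C" "g \<in> Arr C" "Src C g = Src C g'" "Tgt C g = Tgt C g'"
    "Tgt C f = Src C g'"
  shows "(g \<^bold>+ g') \<^bold>\<circ> f = g \<^bold>\<circ> f \<^bold>+ g' \<^bold>\<circ> f"
  using comp_plus_left[of f "Src C f" "Tgt C f" g "Tgt C g" g'] assms by (auto simp: in_Hom)

lemmas distrib = distrib_left distrib_right

text \<open>Cancellation in the hom-group. Together with distributivity it makes composites with
  zero arrows vanish in \<open>comp_zero\<close>.\<close>

lemma self_plus_eq:
  assumes "f \<in> Arr C" "f \<^bold>+ f = f"
  shows "f = Zero C (Src C f) (Tgt C f)"
  using assms plus_left_cancel[of f f "Zero C (Src C f) (Tgt C f)"] src_obj tgt_obj by simp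

lemma comp_zero [simp]:
  assumes "f \<in> Arr C"
  shows "Tgt C f = A \<Longrightarrow> B \<in> Obj C \<Longrightarrow> Zero C A B \<^bold>\<circ> f = Zero C (Src C f) B"
    "Src C f = B \<Longrightarrow> A \<in> Obj C \<Longrightarrow> f \<^bold>\<circ> Zero C A B = Zero C A (Tgt C f)"
proof -
  assume a: "Tgt C f = A" "B \<in> Obj C"
  then have "A \<in> Obj C" using assms tgt_obj by auto
  with a assms distrib_right[of f "Zero C A B" "Zero C A B"] self_plus_eq[of "Zero C A B \<^bold>\<circ> f"]
  show "Zero C A B \<^bold>\<circ> f = Zero C (Src C f) B" by simp
next
  assume a: "Src C f = B" "A \<in> Obj C"
  then have "B \<in> Obj C" using assms src_obj by auto
  with a assms distrib_left[of "Zero C A B" "Zero C A B" f] self_plus_eq[of "f \<^bold>\<circ> Zero C A B"]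
  show "f \<^bold>\<circ> Zero C A B = Zero C A (Tgt C f)" by simp
qed

lemma neg_unique:
  assumes "f \<in> Arr C" "g \<in> Arr C" "Src C f = Src C g" "Tgt C f = Tgt C g"
    "f \<^bold>+ g = Zero C (Src C f) (Tgt C f)"
  shows "g = neg f"
proof -
  have "neg f = neg f \<^bold>+ (f \<^bold>+ g)" using assms(1-4) by (simp add: assms(5) del: plus_neg_cancel)
  then show ?thesis using assms(1-4) by simp
qed

lemma comp_neg [simp]:
  assumes "f \<in> Arr C" "g \<in> Arr C" "Tgt C f = Src C g"
  shows "g \<^bold>\<circ> neg f = neg (g \<^bold>\<circ> f)" "neg g \<^bold>\<circ> f = neg (g \<^bold>\<circ> f)"
proof -
  show "g \<^bold>\<circ> neg f = neg (g \<^bold>\<circ> f)"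
    using assms src_obj tgt_obj by (intro neg_unique) (simp_all add: distrib_left[symmetric])
  show "neg g \<^bold>\<circ> f = neg (g \<^bold>\<circ> f)"
    using assms src_obj tgt_obj by (intro neg_unique) (simp_all add: distrib_right[symmetric])
qed

lemma neg_zero [simp]: "A \<in> Obj C \<Longrightarrow> B \<in> Obj C \<Longrightarrow> neg (Zero C A B) = Zero C A B"
  using neg_unique[of "Zero C A B" "Zero C A B"] by simp

lemma neg_neg [simp]: "f \<in> Arr C \<Longrightarrow> neg (neg f) = f"
  using neg_unique[of "neg f" f] by simp

lemma neg_plus [simp]:
  assumes "f \<in> Arr C" "g \<in> Arr C" "Src C f = Src C g" "Tgt C f = Tgt C g"
  shows "neg (f \<^bold>+ g) = neg f \<^bold>+ neg g"
proof -
  have "(f \<^bold>+ g) \<^bold>+ (neg f \<^bold>+ neg g) = Zero C (Src C f) (Tgt C f)"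
    using assms by (simp add: plus_comm[of f g] plus_assoc)
  with assms show ?thesis by (intro neg_unique[symmetric]) simp_all
qed

lemma minus_eq_zero_iff:
  assumes "f \<in> Arr C" "g \<in> Arr C" "Src C f = Src C g" "Tgt C f = Tgt C g"
  shows "f \<^bold>+ neg g = Zero C (Src C f) (Tgt C f) \<longleftrightarrow> f = g"
proof
  assume "f \<^bold>+ neg g = Zero C (Src C f) (Tgt C f)"
  with assms show "f = g" using neg_unique[of "neg g" f] by (simp add: plus_comm[of f])
qed (use assms in simp)

lemma eq_minus_iff:
  assumes "f \<in> Arr C" "g \<in> Arr C" "h \<in> Arr C"
    "Src C f = Src C g" "Tgt C f = Tgt C g" "Src C g = Src C h" "Tgt C g = Tgt C h"
  shows "f = g \<^bold>+ neg h \<longleftrightarrow> f \<^bold>+ h = g"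
proof
  assume e: "f = g \<^bold>+ neg h"
  show "f \<^bold>+ h = g" unfolding e using assms(2-) by (simp add: plus_assoc)
next
  assume e: "f \<^bold>+ h = g"
  show "f = g \<^bold>+ neg h" unfolding e[symmetric] using assms(1,3-) by (simp add: plus_assoc)
qed

section \<open>Calculus of biproducts\<close>

lemma biproductD:
  assumes "is_biproduct C A B S i\<^sub>1 i\<^sub>2 p\<^sub>1 p\<^sub>2"
  shows "A \<in> Obj C" "B \<in> Obj C" "S \<in> Obj C"
    "i\<^sub>1 \<in> Arr C" "Src C i\<^sub>1 = A" "Tgt C i\<^sub>1 = S" "i\<^sub>2 \<in> Arr C" "Src C i\<^sub>2 = B" "Tgt C i\<^sub>2 = S"
    "p\<^sub>1 \<in> Arr C" "Src C p\<^sub>1 = S" "Tgt C p\<^sub>1 = A" "p\<^sub>2 \<in> Arr C" "Src C p\<^sub>2 = S" "Tgt C p\<^sub>2 = B"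
    "p\<^sub>1 \<^bold>\<circ> i\<^sub>1 = Ident C A" "p\<^sub>2 \<^bold>\<circ> i\<^sub>2 = Ident C B"
    "p\<^sub>1 \<^bold>\<circ> i\<^sub>2 = Zero C B A" "p\<^sub>2 \<^bold>\<circ> i\<^sub>1 = Zero C A B"
    "(i\<^sub>1 \<^bold>\<circ> p\<^sub>1) \<^bold>+ (i\<^sub>2 \<^bold>\<circ> p\<^sub>2) = Ident C S"
  using assms by (auto simp: is_biproduct_def in_Hom)

lemma biproduct_comp:
  assumes "is_biproduct C A B S i\<^sub>1 i\<^sub>2 p\<^sub>1 p\<^sub>2" "f \<in> Arr C"
  shows "Tgt C f = A \<Longrightarrow> p\<^sub>1 \<^bold>\<circ> i\<^sub>1 \<^bold>\<circ> f = f" "Tgt C f = B \<Longrightarrow> p\<^sub>2 \<^bold>\<circ> i\<^sub>2 \<^bold>\<circ> f = f"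
    "Tgt C f = B \<Longrightarrow> p\<^sub>1 \<^bold>\<circ> i\<^sub>2 \<^bold>\<circ> f = Zero C (Src C f) A"
    "Tgt C f = A \<Longrightarrow> p\<^sub>2 \<^bold>\<circ> i\<^sub>1 \<^bold>\<circ> f = Zero C (Src C f) B"
    "Tgt C f = S \<Longrightarrow> (i\<^sub>1 \<^bold>\<circ> p\<^sub>1 \<^bold>\<circ> f) \<^bold>+ (i\<^sub>2 \<^bold>\<circ> p\<^sub>2 \<^bold>\<circ> f) = f"
    "Src C f = S \<Longrightarrow> (f \<^bold>\<circ> i\<^sub>1 \<^bold>\<circ> p\<^sub>1) \<^bold>+ (f \<^bold>\<circ> i\<^sub>2 \<^bold>\<circ> p\<^sub>2) = f"
proof -
  note b = biproductD[OF assms(1)]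
  show "Tgt C f = A \<Longrightarrow> p\<^sub>1 \<^bold>\<circ> i\<^sub>1 \<^bold>\<circ> f = f" "Tgt C f = B \<Longrightarrow> p\<^sub>2 \<^bold>\<circ> i\<^sub>2 \<^bold>\<circ> f = f"
    "Tgt C f = B \<Longrightarrow> p\<^sub>1 \<^bold>\<circ> i\<^sub>2 \<^bold>\<circ> f = Zero C (Src C f) A"
    "Tgt C f = A \<Longrightarrow> p\<^sub>2 \<^bold>\<circ> i\<^sub>1 \<^bold>\<circ> f = Zero C (Src C f) B"
    using b assms(2) by (simp_all add: comp_cong_left)
  show "Tgt C f = S \<Longrightarrow> (i\<^sub>1 \<^bold>\<circ> p\<^sub>1 \<^bold>\<circ> f) \<^bold>+ (i\<^sub>2 \<^bold>\<circ> p\<^sub>2 \<^bold>\<circ> f) = f"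
    using b assms(2) distrib_right[of f "i\<^sub>2 \<^bold>\<circ> p\<^sub>2" "i\<^sub>1 \<^bold>\<circ> p\<^sub>1"] by simp
  show "Src C f = S \<Longrightarrow> (f \<^bold>\<circ> i\<^sub>1 \<^bold>\<circ> p\<^sub>1) \<^bold>+ (f \<^bold>\<circ> i\<^sub>2 \<^bold>\<circ> p\<^sub>2) = f"
    using b assms(2) distrib_left[of "i\<^sub>1 \<^bold>\<circ> p\<^sub>1" "i\<^sub>2 \<^bold>\<circ> p\<^sub>2" f] by simp
qed

lemma biproduct_arr_eqI:
  assumes "is_biproduct C A B S i\<^sub>1 i\<^sub>2 p\<^sub>1 p\<^sub>2" "f \<in> Arr C" "g \<in> Arr C" "Tgt C f = S" "Tgt C g = S"
    "p\<^sub>1 \<^bold>\<circ> f = p\<^sub>1 \<^bold>\<circ> g" "p\<^sub>2 \<^bold>\<circ> f = p\<^sub>2 \<^bold>\<circ> g"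
  shows "f = g"
  using biproduct_comp(5)[OF assms(1,2)] biproduct_comp(5)[OF assms(1,3)] assms(4-7) by metis

lemma biproduct_arr_eqI':
  assumes "is_biproduct C A B S i\<^sub>1 i\<^sub>2 p\<^sub>1 p\<^sub>2" "f \<in> Arr C" "g \<in> Arr C" "Src C f = S" "Src C g = S"
    "f \<^bold>\<circ> i\<^sub>1 = g \<^bold>\<circ> i\<^sub>1" "f \<^bold>\<circ> i\<^sub>2 = g \<^bold>\<circ> i\<^sub>2"
  shows "f = g"
proof -
  note b = biproductD[OF assms(1)]
  have "f = (f \<^bold>\<circ> i\<^sub>1) \<^bold>\<circ> p\<^sub>1 \<^bold>+ (f \<^bold>\<circ> i\<^sub>2) \<^bold>\<circ> p\<^sub>2" using biproduct_comp(6)[OF assms(1,2)] b assms(2-5) by simp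
  also have "\<dots> = (g \<^bold>\<circ> i\<^sub>1) \<^bold>\<circ> p\<^sub>1 \<^bold>+ (g \<^bold>\<circ> i\<^sub>2) \<^bold>\<circ> p\<^sub>2" using assms by simp
  also have "\<dots> = g" using biproduct_comp(6)[OF assms(1,3)] b assms(2-5) by simp
  finally show ?thesis .
qed

end


section \<open>Abelian categories and duality\<close>

lemma op_cat_simps [simp]:
  "Obj (op_cat C) = Obj C" "Arr (op_cat C) = Arr C" "Src (op_cat C) = Tgt C" "Tgt (op_cat C) = Src C"
  "Ident (op_cat C) = Ident C" "g \<^bold>\<circ>\<^bsub>op_cat C\<^esub> f = f \<^bold>\<circ>\<^bsub>C\<^esub> g" "Plus (op_cat C) = Plus C"
  "Zero (op_cat C) A B = Zero C B A" "Hom (op_cat C) A B = Hom C B A"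
  "hom_group (op_cat C) A B = hom_group C B A"
  by (auto simp: op_cat_def Hom_def hom_group_def)

lemma op_cat_op_cat [simp]: "op_cat (op_cat C) = C"
  by (simp add: op_cat_def)

text \<open>With these rules a dual statement is the original one instantiated at
  \<open>op_cat C\<close>. Biproducts exchange their injections and projections.\<close>

lemma op_cat_notions [simp]:
  "is_mono (op_cat C) f \<longleftrightarrow> is_epi C f" "is_epi (op_cat C) f \<longleftrightarrow> is_mono C f"
  "is_kernel (op_cat C) k f \<longleftrightarrow> is_cokernel C k f" "is_cokernel (op_cat C) k f \<longleftrightarrow> is_kernel C k f"
  "is_biproduct (op_cat C) A B S i\<^sub>1 i\<^sub>2 p\<^sub>1 p\<^sub>2 \<longleftrightarrow> is_biproduct C A B S p\<^sub>1 p\<^sub>2 i\<^sub>1 i\<^sub>2"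
  "is_zero_object (op_cat C) Z \<longleftrightarrow> is_zero_object C Z"
  "projective (op_cat C) = injective C" "injective (op_cat C) = projective C"
  "enough_projectives (op_cat C) \<longleftrightarrow> enough_injectives C"
  "closed_kernels_of_epis (op_cat C) X \<longleftrightarrow> closed_cokernels_of_monos C X"
  by (auto simp: is_mono_def is_epi_def is_kernel_def is_cokernel_def is_biproduct_def
    is_zero_object_def fun_eq_iff projective_def injective_def enough_projectives_def
    enough_injectives_def closed_kernels_of_epis_def closed_cokernels_of_monos_def)

lemma (in category) category_op: "category (op_cat C)"
  by unfold_locales (auto simp: in_Hom src_obj tgt_obj)

lemma (in preadditive_category) preadditive_op: "preadditive_category (op_cat C)"
  by (intro preadditive_category.intro preadditive_category_axioms.intro category_op)
    (auto simp: in_Hom distrib hom_comm_group)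

lemma (in abelian_category) abelian_op: "abelian_category (op_cat C)"
proof (intro abelian_category.intro abelian_category_axioms.intro preadditive_op)
  fix A B assume "A \<in> Obj (op_cat C)" "B \<in> Obj (op_cat C)"
  then show "\<exists>S i\<^sub>1 i\<^sub>2 p\<^sub>1 p\<^sub>2. is_biproduct (op_cat C) A B S i\<^sub>1 i\<^sub>2 p\<^sub>1 p\<^sub>2"
    using ex_biproduct[of A B] by simp blast
qed (auto simp: ex_zero_object ex_kernel ex_cokernel mono_is_kernel epi_is_cokernel)

section \<open>Monomorphisms, epimorphisms, kernels and cokernels\<close>

context preadditive_category begin

text \<open>Hom-sets are groups, so cancellability of \<open>f\<close> can be tested on the
  difference of two arrows.\<close>

lemma monoI:
  assumes "f \<in> Arr C"
    and "\<And>g D. g \<in> Arr C \<Longrightarrow> Src C g = D \<Longrightarrow> Tgt C g = Src C f \<Longrightarrow> f \<^bold>\<circ> g = Zero C D (Tgt C f) \<Longrightarrow>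
           g = Zero C D (Src C f)"
  shows "is_mono C f"
  unfolding is_mono_def
proof (intro conjI allI ballI impI)
  fix D g h
  assume gh: "g \<in> Hom C D (Src C f)" "h \<in> Hom C D (Src C f)" and e: "f \<^bold>\<circ> g = f \<^bold>\<circ> h"
  from gh assms(1) e have "f \<^bold>\<circ> (g \<^bold>+ neg h) = Zero C D (Tgt C f)" by (simp add: in_Hom distrib)
  with assms(2)[of "g \<^bold>+ neg h"] gh assms(1) have "g \<^bold>+ neg h = Zero C D (Src C f)" by (simp add: in_Hom)
  with minus_eq_zero_iff[of g h] gh show "g = h" by (simp add: in_Hom)
qed (fact assms(1))

lemma monoD:
  assumes "is_mono C f" "f \<^bold>\<circ> g = f \<^bold>\<circ> h" "g \<in> Arr C" "h \<in> Arr C" "Tgt C g = Src C f" "Tgt C h = Src C f"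
    "Src C g = Src C h"
  shows "g = h"
  using assms by (auto simp: is_mono_def in_Hom)

lemma mono_zeroD:
  assumes "is_mono C f" "f \<^bold>\<circ> g = Zero C D (Tgt C f)" "g \<in> Arr C" "Tgt C g = Src C f" "Src C g = D"
  shows "g = Zero C D (Src C f)"
proof (rule monoD[OF assms(1)])
  have f: "f \<in> Arr C" using assms(1) by (simp add: is_mono_def)
  note o = src_obj[OF f] tgt_obj[OF f] src_obj[OF assms(3), unfolded assms(5)]
  show "f \<^bold>\<circ> g = f \<^bold>\<circ> Zero C D (Src C f)" using assms(2) f o by simp
  show "Zero C D (Src C f) \<in> Arr C" "Tgt C (Zero C D (Src C f)) = Src C f"
    "Src C g = Src C (Zero C D (Src C f))"
    using o assms(5) by simp_all
qed (use assms(3-5) in auto)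

lemma is_kernelD:
  assumes "is_kernel C k f"
  shows "f \<in> Arr C" "k \<in> Arr C" "Tgt C k = Src C f" "f \<^bold>\<circ> k = Zero C (Src C k) (Tgt C f)"
  using assms by (auto simp: is_kernel_def)

lemma kernelE:
  assumes "is_kernel C k f" "g \<in> Arr C" "Tgt C g = Src C f" "Src C g = D" "f \<^bold>\<circ> g = Zero C D (Tgt C f)"
  obtains h where "h \<in> Arr C" "Src C h = D" "Tgt C h = Src C k" "k \<^bold>\<circ> h = g"
proof -
  have "g \<in> Hom C D (Src C f)" using assms by (simp add: in_Hom)
  with assms(1,5) have "\<exists>!h. h \<in> Hom C D (Src C k) \<and> k \<^bold>\<circ> h = g"
    unfolding is_kernel_def by blast
  with that show thesis by (auto simp: in_Hom)
qed

lemma kernel_mono: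
  assumes "is_kernel C k f"
  shows "is_mono C k"
proof (rule monoI)
  note k = is_kernelD[OF assms]
  show "k \<in> Arr C" by (fact k)
  fix g D assume g: "g \<in> Arr C" "Src C g = D" "Tgt C g = Src C k" "k \<^bold>\<circ> g = Zero C D (Tgt C k)"
  \<comment> \<open>The zero arrow factors through \<open>k\<close> in only one way, and both
    \<open>g\<close> and zero are such factorizations.\<close>
  have "\<exists>!h. h \<in> Hom C D (Src C k) \<and> k \<^bold>\<circ> h = Zero C D (Tgt C k)"
  proof -
    have "Zero C D (Tgt C k) \<in> Hom C D (Src C f)"
      "f \<^bold>\<circ> Zero C D (Tgt C k) = Zero C D (Tgt C f)"
      using k g src_obj[OF g(1)] src_obj tgt_obj by (simp_all add: in_Hom)
    with assms show ?thesis unfolding is_kernel_def by blast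
  qed
  moreover have "g \<in> Hom C D (Src C k)"
    "Zero C D (Src C k) \<in> Hom C D (Src C k)"
    "k \<^bold>\<circ> Zero C D (Src C k) = Zero C D (Tgt C k)"
    using k g src_obj[OF g(1)] src_obj tgt_obj by (simp_all add: in_Hom)
  ultimately show "g = Zero C D (Src C k)" using g(4) by blast
qed

lemma is_kernelI:
  assumes "is_mono C k" "f \<in> Arr C" "Tgt C k = Src C f" "f \<^bold>\<circ> k = Zero C (Src C k) (Tgt C f)"
    and "\<And>g D. g \<in> Arr C \<Longrightarrow> Src C g = D \<Longrightarrow> Tgt C g = Src C f \<Longrightarrow> f \<^bold>\<circ> g = Zero C D (Tgt C f) \<Longrightarrow>
           \<exists>h. h \<in> Arr C \<and> Src C h = D \<and> Tgt C h = Src C k \<and> k \<^bold>\<circ> h = g"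
  shows "is_kernel C k f"
  unfolding is_kernel_def
proof (intro conjI allI ballI impI)
  fix D g assume g: "g \<in> Hom C D (Src C f)" and e: "f \<^bold>\<circ> g = Zero C D (Tgt C f)"
  with assms(5)[of g] obtain h where h: "h \<in> Hom C D (Src C k)" "k \<^bold>\<circ> h = g" by (auto simp: in_Hom)
  then show "\<exists>!h. h \<in> Hom C D (Src C k) \<and> k \<^bold>\<circ> h = g"
    using assms(1) unfolding is_mono_def by (intro ex1I[of _ h]) auto
qed (use assms in \<open>auto simp: is_mono_def\<close>)

lemma is_cokernelD:
  assumes "is_cokernel C c f"
  shows "f \<in> Arr C" "c \<in> Arr C" "Src C c = Tgt C f" "c \<^bold>\<circ> f = Zero C (Src C f) (Tgt C c)"
  using assms by (auto simp: is_cokernel_def)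

lemma cokernelE:
  assumes "is_cokernel C c f" "g \<in> Arr C" "Src C g = Tgt C f" "Tgt C g = D" "g \<^bold>\<circ> f = Zero C (Src C f) D"
  obtains h where "h \<in> Arr C" "Tgt C h = D" "Src C h = Tgt C c" "h \<^bold>\<circ> c = g"
  using preadditive_category.kernelE[OF preadditive_op, of c f g D thesis] assms that by simp

text \<open>Since \<open>g\<close> kills \<open>f\<close>, it factors through the cokernel
  \<open>c\<close>. Hence whatever \<open>c\<close> kills is killed by \<open>g\<close> and lifts
  along \<open>f\<close>.\<close>

lemma kernel_of_cokernel:
  assumes "is_kernel C f g" "is_cokernel C c f"
  shows "is_kernel C f c"
proof (rule is_kernelI)
  note f = is_kernelD[OF assms(1)]
  have c: "c \<in> Arr C" "Src C c = Tgt C f" "c \<^bold>\<circ> f = Zero C (Src C f) (Tgt C c)"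
    using is_cokernelD[OF assms(2)] by auto
  show "is_mono C f" using assms(1) by (rule kernel_mono)
  show "c \<in> Arr C" "Tgt C f = Src C c" "c \<^bold>\<circ> f = Zero C (Src C f) (Tgt C c)" using c by auto
  obtain h where h: "h \<in> Arr C" "Src C h = Tgt C c" "Tgt C h = Tgt C g" "h \<^bold>\<circ> c = g"
    using cokernelE[OF assms(2), of g] f by auto
  fix u D assume u: "u \<in> Arr C" "Src C u = D" "Tgt C u = Src C c" "c \<^bold>\<circ> u = Zero C D (Tgt C c)"
  have "g \<^bold>\<circ> u = Zero C D (Tgt C g)"
    unfolding h(4)[symmetric] using h(1-3) u c src_obj[OF u(1)] tgt_obj[OF h(1)] by simp
  then show "\<exists>v. v \<in> Arr C \<and> Src C v = D \<and> Tgt C v = Src C f \<and> f \<^bold>\<circ> v = u"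
    using kernelE[OF assms(1), of u D] u f c by metis
qed

lemma epiI:
  assumes "f \<in> Arr C"
    and "\<And>g D. g \<in> Arr C \<Longrightarrow> Tgt C g = D \<Longrightarrow> Src C g = Tgt C f \<Longrightarrow> g \<^bold>\<circ> f = Zero C (Src C f) D \<Longrightarrow>
           g = Zero C (Tgt C f) D"
  shows "is_epi C f"
  using preadditive_category.monoI[OF preadditive_op] assms by simp

lemma epiD:
  assumes "is_epi C f" "g \<^bold>\<circ> f = h \<^bold>\<circ> f" "g \<in> Arr C" "h \<in> Arr C" "Src C g = Tgt C f" "Src C h = Tgt C f"
    "Tgt C g = Tgt C h"
  shows "g = h"
  using assms by (auto simp: is_epi_def in_Hom)

lemma epi_zeroD:
  assumes "is_epi C f" "g \<^bold>\<circ> f = Zero C (Src C f) D" "g \<in> Arr C" "Src C g = Tgt C f" "Tgt C g = D"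
  shows "g = Zero C (Tgt C f) D"
  using preadditive_category.mono_zeroD[OF preadditive_op, of f g D] assms by simp

lemma cokernel_epi: "is_cokernel C c f \<Longrightarrow> is_epi C c"
  using preadditive_category.kernel_mono[OF preadditive_op] by simp

lemma is_cokernelI:
  assumes "is_epi C c" "f \<in> Arr C" "Src C c = Tgt C f" "c \<^bold>\<circ> f = Zero C (Src C f) (Tgt C c)"
    and "\<And>g D. g \<in> Arr C \<Longrightarrow> Tgt C g = D \<Longrightarrow> Src C g = Tgt C f \<Longrightarrow> g \<^bold>\<circ> f = Zero C (Src C f) D \<Longrightarrow>
           \<exists>h. h \<in> Arr C \<and> Tgt C h = D \<and> Src C h = Tgt C c \<and> h \<^bold>\<circ> c = g"
  shows "is_cokernel C c f"
  using preadditive_category.is_kernelI[OF preadditive_op, of c f] assms by simp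

end

context abelian_category begin

lemma mono_kernel_of_cokernel: "is_mono C f \<Longrightarrow> is_cokernel C c f \<Longrightarrow> is_kernel C f c"
  using mono_is_kernel kernel_of_cokernel by blast

lemma epi_cokernel_of_kernel: "is_epi C f \<Longrightarrow> is_kernel C k f \<Longrightarrow> is_cokernel C f k"
  using abelian_category.mono_kernel_of_cokernel[OF abelian_op] by simp

text \<open>A mono is the kernel of some \<open>h\<close>; being epi as well, it forces
  \<open>h\<close> to vanish, so the identity of the target lifts along \<open>f\<close>. This right
  inverse is two-sided because \<open>f\<close> is mono.\<close>

lemma mono_epi_iso:
  assumes "is_mono C f" "is_epi C f"
  obtains g where "g \<in> Arr C" "Src C g = Tgt C f" "Tgt C g = Src C f"
    "f \<^bold>\<circ> g = Ident C (Tgt C f)" "g \<^bold>\<circ> f = Ident C (Src C f)"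
proof -
  obtain h where k: "is_kernel C f h" using mono_is_kernel[OF assms(1)] by blast
  note f = is_kernelD[OF k]
  note o = src_obj[OF f(2)] tgt_obj[OF f(2)] tgt_obj[OF f(1)]
  have "h = Zero C (Tgt C f) (Tgt C h)" using f by (intro epi_zeroD[OF assms(2)]) auto
  moreover have "h \<^bold>\<circ> Ident C (Tgt C f) = h" using f o by simp
  ultimately have "h \<^bold>\<circ> Ident C (Tgt C f) = Zero C (Tgt C f) (Tgt C h)" by metis
  then obtain g where g: "g \<in> Arr C" "Src C g = Tgt C f" "Tgt C g = Src C f"
      "f \<^bold>\<circ> g = Ident C (Tgt C f)"
    using kernelE[OF k, of "Ident C (Tgt C f)"] f o by auto
  have "f \<^bold>\<circ> g \<^bold>\<circ> f = f \<^bold>\<circ> Ident C (Src C f)" using comp_cong_left[OF g(4), of f] f g o by simp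
  then have "g \<^bold>\<circ> f = Ident C (Src C f)" by (rule monoD[OF assms(1)]) (use f g o in auto)
  with g that show thesis by blast
qed

end


section \<open>Morphisms of extensions\<close>

text \<open>For extensions \<open>x\<close> and \<open>y\<close>, this relation expresses \<open>b\<^sub>*x = a\<^sup>*y\<close>.\<close>

definition ext_map :: "('o, 'm) cat \<Rightarrow> 'm \<times> 'm \<Rightarrow> 'm \<times> 'm \<Rightarrow> 'm \<Rightarrow> 'm \<Rightarrow> bool" where
  "ext_map C x y b a \<longleftrightarrow> (\<exists>e. extension_morphism C x y b e a)"

context abelian_category begin

lemma extensionsD:
  assumes "x \<in> extensions C A B"
  shows "fst x \<in> Arr C" "snd x \<in> Arr C" "Src C (fst x) = B" "Tgt C (snd x) = A"
    "Tgt C (fst x) = Src C (snd x)" "A \<in> Obj C" "B \<in> Obj C" "Src C (snd x) \<in> Obj C"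
    "snd x \<^bold>\<circ> fst x = Zero C B A" "is_kernel C (fst x) (snd x)" "is_cokernel C (snd x) (fst x)"
    "is_mono C (fst x)" "is_epi C (snd x)"
proof -
  have x: "is_kernel C (fst x) (snd x)" "is_cokernel C (snd x) (fst x)"
    "Src C (fst x) = B" "Tgt C (snd x) = A"
    using assms by (auto simp: extensions_def short_exact_def)
  note k = is_kernelD[OF x(1)]
  from x k kernel_mono[OF x(1)] cokernel_epi[OF x(2)] src_obj[OF k(2)] tgt_obj[OF k(1)] src_obj[OF k(1)]
  show "fst x \<in> Arr C" "snd x \<in> Arr C" "Src C (fst x) = B" "Tgt C (snd x) = A"
    "Tgt C (fst x) = Src C (snd x)" "A \<in> Obj C" "B \<in> Obj C" "Src C (snd x) \<in> Obj C"
    "snd x \<^bold>\<circ> fst x = Zero C B A" "is_kernel C (fst x) (snd x)" "is_cokernel C (snd x) (fst x)"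
    "is_mono C (fst x)" "is_epi C (snd x)"
    by auto
qed

lemma extensionsI:
  assumes "is_kernel C i p" "is_cokernel C p i" "Src C i = B" "Tgt C p = A"
  shows "(i, p) \<in> extensions C A B"
  using assms by (simp add: extensions_def short_exact_def)

lemma ext_map_iff:
  assumes "x \<in> extensions C A B" "y \<in> extensions C A' B'"
  shows "ext_map C x y b a \<longleftrightarrow> b \<in> Hom C B B' \<and> a \<in> Hom C A A' \<and>
    (\<exists>e. e \<in> Arr C \<and> Src C e = Src C (snd x) \<and> Tgt C e = Src C (snd y) \<and>
      e \<^bold>\<circ> fst x = fst y \<^bold>\<circ> b \<and> snd y \<^bold>\<circ> e = a \<^bold>\<circ> snd x)"
  using extensionsD[OF assms(1)] extensionsD[OF assms(2)]
  by (auto simp: ext_map_def extension_morphism_def in_Hom)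

lemma ext_map_ident: "x \<in> extensions C A B \<Longrightarrow> ext_map C x x (Ident C B) (Ident C A)"
  using extensionsD[of x A B] ident_hom
  by (auto simp: ext_map_iff intro!: exI[of _ "Ident C (Src C (snd x))"])

lemma ext_map_comp:
  assumes "x \<in> extensions C A B" "y \<in> extensions C A' B'" "z \<in> extensions C A'' B''"
    "ext_map C x y b a" "ext_map C y z b' a'"
  shows "ext_map C x z (b' \<^bold>\<circ> b) (a' \<^bold>\<circ> a)"
proof -
  note x = extensionsD[OF assms(1)] and y = extensionsD[OF assms(2)] and z = extensionsD[OF assms(3)]
  obtain e where e: "b \<in> Hom C B B'" "a \<in> Hom C A A'"
    "e \<in> Arr C" "Src C e = Src C (snd x)" "Tgt C e = Src C (snd y)"
    "e \<^bold>\<circ> fst x = fst y \<^bold>\<circ> b" "snd y \<^bold>\<circ> e = a \<^bold>\<circ> snd x"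
    using assms(4) unfolding ext_map_iff[OF assms(1,2)] by blast
  obtain e' where e': "b' \<in> Hom C B' B''" "a' \<in> Hom C A' A''"
    "e' \<in> Arr C" "Src C e' = Src C (snd y)" "Tgt C e' = Src C (snd z)"
    "e' \<^bold>\<circ> fst y = fst z \<^bold>\<circ> b'" "snd z \<^bold>\<circ> e' = a' \<^bold>\<circ> snd y"
    using assms(5) unfolding ext_map_iff[OF assms(2,3)] by blast
  have "(e' \<^bold>\<circ> e) \<^bold>\<circ> fst x = fst z \<^bold>\<circ> b' \<^bold>\<circ> b"
    using e e'(1-5) comp_cong_left[OF e'(6), of b] x y z by (simp add: in_Hom)
  moreover have "snd z \<^bold>\<circ> e' \<^bold>\<circ> e = (a' \<^bold>\<circ> a) \<^bold>\<circ> snd x"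
    using e e'(1-5) comp_cong_left[OF e'(7), of e] x y z by (simp add: in_Hom)
  ultimately show ?thesis unfolding ext_map_iff[OF assms(1,3)]
    using comp_hom[OF e(1) e'(1)] comp_hom[OF e(2) e'(2)] e(3-5) e'(3-5)
    by (intro conjI exI[of _ "e' \<^bold>\<circ> e"]) simp_all
qed

text \<open>This is the short five lemma: the middle arrow is mono and epi, hence invertible, and
  its inverse is a morphism in the other direction.\<close>

lemma ext_map_sym:
  assumes "x \<in> extensions C A B" "y \<in> extensions C A B" "ext_map C x y (Ident C B) (Ident C A)"
  shows "ext_map C y x (Ident C B) (Ident C A)"
proof -
  note x = extensionsD[OF assms(1)] and y = extensionsD[OF assms(2)]
  obtain e where e: "e \<in> Arr C" "Src C e = Src C (snd x)" "Tgt C e = Src C (snd y)"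
    "e \<^bold>\<circ> fst x = fst y" "snd y \<^bold>\<circ> e = snd x"
    using assms(3) x y unfolding ext_map_iff[OF assms(1,2)] by auto
  have "is_mono C e"
  proof (rule monoI)
    fix g D assume g: "g \<in> Arr C" "Src C g = D" "Tgt C g = Src C e" "e \<^bold>\<circ> g = Zero C D (Tgt C e)"
    note D = src_obj[OF g(1), unfolded g(2)]
    have "snd x \<^bold>\<circ> g = Zero C D A" using comp_cong_left[OF e(5), of g] e(1-3) g x y D by simp
    then obtain h where h: "h \<in> Arr C" "Src C h = D" "Tgt C h = B" and gh: "g = fst x \<^bold>\<circ> h"
      using kernelE[OF x(10), of g D] g(1-3) x e(1-3) by metis
    have "fst y \<^bold>\<circ> h = Zero C D (Tgt C (fst y))"
      using comp_cong_left[OF e(4), of h] g(4) gh e(1-3) h x y by simp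
    then have "h = Zero C D B" using mono_zeroD[OF y(12), of h D] h y by simp
    then show "g = Zero C D (Src C e)" using gh x e D by simp
  qed (fact e)
  moreover have "is_epi C e"
  proof (rule epiI)
    fix g D assume g: "g \<in> Arr C" "Tgt C g = D" "Src C g = Tgt C e" "g \<^bold>\<circ> e = Zero C (Src C e) D"
    note D = tgt_obj[OF g(1), unfolded g(2)]
    have "g \<^bold>\<circ> fst y = (g \<^bold>\<circ> e) \<^bold>\<circ> fst x" using e g(1-3) x y D by (simp add: e(4))
    also have "\<dots> = Zero C B D" unfolding g(4) using e x D by simp
    finally obtain h where h: "h \<in> Arr C" "Tgt C h = D" "Src C h = A" and gh: "g = h \<^bold>\<circ> snd y"
      using cokernelE[OF y(11), of g D] g(1-3) y e(1-3) by metis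
    have "h \<^bold>\<circ> snd x = (h \<^bold>\<circ> snd y) \<^bold>\<circ> e" using e h x y by (simp add: e(5))
    also have "\<dots> = Zero C (Src C (snd x)) D" using g(4) gh e by simp
    finally have "h = Zero C A D" using epi_zeroD[OF x(13), of h D] h x by simp
    then show "g = Zero C (Tgt C e) D" using gh y e D by simp
  qed (fact e)
  ultimately obtain d where d: "d \<in> Arr C" "Src C d = Tgt C e" "Tgt C d = Src C e"
    "e \<^bold>\<circ> d = Ident C (Tgt C e)" "d \<^bold>\<circ> e = Ident C (Src C e)" by (rule mono_epi_iso)
  have "d \<^bold>\<circ> fst y = fst x" using comp_cong_left[OF d(5), of "fst x"] d e x y by simp
  moreover have "snd x \<^bold>\<circ> d = snd y" using comp_cong_left[OF e(5), of d] d e(1-3) x y by simp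
  ultimately show ?thesis unfolding ext_map_iff[OF assms(2,1)]
    using x y d e(1-3) ident_hom by (intro conjI exI[of _ d]) simp_all
qed

text \<open>The pushout of \<open>fst x\<close> and \<open>b\<close> is the cokernel of the arrow
  with components \<open>fst x\<close> and -\<open>b\<close> into the biproduct of the middle term
  and B'. The last two conclusions are its universal property, split into existence and uniqueness
  because both are needed to factor morphisms of extensions.\<close>

lemma pushout_extension:
  assumes "x \<in> extensions C A B" "b \<in> Hom C B B'"
  obtains y e where "y \<in> extensions C A B'" "e \<in> Arr C" "Src C e = Src C (snd x)" "Tgt C e = Src C (snd y)"
    "e \<^bold>\<circ> fst x = fst y \<^bold>\<circ> b" "snd y \<^bold>\<circ> e = snd x"
    "\<And>f g T. f \<in> Hom C (Src C (snd x)) T \<Longrightarrow> g \<in> Hom C B' T \<Longrightarrow> f \<^bold>\<circ> fst x = g \<^bold>\<circ> b \<Longrightarrow>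
       \<exists>h \<in> Hom C (Src C (snd y)) T. h \<^bold>\<circ> e = f \<and> h \<^bold>\<circ> fst y = g"
    "\<And>u v T. u \<in> Hom C (Src C (snd y)) T \<Longrightarrow> v \<in> Hom C (Src C (snd y)) T \<Longrightarrow>
       u \<^bold>\<circ> e = v \<^bold>\<circ> e \<Longrightarrow> u \<^bold>\<circ> fst y = v \<^bold>\<circ> fst y \<Longrightarrow> u = v"
proof -
  obtain i p where xip: "x = (i, p)" by (cases x)
  note x = extensionsD[OF assms(1), unfolded xip fst_conv snd_conv]
  have b: "b \<in> Arr C" "Src C b = B" "Tgt C b = B'" using assms(2) by (auto simp: in_Hom)
  have B': "B' \<in> Obj C" using tgt_obj[OF b(1)] b by simp
  obtain S i\<^sub>1 i\<^sub>2 p\<^sub>1 p\<^sub>2 where S: "is_biproduct C (Src C p) B' S i\<^sub>1 i\<^sub>2 p\<^sub>1 p\<^sub>2"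
    using ex_biproduct[of "Src C p" B'] x B' by blast
  note s = biproductD(1-15)[OF S] and s' = biproductD(16-19)[OF S] and bc = biproduct_comp[OF S]
  \<comment> \<open>The minus sign makes the two routes from B into the cokernel agree, which is
    \<open>sq\<close> below.\<close>
  define m where "m = i\<^sub>1 \<^bold>\<circ> i \<^bold>+ neg (i\<^sub>2 \<^bold>\<circ> b)"
  have m: "m \<in> Arr C" "Src C m = B" "Tgt C m = S" using s x b by (simp_all add: m_def)
  have p1m: "p\<^sub>1 \<^bold>\<circ> m = i" using s x b bc by (simp add: m_def distrib)
  have mm: "is_mono C m"
  proof (rule monoI)
    fix g D assume g: "g \<in> Arr C" "Src C g = D" "Tgt C g = Src C m" "m \<^bold>\<circ> g = Zero C D (Tgt C m)"
    have "D \<in> Obj C" using src_obj[OF g(1)] g by simp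
    with g have "i \<^bold>\<circ> g = Zero C D (Tgt C i)" using comp_cong_left[OF p1m, of g] m s x by simp
    then show "g = Zero C D (Src C m)" using mono_zeroD[OF x(12), of g D] g m x by simp
  qed (fact m)
  obtain c where cm: "is_cokernel C c m" using ex_cokernel m by blast
  note mc = mono_kernel_of_cokernel[OF mm cm]
  have c: "c \<in> Arr C" "Src C c = S" "c \<^bold>\<circ> m = Zero C B (Tgt C c)" "Tgt C c \<in> Obj C"
    using is_cokernelD[OF cm] m tgt_obj by auto
  have sq: "c \<^bold>\<circ> i\<^sub>1 \<^bold>\<circ> i = c \<^bold>\<circ> i\<^sub>2 \<^bold>\<circ> b"
    using c(3) minus_eq_zero_iff[of "c \<^bold>\<circ> i\<^sub>1 \<^bold>\<circ> i" "c \<^bold>\<circ> i\<^sub>2 \<^bold>\<circ> b"] c(1,2,4) s x b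
    by (simp add: m_def distrib)
  \<comment> \<open>If \<open>c\<close> kills \<open>i\<^sub>2 g\<close>, this arrow comes through
    the kernel \<open>m\<close> from some \<open>h\<close>. Its first component \<open>i h\<close>
    is zero, so \<open>h\<close> vanishes, and with it \<open>g\<close>.\<close>
  have jm: "is_mono C (c \<^bold>\<circ> i\<^sub>2)"
  proof (rule monoI)
    fix g D assume "g \<in> Arr C" "Src C g = D" "Tgt C g = Src C (c \<^bold>\<circ> i\<^sub>2)"
      "(c \<^bold>\<circ> i\<^sub>2) \<^bold>\<circ> g = Zero C D (Tgt C (c \<^bold>\<circ> i\<^sub>2))"
    then have g: "g \<in> Arr C" "Src C g = D" "Tgt C g = B'" "c \<^bold>\<circ> i\<^sub>2 \<^bold>\<circ> g = Zero C D (Tgt C c)"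
      using c s by simp_all
    have D: "D \<in> Obj C" using src_obj[OF g(1)] g by simp
    obtain h where h: "h \<in> Arr C" "Src C h = D" "Tgt C h = B" "m \<^bold>\<circ> h = i\<^sub>2 \<^bold>\<circ> g"
      using kernelE[OF mc, of "i\<^sub>2 \<^bold>\<circ> g" D] g c s m by auto
    have "i \<^bold>\<circ> h = p\<^sub>1 \<^bold>\<circ> m \<^bold>\<circ> h" using comp_cong_left[OF p1m, of h] h(1-3) m s by simp
    also have "\<dots> = Zero C D (Tgt C i)" unfolding h(4) using g bc s x by simp
    finally have "h = Zero C D B" using mono_zeroD[OF x(12), of h D] h x by simp
    then have "i\<^sub>2 \<^bold>\<circ> g = Zero C D S" using h(4) m D by simp
    then have "p\<^sub>2 \<^bold>\<circ> i\<^sub>2 \<^bold>\<circ> g = Zero C D B'" using s D by simp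
    then show "g = Zero C D (Src C (c \<^bold>\<circ> i\<^sub>2))" using bc g c s by simp
  qed (use c s in simp)
  \<comment> \<open>On the biproduct take \<open>p\<close> on the first summand and zero on the
    second. This kills \<open>m\<close> and descends to the new projection \<open>q\<close>.\<close>
  have "(p \<^bold>\<circ> p\<^sub>1) \<^bold>\<circ> m = Zero C B A" using p1m x m s by simp
  then obtain q where q: "q \<in> Arr C" "Src C q = Tgt C c" "Tgt C q = A" "q \<^bold>\<circ> c = p \<^bold>\<circ> p\<^sub>1"
    using cokernelE[OF cm, of "p \<^bold>\<circ> p\<^sub>1" A] x m s by auto
  have qe: "q \<^bold>\<circ> c \<^bold>\<circ> i\<^sub>1 = p" using comp_cong_left[OF q(4), of "i\<^sub>1"] q s' s c x by simp
  have qj: "q \<^bold>\<circ> c \<^bold>\<circ> i\<^sub>2 = Zero C B' A" using comp_cong_left[OF q(4), of "i\<^sub>2"] q s' s c x by simp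
  have qepi: "is_epi C q"
  proof (rule epiI)
    fix g D assume g: "g \<in> Arr C" "Tgt C g = D" "Src C g = Tgt C q" "g \<^bold>\<circ> q = Zero C (Src C q) D"
    have D: "D \<in> Obj C" using tgt_obj[OF g(1)] g by simp
    have "g \<^bold>\<circ> p = (g \<^bold>\<circ> q) \<^bold>\<circ> c \<^bold>\<circ> i\<^sub>1" using g(1-3) q c s qe by simp
    also have "\<dots> = Zero C (Src C p) D" unfolding g(4) using q c s D by simp
    finally show "g = Zero C (Tgt C q) D" using epi_zeroD[OF x(13), of g D] g(1-3) x q by simp
  qed (fact q)
  \<comment> \<open>An arrow killing the new inclusion restricts on the old middle term to an arrow
    killing \<open>i\<close>, so it descends along \<open>p\<close>. Comparing both components shows
    that the descended arrow is the right one.\<close>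
  have cok: "is_cokernel C q (c \<^bold>\<circ> i\<^sub>2)"
  proof (rule is_cokernelI)
    fix g D assume "g \<in> Arr C" "Tgt C g = D" "Src C g = Tgt C (c \<^bold>\<circ> i\<^sub>2)"
      "g \<^bold>\<circ> c \<^bold>\<circ> i\<^sub>2 = Zero C (Src C (c \<^bold>\<circ> i\<^sub>2)) D"
    then have g: "g \<in> Arr C" "Tgt C g = D" "Src C g = Tgt C c" "g \<^bold>\<circ> c \<^bold>\<circ> i\<^sub>2 = Zero C B' D"
      using c s by simp_all
    have D: "D \<in> Obj C" using tgt_obj[OF g(1)] g by simp
    have "(g \<^bold>\<circ> c \<^bold>\<circ> i\<^sub>1) \<^bold>\<circ> i = (g \<^bold>\<circ> c \<^bold>\<circ> i\<^sub>2) \<^bold>\<circ> b" using g(1-3) c s x b sq by simp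
    also have "\<dots> = Zero C B D" unfolding g(4) using b D by simp
    finally obtain h where h: "h \<in> Arr C" "Tgt C h = D" "Src C h = A" "h \<^bold>\<circ> p = g \<^bold>\<circ> c \<^bold>\<circ> i\<^sub>1"
      using cokernelE[OF x(11), of "g \<^bold>\<circ> c \<^bold>\<circ> i\<^sub>1" D] g c s x by auto
    have "(h \<^bold>\<circ> q) \<^bold>\<circ> c = g \<^bold>\<circ> c"
    proof (rule biproduct_arr_eqI'[OF S])
      show "((h \<^bold>\<circ> q) \<^bold>\<circ> c) \<^bold>\<circ> i\<^sub>1 = (g \<^bold>\<circ> c) \<^bold>\<circ> i\<^sub>1" "((h \<^bold>\<circ> q) \<^bold>\<circ> c) \<^bold>\<circ> i\<^sub>2 = (g \<^bold>\<circ> c) \<^bold>\<circ> i\<^sub>2"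
        using g h q(1-3) c s qe qj D x by simp_all
    qed (use g(1-3) h(1-3) q(1-3) c(1-2) s in simp_all)
    then have "h \<^bold>\<circ> q = g" using epiD[OF cokernel_epi[OF cm], of "h \<^bold>\<circ> q" g] g(1-3) h(1-3) q(1-3) c(1-2) by simp
    then show "\<exists>h. h \<in> Arr C \<and> Tgt C h = D \<and> Src C h = Tgt C q \<and> h \<^bold>\<circ> q = g" using h q by auto
  qed (use qepi qj c s q in simp_all)
  let ?y = "(c \<^bold>\<circ> i\<^sub>2, q)"
  have y: "?y \<in> extensions C A B'"
    using mono_kernel_of_cokernel[OF jm cok] cok c s q by (intro extensionsI) simp_all
  show thesis
  proof (rule that[OF y])
    show "c \<^bold>\<circ> i\<^sub>1 \<in> Arr C" "Src C (c \<^bold>\<circ> i\<^sub>1) = Src C (snd x)" "Tgt C (c \<^bold>\<circ> i\<^sub>1) = Src C (snd ?y)"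
      using c s q by (simp_all add: xip)
    show "(c \<^bold>\<circ> i\<^sub>1) \<^bold>\<circ> fst x = fst ?y \<^bold>\<circ> b" "snd ?y \<^bold>\<circ> c \<^bold>\<circ> i\<^sub>1 = snd x"
      using c s q b x sq qe by (simp_all add: xip)
    show "\<exists>h\<in>Hom C (Src C (snd ?y)) T. h \<^bold>\<circ> c \<^bold>\<circ> i\<^sub>1 = f \<and> h \<^bold>\<circ> fst ?y = g"
      if "f \<in> Hom C (Src C (snd x)) T" "g \<in> Hom C B' T" "f \<^bold>\<circ> fst x = g \<^bold>\<circ> b" for f g T
    proof -
      have fg: "f \<in> Arr C" "Src C f = Src C p" "Tgt C f = T" "g \<in> Arr C" "Src C g = B'" "Tgt C g = T"
        "f \<^bold>\<circ> i = g \<^bold>\<circ> b" using that by (auto simp: in_Hom xip)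
      have "(f \<^bold>\<circ> p\<^sub>1 \<^bold>+ g \<^bold>\<circ> p\<^sub>2) \<^bold>\<circ> m = Zero C B T"
        using fg s bc x b tgt_obj[OF fg(1)] by (simp add: m_def distrib)
      then obtain h where h: "h \<in> Arr C" "Tgt C h = T" "Src C h = Tgt C c"
        "h \<^bold>\<circ> c = f \<^bold>\<circ> p\<^sub>1 \<^bold>+ g \<^bold>\<circ> p\<^sub>2"
        using cokernelE[OF cm, of "f \<^bold>\<circ> p\<^sub>1 \<^bold>+ g \<^bold>\<circ> p\<^sub>2" T] fg(1-6) m s by auto
      have "h \<^bold>\<circ> c \<^bold>\<circ> i\<^sub>1 = f" "h \<^bold>\<circ> c \<^bold>\<circ> i\<^sub>2 = g"
        using comp_cong_left[OF h(4), of i\<^sub>1] comp_cong_left[OF h(4), of i\<^sub>2] fg(1-6) h(1-3) c s s'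
          src_obj[OF fg(4)] tgt_obj[OF fg(1)]
        by (simp_all add: distrib)
      then show ?thesis using h q by (intro bexI[of _ h]) (auto simp: in_Hom)
    qed
    show "u = v" if uv: "u \<in> Hom C (Src C (snd ?y)) T" "v \<in> Hom C (Src C (snd ?y)) T"
       "u \<^bold>\<circ> c \<^bold>\<circ> i\<^sub>1 = v \<^bold>\<circ> c \<^bold>\<circ> i\<^sub>1" "u \<^bold>\<circ> fst ?y = v \<^bold>\<circ> fst ?y" for u v T
    proof -
      have uv': "u \<in> Arr C" "Src C u = Tgt C c" "Tgt C u = T" "v \<in> Arr C" "Src C v = Tgt C c" "Tgt C v = T"
        using uv q by (auto simp: in_Hom)
      have "u \<^bold>\<circ> c = v \<^bold>\<circ> c"
        by (rule biproduct_arr_eqI'[OF S]) (use uv' uv(3,4) c s in simp_all)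
      then show ?thesis using epiD[OF cokernel_epi[OF cm], of u v] uv' by simp
    qed
  qed
qed

lemma ext_map_push_ex:
  assumes "x \<in> extensions C A B" "b \<in> Hom C B B'"
  shows "\<exists>y \<in> extensions C A B'. ext_map C x y b (Ident C A)"
proof -
  obtain y e where y: "y \<in> extensions C A B'" "e \<in> Arr C" "Src C e = Src C (snd x)"
    "Tgt C e = Src C (snd y)" "e \<^bold>\<circ> fst x = fst y \<^bold>\<circ> b" "snd y \<^bold>\<circ> e = snd x"
    by (rule pushout_extension[OF assms]) blast
  then have "ext_map C x y b (Ident C A)"
    using extensionsD[OF assms(1)] assms ident_hom by (auto simp: ext_map_iff)
  with y show ?thesis by blast
qed

text \<open>For the constructed pushout \<open>y0\<close> this is the universal property, and
  \<open>y\<close> is equivalent to \<open>y0\<close> because it too receives a morphism over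
  \<open>b\<close> and the identity. From here on this lemma stands in for the universal
  property.\<close>

lemma ext_map_push_factor:
  assumes "x \<in> extensions C A B" "y \<in> extensions C A B'" "z \<in> extensions C A' B''"
    "ext_map C x y b (Ident C A)" "ext_map C x z (b' \<^bold>\<circ> b) a" "b' \<in> Hom C B' B''"
  shows "ext_map C y z b' a"
proof -
  note x = extensionsD[OF assms(1)] and y = extensionsD[OF assms(2)] and z = extensionsD[OF assms(3)]
  have b: "b \<in> Hom C B B'" using assms(4) ext_map_iff[OF assms(1,2)] by blast
  have a: "a \<in> Hom C A A'" using assms(5) ext_map_iff[OF assms(1,3)] by blast
  obtain y0 e where y0: "y0 \<in> extensions C A B'" "e \<in> Arr C" "Src C e = Src C (snd x)"
    "Tgt C e = Src C (snd y0)" "e \<^bold>\<circ> fst x = fst y0 \<^bold>\<circ> b" "snd y0 \<^bold>\<circ> e = snd x"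
    and univ: "\<And>f g T. f \<in> Hom C (Src C (snd x)) T \<Longrightarrow> g \<in> Hom C B' T \<Longrightarrow> f \<^bold>\<circ> fst x = g \<^bold>\<circ> b \<Longrightarrow>
       \<exists>h \<in> Hom C (Src C (snd y0)) T. h \<^bold>\<circ> e = f \<and> h \<^bold>\<circ> fst y0 = g"
    and uniq: "\<And>u v T. u \<in> Hom C (Src C (snd y0)) T \<Longrightarrow> v \<in> Hom C (Src C (snd y0)) T \<Longrightarrow>
       u \<^bold>\<circ> e = v \<^bold>\<circ> e \<Longrightarrow> u \<^bold>\<circ> fst y0 = v \<^bold>\<circ> fst y0 \<Longrightarrow> u = v"
    by (rule pushout_extension[OF assms(1) b]) blast
  note y0' = extensionsD[OF y0(1)]
  \<comment> \<open>The target is left arbitrary because the fact is used twice: with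
    \<open>y\<close>, to identify it with \<open>y0\<close>, and with \<open>z\<close>.\<close>
  have key: "ext_map C y0 w d a'"
    if w: "w \<in> extensions C A2 B2" and m: "ext_map C x w (d \<^bold>\<circ> b) a'" and d: "d \<in> Hom C B' B2" for w A2 B2 d a'
  proof -
    note w' = extensionsD[OF w]
    have d': "d \<in> Arr C" "Src C d = B'" "Tgt C d = B2" using d by (auto simp: in_Hom)
    have b': "b \<in> Arr C" "Src C b = B" "Tgt C b = B'" using b by (auto simp: in_Hom)
    obtain f where f: "a' \<in> Hom C A A2" "f \<in> Arr C" "Src C f = Src C (snd x)" "Tgt C f = Src C (snd w)"
      "f \<^bold>\<circ> fst x = fst w \<^bold>\<circ> d \<^bold>\<circ> b" "snd w \<^bold>\<circ> f = a' \<^bold>\<circ> snd x"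
      using m unfolding ext_map_iff[OF assms(1) w] by blast
    have a': "a' \<in> Arr C" "Src C a' = A" "Tgt C a' = A2" using f(1) by (auto simp: in_Hom)
    obtain h where h: "h \<in> Hom C (Src C (snd y0)) (Src C (snd w))" "h \<^bold>\<circ> e = f" "h \<^bold>\<circ> fst y0 = fst w \<^bold>\<circ> d"
      using univ[of f "Src C (snd w)" "fst w \<^bold>\<circ> d"] f d' b' w' by (auto simp: in_Hom)
    have h': "h \<in> Arr C" "Src C h = Src C (snd y0)" "Tgt C h = Src C (snd w)" using h by (auto simp: in_Hom)
    have "snd w \<^bold>\<circ> h = a' \<^bold>\<circ> snd y0"
    proof (rule uniq)
      show "(snd w \<^bold>\<circ> h) \<^bold>\<circ> e = (a' \<^bold>\<circ> snd y0) \<^bold>\<circ> e"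
        using h' h(2) w' y0 y0' a' f by simp
      show "(snd w \<^bold>\<circ> h) \<^bold>\<circ> fst y0 = (a' \<^bold>\<circ> snd y0) \<^bold>\<circ> fst y0"
        using h' h(3) w' y0' a' d' comp_cong_left[OF w'(9), of d] by simp
    qed (use h' w' y0' a' in \<open>simp_all add: in_Hom\<close>)
    then show ?thesis unfolding ext_map_iff[OF y0(1) w] using d f(1) h' h(3) by blast
  qed
  have "ext_map C x y (Ident C B' \<^bold>\<circ> b) (Ident C A)" using assms(4) b by (simp add: in_Hom)
  then have "ext_map C y0 y (Ident C B') (Ident C A)" using key[OF assms(2)] ident_hom y by simp
  then have "ext_map C y y0 (Ident C B') (Ident C A)" by (rule ext_map_sym[OF y0(1) assms(2)])
  from ext_map_comp[OF assms(2) y0(1) assms(3) this key[OF assms(3,5,6)]]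
  show ?thesis using assms(6) a by (simp add: in_Hom)
qed

end

text \<open>Reversing arrows exchanges inclusion and projection, so the dual of an extension is the
  swapped pair. Facts on pullbacks are then the facts on pushouts in the opposite category.\<close>

lemma (in abelian_category) swap_extensions:
  "prod.swap x \<in> extensions (op_cat C) B A \<longleftrightarrow> x \<in> extensions C A B"
  by (auto simp: extensions_def short_exact_def)

lemma (in abelian_category) swap_ext_map:
  assumes "x \<in> extensions C A B" "y \<in> extensions C A' B'"
  shows "ext_map (op_cat C) (prod.swap y) (prod.swap x) a b \<longleftrightarrow> ext_map C x y b a"
  using extensionsD[OF assms(1)] extensionsD[OF assms(2)]
  by (auto simp: ext_map_def extension_morphism_def in_Hom)

section \<open>Pullbacks of extensions, by duality\<close>

context abelian_category begin

lemma ext_map_pull_ex: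
  assumes "x \<in> extensions C A B" "a \<in> Hom C A' A"
  shows "\<exists>y \<in> extensions C A' B. ext_map C y x (Ident C B) a"
proof -
  from abelian_category.ext_map_push_ex[OF abelian_op, of "prod.swap x" B A a A'] assms
  obtain y where y: "y \<in> extensions (op_cat C) B A'" "ext_map (op_cat C) (prod.swap x) y a (Ident C B)"
    by (auto simp: swap_extensions)
  from y(1) swap_extensions[of "prod.swap y"] have y': "prod.swap y \<in> extensions C A' B" by simp
  from swap_ext_map[OF this assms(1)] y y' show ?thesis by auto
qed

lemma ext_map_pull_factor:
  assumes "x \<in> extensions C A B" "y \<in> extensions C A' B" "z \<in> extensions C A'' B''"
    "ext_map C y x (Ident C B) a" "ext_map C z x b (a \<^bold>\<circ> a')" "a' \<in> Hom C A'' A'"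
  shows "ext_map C z y b a'"
  using abelian_category.ext_map_push_factor[OF abelian_op, of "prod.swap x" B A "prod.swap y" A'
      "prod.swap z" B'' A'' a a' b] assms
  by (simp add: swap_extensions swap_ext_map[OF assms(2,1)] swap_ext_map[OF assms(3,1)]
      swap_ext_map[OF assms(3,2)])

end


section \<open>Classes of extensions and the Baer sum\<close>

definition ext_class :: "('o, 'm) cat \<Rightarrow> 'o \<Rightarrow> 'o \<Rightarrow> 'm \<times> 'm \<Rightarrow> ('m \<times> 'm) set" where
  "ext_class C A B x = {y \<in> extensions C A B. ext_map C x y (Ident C B) (Ident C A)}"

text \<open>Arrows into a biproduct are determined by their components, so everything is checked
  componentwise. Only kernels are treated: the cokernel half of \<open>biproduct_extension\<close>
  is this lemma in the opposite category.\<close>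

lemma (in preadditive_category) biproduct_kernel:
  assumes S: "is_biproduct C B B' S i\<^sub>1 i\<^sub>2 p\<^sub>1 p\<^sub>2" and T: "is_biproduct C A A' T k\<^sub>1 k\<^sub>2 q\<^sub>1 q\<^sub>2"
    and U: "is_biproduct C E E' U j\<^sub>1 j\<^sub>2 r\<^sub>1 r\<^sub>2" and x: "is_kernel C i p" and y: "is_kernel C i' p'"
    and t: "Src C i = B" "Tgt C i = E" "Tgt C p = A" "Src C i' = B'" "Tgt C i' = E'" "Tgt C p' = A'"
  shows "is_kernel C (j\<^sub>1 \<^bold>\<circ> i \<^bold>\<circ> p\<^sub>1 \<^bold>+ j\<^sub>2 \<^bold>\<circ> i' \<^bold>\<circ> p\<^sub>2) (k\<^sub>1 \<^bold>\<circ> p \<^bold>\<circ> r\<^sub>1 \<^bold>+ k\<^sub>2 \<^bold>\<circ> p' \<^bold>\<circ> r\<^sub>2)"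
    (is "is_kernel C ?I ?Q")
proof -
  note S' = biproductD(1-15)[OF S] and T' = biproductD(1-15)[OF T] and U' = biproductD(1-15)[OF U]
  note bc = biproduct_comp[OF S] biproduct_comp[OF T] biproduct_comp[OF U]
  note x' = is_kernelD[OF x] and y' = is_kernelD[OF y]
  have t': "i \<in> Arr C" "i' \<in> Arr C" "p \<in> Arr C" "p' \<in> Arr C" "Src C p = E" "Src C p' = E'"
    using x' y' t by auto
  have pi: "p \<^bold>\<circ> i = Zero C B A" "p' \<^bold>\<circ> i' = Zero C B' A'" using x' y' t by auto
  have I: "?I \<in> Arr C" "Src C ?I = S" "Tgt C ?I = U" using S' U' t t' by simp_all
  have Q: "?Q \<in> Arr C" "Src C ?Q = U" "Tgt C ?Q = T" using T' U' t t' by simp_all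
  \<comment> \<open>These identities and the next ones reduce statements about the diagonal arrows
    \<open>?I\<close> and \<open>?Q\<close> to their two components.\<close>
  have rI: "r\<^sub>1 \<^bold>\<circ> ?I = i \<^bold>\<circ> p\<^sub>1" "r\<^sub>2 \<^bold>\<circ> ?I = i' \<^bold>\<circ> p\<^sub>2" using S' U' t t' bc by (simp_all add: distrib)
  have qQ: "q\<^sub>1 \<^bold>\<circ> ?Q = p \<^bold>\<circ> r\<^sub>1" "q\<^sub>2 \<^bold>\<circ> ?Q = p' \<^bold>\<circ> r\<^sub>2" using T' U' t t' bc by (simp_all add: distrib)
  note rI' = comp_cong_left[OF rI(1)] comp_cong_left[OF rI(2)]
  note qQ' = comp_cong_left[OF qQ(1)] comp_cong_left[OF qQ(2)]
  show ?thesis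
  proof (rule is_kernelI)
    show "is_mono C ?I"
    proof (rule monoI)
      fix g D assume "g \<in> Arr C" "Src C g = D" "Tgt C g = Src C ?I" "?I \<^bold>\<circ> g = Zero C D (Tgt C ?I)"
      then have g: "g \<in> Arr C" "Src C g = D" "Tgt C g = S" "?I \<^bold>\<circ> g = Zero C D U" unfolding I .
      have D: "D \<in> Obj C" using src_obj[OF g(1)] g by simp
      have "i \<^bold>\<circ> p\<^sub>1 \<^bold>\<circ> g = r\<^sub>1 \<^bold>\<circ> ?I \<^bold>\<circ> g" "i' \<^bold>\<circ> p\<^sub>2 \<^bold>\<circ> g = r\<^sub>2 \<^bold>\<circ> ?I \<^bold>\<circ> g"
        using rI'[of g] I g(1-3) U' S' t t' by (simp_all del: assoc add: assoc[of g p\<^sub>1 i] assoc[of g p\<^sub>2 i'])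
      then have "i \<^bold>\<circ> p\<^sub>1 \<^bold>\<circ> g = Zero C D E" "i' \<^bold>\<circ> p\<^sub>2 \<^bold>\<circ> g = Zero C D E'" unfolding g(4) using U' D by simp_all
      then have pg: "p\<^sub>1 \<^bold>\<circ> g = Zero C D B" "p\<^sub>2 \<^bold>\<circ> g = Zero C D B'"
        using mono_zeroD[OF kernel_mono[OF x], of "p\<^sub>1 \<^bold>\<circ> g" D] mono_zeroD[OF kernel_mono[OF y], of "p\<^sub>2 \<^bold>\<circ> g" D]
          g(1-3) S' t t' by simp_all
      have "g = Zero C D S" by (rule biproduct_arr_eqI[OF S]) (use pg g(1-3) S' D in simp_all)
      then show "g = Zero C D (Src C ?I)" unfolding I .
    qed (fact I)
    show "?Q \<in> Arr C" by (fact Q)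
    show "Tgt C ?I = Src C ?Q" unfolding I Q ..
    have "?Q \<^bold>\<circ> ?I = Zero C S T"
    proof (rule biproduct_arr_eqI[OF T])
      have "q\<^sub>1 \<^bold>\<circ> ?Q \<^bold>\<circ> ?I = (p \<^bold>\<circ> r\<^sub>1) \<^bold>\<circ> ?I" "q\<^sub>2 \<^bold>\<circ> ?Q \<^bold>\<circ> ?I = (p' \<^bold>\<circ> r\<^sub>2) \<^bold>\<circ> ?I"
        using qQ'[of ?I] Q I T' by simp_all
      moreover have "(p \<^bold>\<circ> r\<^sub>1) \<^bold>\<circ> ?I = p \<^bold>\<circ> r\<^sub>1 \<^bold>\<circ> ?I" "(p' \<^bold>\<circ> r\<^sub>2) \<^bold>\<circ> ?I = p' \<^bold>\<circ> r\<^sub>2 \<^bold>\<circ> ?I"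
        by (rule assoc; use I U' t' in simp)+
      moreover have "p \<^bold>\<circ> i \<^bold>\<circ> p\<^sub>1 = Zero C S A" "p' \<^bold>\<circ> i' \<^bold>\<circ> p\<^sub>2 = Zero C S A'"
        using comp_cong_left[OF pi(1), of p\<^sub>1] comp_cong_left[OF pi(2), of p\<^sub>2] t t' S' T' by simp_all
      ultimately show "q\<^sub>1 \<^bold>\<circ> ?Q \<^bold>\<circ> ?I = q\<^sub>1 \<^bold>\<circ> Zero C S T" "q\<^sub>2 \<^bold>\<circ> ?Q \<^bold>\<circ> ?I = q\<^sub>2 \<^bold>\<circ> Zero C S T"
        using rI T' S' by simp_all
    qed (use Q I S' T' in simp_all)
    then show "?Q \<^bold>\<circ> ?I = Zero C (Src C ?I) (Tgt C ?Q)" unfolding I Q .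
    fix g D assume "g \<in> Arr C" "Src C g = D" "Tgt C g = Src C ?Q" "?Q \<^bold>\<circ> g = Zero C D (Tgt C ?Q)"
    then have g: "g \<in> Arr C" "Src C g = D" "Tgt C g = U" "?Q \<^bold>\<circ> g = Zero C D T" unfolding Q .
    have D: "D \<in> Obj C" using src_obj[OF g(1)] g by simp
    have "p \<^bold>\<circ> r\<^sub>1 \<^bold>\<circ> g = q\<^sub>1 \<^bold>\<circ> ?Q \<^bold>\<circ> g" "p' \<^bold>\<circ> r\<^sub>2 \<^bold>\<circ> g = q\<^sub>2 \<^bold>\<circ> ?Q \<^bold>\<circ> g"
      using qQ'[of g] Q g(1-3) U' T' t t' by (simp_all del: assoc add: assoc[of g r\<^sub>1 p] assoc[of g r\<^sub>2 p'])
    then have z: "p \<^bold>\<circ> r\<^sub>1 \<^bold>\<circ> g = Zero C D A" "p' \<^bold>\<circ> r\<^sub>2 \<^bold>\<circ> g = Zero C D A'" unfolding g(4) using T' D by simp_all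
    obtain h where h: "h \<in> Arr C" "Src C h = D" "Tgt C h = B" "i \<^bold>\<circ> h = r\<^sub>1 \<^bold>\<circ> g"
      using kernelE[OF x, of "r\<^sub>1 \<^bold>\<circ> g" D] z g(1-3) U' t t' by auto
    obtain h' where h': "h' \<in> Arr C" "Src C h' = D" "Tgt C h' = B'" "i' \<^bold>\<circ> h' = r\<^sub>2 \<^bold>\<circ> g"
      using kernelE[OF y, of "r\<^sub>2 \<^bold>\<circ> g" D] z g(1-3) U' t t' by auto
    let ?h = "i\<^sub>1 \<^bold>\<circ> h \<^bold>+ i\<^sub>2 \<^bold>\<circ> h'"
    have hh: "?h \<in> Arr C" "Src C ?h = D" "Tgt C ?h = S" using h h' S' by simp_all
    have ph: "p\<^sub>1 \<^bold>\<circ> ?h = h" "p\<^sub>2 \<^bold>\<circ> ?h = h'" using h h' S' bc by (simp_all add: distrib)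
    have "?I \<^bold>\<circ> ?h = g"
    proof (rule biproduct_arr_eqI[OF U])
      have "r\<^sub>1 \<^bold>\<circ> ?I \<^bold>\<circ> ?h = (i \<^bold>\<circ> p\<^sub>1) \<^bold>\<circ> ?h" "r\<^sub>2 \<^bold>\<circ> ?I \<^bold>\<circ> ?h = (i' \<^bold>\<circ> p\<^sub>2) \<^bold>\<circ> ?h"
        using rI'[of ?h] hh I U' by simp_all
      moreover have "(i \<^bold>\<circ> p\<^sub>1) \<^bold>\<circ> ?h = i \<^bold>\<circ> p\<^sub>1 \<^bold>\<circ> ?h" "(i' \<^bold>\<circ> p\<^sub>2) \<^bold>\<circ> ?h = i' \<^bold>\<circ> p\<^sub>2 \<^bold>\<circ> ?h"
        by (rule assoc; use hh S' t t' in simp)+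
      ultimately show "r\<^sub>1 \<^bold>\<circ> ?I \<^bold>\<circ> ?h = r\<^sub>1 \<^bold>\<circ> g" "r\<^sub>2 \<^bold>\<circ> ?I \<^bold>\<circ> ?h = r\<^sub>2 \<^bold>\<circ> g"
        unfolding ph h(4) h'(4) by auto
    qed (use I hh g in simp_all)
    with hh show "\<exists>h. h \<in> Arr C \<and> Src C h = D \<and> Tgt C h = Src C ?I \<and> ?I \<^bold>\<circ> h = g" unfolding I by blast
  qed
qed

context abelian_category begin

lemma biproduct_extension:
  assumes S: "is_biproduct C B B' S i\<^sub>1 i\<^sub>2 p\<^sub>1 p\<^sub>2" and T: "is_biproduct C A A' T k\<^sub>1 k\<^sub>2 q\<^sub>1 q\<^sub>2"
    and U: "is_biproduct C (Tgt C (fst x)) (Tgt C (fst y)) U j\<^sub>1 j\<^sub>2 r\<^sub>1 r\<^sub>2"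
    and x: "x \<in> extensions C A B" and y: "y \<in> extensions C A' B'"
  shows "((j\<^sub>1 \<^bold>\<circ> fst x \<^bold>\<circ> p\<^sub>1) \<^bold>+ (j\<^sub>2 \<^bold>\<circ> fst y \<^bold>\<circ> p\<^sub>2), (k\<^sub>1 \<^bold>\<circ> snd x \<^bold>\<circ> r\<^sub>1) \<^bold>+ (k\<^sub>2 \<^bold>\<circ> snd y \<^bold>\<circ> r\<^sub>2))
    \<in> extensions C T S"
proof (rule extensionsI)
  note x' = extensionsD[OF x] and y' = extensionsD[OF y]
  note S' = biproductD(1-15)[OF S] and T' = biproductD(1-15)[OF T] and U' = biproductD(1-15)[OF U]
  show "is_kernel C ((j\<^sub>1 \<^bold>\<circ> fst x \<^bold>\<circ> p\<^sub>1) \<^bold>+ (j\<^sub>2 \<^bold>\<circ> fst y \<^bold>\<circ> p\<^sub>2)) ((k\<^sub>1 \<^bold>\<circ> snd x \<^bold>\<circ> r\<^sub>1) \<^bold>+ (k\<^sub>2 \<^bold>\<circ> snd y \<^bold>\<circ> r\<^sub>2))"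
    by (rule biproduct_kernel[OF S T U x'(10) y'(10)]) (use x' y' in simp_all)
  show "is_cokernel C ((k\<^sub>1 \<^bold>\<circ> snd x \<^bold>\<circ> r\<^sub>1) \<^bold>+ (k\<^sub>2 \<^bold>\<circ> snd y \<^bold>\<circ> r\<^sub>2)) ((j\<^sub>1 \<^bold>\<circ> fst x \<^bold>\<circ> p\<^sub>1) \<^bold>+ (j\<^sub>2 \<^bold>\<circ> fst y \<^bold>\<circ> p\<^sub>2))"
    using preadditive_category.biproduct_kernel[OF preadditive_op, of A A' T q\<^sub>1 q\<^sub>2 k\<^sub>1 k\<^sub>2
        B B' S p\<^sub>1 p\<^sub>2 i\<^sub>1 i\<^sub>2 "Tgt C (fst x)" "Tgt C (fst y)" U r\<^sub>1 r\<^sub>2 j\<^sub>1 j\<^sub>2 "snd x" "fst x" "snd y" "fst y"]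
      S T U x' y' S' T' U' by simp
qed (use extensionsD[OF x] extensionsD[OF y] biproductD[OF S] biproductD[OF T] biproductD[OF U] in simp_all)

section \<open>Pushout and pullback of classes\<close>

lemma carrier_Ext1: "\<xi> \<in> carrier (Ext1 C A B) \<longleftrightarrow> (\<exists>x \<in> extensions C A B. \<xi> = ext_class C A B x)"
  by (auto simp: Ext1_def quotient_def ext_class_def extension_equiv_def ext_map_def Image_def)

lemma ext_map_comp':
  assumes "x \<in> extensions C A B" "y \<in> extensions C A' B'" "z \<in> extensions C A'' B''"
    "ext_map C x y b a" "ext_map C y z b' a'" "b'' = b' \<^bold>\<circ> b" "a'' = a' \<^bold>\<circ> a"
  shows "ext_map C x z b'' a''"
  using ext_map_comp[OF assms(1-5)] assms(6,7) by simp

lemma ext_map_HomD: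
  assumes "x \<in> extensions C A B" "y \<in> extensions C A' B'" "ext_map C x y b a"
  shows "b \<in> Hom C B B'" "a \<in> Hom C A A'"
  using assms by (auto simp: ext_map_iff)

text \<open>Another representative of the class only inserts an equivalence before the morphism, so
  one fixed representative suffices.\<close>

lemma ext_push_class:
  assumes "x \<in> extensions C A B" "b \<in> Hom C B B'"
  shows "ext_push C b (ext_class C A B x) = {y \<in> extensions C A B'. ext_map C x y b (Ident C A)}"
proof (intro Set.set_eqI iffI)
  have b: "b \<in> Arr C" "Src C b = B" "Tgt C b = B'" using assms(2) by (auto simp: in_Hom)
  fix y assume "y \<in> ext_push C b (ext_class C A B x)"
  then obtain x' where x': "x' \<in> extensions C A B" "ext_map C x x' (Ident C B) (Ident C A)"
    and y: "y \<in> extensions C (Tgt C (snd x')) (Tgt C b)" "ext_map C x' y b (Ident C (Tgt C (snd x')))"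
    unfolding ext_push_def ext_class_def ext_map_def by blast
  note [simp] = extensionsD[OF x'(1)]
  from y have y': "y \<in> extensions C A B'" "ext_map C x' y b (Ident C A)" using b by simp_all
  with ext_map_comp'[OF assms(1) x'(1) y'(1) x'(2) y'(2)] b
  show "y \<in> {y \<in> extensions C A B'. ext_map C x y b (Ident C A)}" by simp
next
  have b: "b \<in> Arr C" "Src C b = B" "Tgt C b = B'" using assms(2) by (auto simp: in_Hom)
  fix y assume "y \<in> {y \<in> extensions C A B'. ext_map C x y b (Ident C A)}"
  then show "y \<in> ext_push C b (ext_class C A B x)"
    using assms(1) ext_map_ident[OF assms(1)] b extensionsD[OF assms(1)]
    unfolding ext_push_def ext_class_def ext_map_def[symmetric]
    by (intro CollectI bexI[of _ x]) simp_all
qed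

lemma ext_pull_class:
  assumes "x \<in> extensions C A B" "a \<in> Hom C A' A"
  shows "ext_pull C a (ext_class C A B x) = {y \<in> extensions C A' B. ext_map C y x (Ident C B) a}"
proof (intro Set.set_eqI iffI)
  have a: "a \<in> Arr C" "Src C a = A'" "Tgt C a = A" using assms(2) by (auto simp: in_Hom)
  fix y assume "y \<in> ext_pull C a (ext_class C A B x)"
  then obtain x' where x': "x' \<in> extensions C A B" "ext_map C x x' (Ident C B) (Ident C A)"
    and y: "y \<in> extensions C (Src C a) (Src C (fst x'))" "ext_map C y x' (Ident C (Src C (fst x'))) a"
    unfolding ext_pull_def ext_class_def ext_map_def by blast
  note [simp] = extensionsD[OF x'(1)]
  from y have y': "y \<in> extensions C A' B" "ext_map C y x' (Ident C B) a" using a by simp_all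
  with ext_map_comp'[OF y'(1) x'(1) assms(1) y'(2) ext_map_sym[OF assms(1) x']] a
  show "y \<in> {y \<in> extensions C A' B. ext_map C y x (Ident C B) a}" by simp
next
  have a: "a \<in> Arr C" "Src C a = A'" "Tgt C a = A" using assms(2) by (auto simp: in_Hom)
  fix y assume "y \<in> {y \<in> extensions C A' B. ext_map C y x (Ident C B) a}"
  then show "y \<in> ext_pull C a (ext_class C A B x)"
    using assms(1) ext_map_ident[OF assms(1)] a extensionsD[OF assms(1)]
    unfolding ext_pull_def ext_class_def ext_map_def[symmetric]
    by (intro CollectI bexI[of _ x]) simp_all
qed

text \<open>With the identity as second factor, \<open>ext_map_push_factor\<close> says that any two
  pushouts of \<open>x\<close> along \<open>b\<close> are equivalent. Hence the pushed set is a full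
  class and can be computed from a single pushout.\<close>

lemma ext_push_eq:
  assumes "x \<in> extensions C A B" "y \<in> extensions C A B'" "ext_map C x y b (Ident C A)"
  shows "ext_push C b (ext_class C A B x) = ext_class C A B' y"
proof -
  have b: "b \<in> Hom C B B'" using ext_map_HomD assms by blast
  then have b': "b \<in> Arr C" "Tgt C b = B'" by (auto simp: in_Hom)
  note o = extensionsD(6,7)[OF assms(2)]
  show ?thesis unfolding ext_push_class[OF assms(1) b] unfolding ext_class_def
  proof (intro Collect_cong conj_cong refl iffI)
    fix z assume z: "z \<in> extensions C A B'"
    show "ext_map C y z (Ident C B') (Ident C A)" if "ext_map C x z b (Ident C A)"
      by (rule ext_map_push_factor[OF assms(1,2) z assms(3)]) (use that b' o ident_hom in simp_all)
    show "ext_map C x z b (Ident C A)" if "ext_map C y z (Ident C B') (Ident C A)"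
      by (rule ext_map_comp'[OF assms(1,2) z assms(3) that]) (use b' o in simp_all)
  qed
qed

lemma ext_pull_eq:
  assumes "x \<in> extensions C A B" "y \<in> extensions C A' B" "ext_map C y x (Ident C B) a"
  shows "ext_pull C a (ext_class C A B x) = ext_class C A' B y"
proof -
  have a: "a \<in> Hom C A' A" using ext_map_HomD assms by blast
  then have a': "a \<in> Arr C" "Src C a = A'" by (auto simp: in_Hom)
  note o = extensionsD(6,7)[OF assms(2)]
  show ?thesis unfolding ext_pull_class[OF assms(1) a] unfolding ext_class_def
  proof (intro Collect_cong conj_cong refl iffI)
    fix z assume z: "z \<in> extensions C A' B"
    show "ext_map C y z (Ident C B) (Ident C A')" if "ext_map C z x (Ident C B) a"
      by (rule ext_map_sym[OF z assms(2)], rule ext_map_pull_factor[OF assms(1,2) z assms(3)])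
        (use that a' o ident_hom in simp_all)
    show "ext_map C z x (Ident C B) a" if "ext_map C y z (Ident C B) (Ident C A')"
      by (rule ext_map_comp'[OF z assms(2,1) ext_map_sym[OF assms(2) z that] assms(3)]) (use a' o in simp_all)
  qed
qed

lemma ext_push_closed:
  assumes "\<xi> \<in> carrier (Ext1 C A B)" "b \<in> Hom C B B'"
  shows "ext_push C b \<xi> \<in> carrier (Ext1 C A B')"
  using assms ext_map_push_ex ext_push_eq unfolding carrier_Ext1 by metis

lemma ext_pull_closed:
  assumes "\<xi> \<in> carrier (Ext1 C A B)" "a \<in> Hom C A' A"
  shows "ext_pull C a \<xi> \<in> carrier (Ext1 C A' B)"
  using assms ext_map_pull_ex ext_pull_eq unfolding carrier_Ext1 by metis

lemma ext_pull_ident: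
  assumes "\<xi> \<in> carrier (Ext1 C A B)"
  shows "ext_pull C (Ident C A) \<xi> = \<xi>"
  using assms ext_pull_eq ext_map_ident unfolding carrier_Ext1 by metis

lemma ext_pull_comp:
  assumes "\<xi> \<in> carrier (Ext1 C A B)" "a \<in> Hom C A' A" "a' \<in> Hom C A'' A'"
  shows "ext_pull C (a \<^bold>\<circ> a') \<xi> = ext_pull C a' (ext_pull C a \<xi>)"
proof -
  obtain x where x: "x \<in> extensions C A B" "\<xi> = ext_class C A B x" using assms(1) carrier_Ext1 by blast
  obtain y where y: "y \<in> extensions C A' B" "ext_map C y x (Ident C B) a"
    using ext_map_pull_ex[OF x(1) assms(2)] by blast
  obtain z where z: "z \<in> extensions C A'' B" "ext_map C z y (Ident C B) a'"
    using ext_map_pull_ex[OF y(1) assms(3)] by blast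
  have "ext_map C z x (Ident C B) (a \<^bold>\<circ> a')"
    by (rule ext_map_comp'[OF z(1) y(1) x(1) z(2) y(2)]) (use extensionsD[OF x(1)] in simp_all)
  then show ?thesis
    unfolding x(2) ext_pull_eq[OF x(1) y] ext_pull_eq[OF y(1) z] by (rule ext_pull_eq[OF x(1) z(1)])
qed

text \<open>The composite from the pullback of \<open>x\<close> through \<open>x\<close> to its
  pushout has outer components \<open>b\<close> and \<open>a\<close>. Factoring it through the
  pullback of the pushout leaves \<open>b\<close> and the identity.\<close>

lemma ext_push_pull:
  assumes "\<xi> \<in> carrier (Ext1 C A B)" "a \<in> Hom C A' A" "b \<in> Hom C B B'"
  shows "ext_push C b (ext_pull C a \<xi>) = ext_pull C a (ext_push C b \<xi>)"
proof -
  obtain x where x: "x \<in> extensions C A B" "\<xi> = ext_class C A B x" using assms(1) carrier_Ext1 by blast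
  obtain y where y: "y \<in> extensions C A' B" "ext_map C y x (Ident C B) a"
    using ext_map_pull_ex[OF x(1) assms(2)] by blast
  obtain z where z: "z \<in> extensions C A B'" "ext_map C x z b (Ident C A)"
    using ext_map_push_ex[OF x(1) assms(3)] by blast
  obtain w where w: "w \<in> extensions C A' B'" "ext_map C w z (Ident C B') a"
    using ext_map_pull_ex[OF z(1) assms(2)] by blast
  have "ext_map C y z b a"
    by (rule ext_map_comp'[OF y(1) x(1) z(1) y(2) z(2)]) (use assms(2,3) in \<open>simp_all add: in_Hom\<close>)
  then have "ext_map C y w b (Ident C A')"
    by (intro ext_map_pull_factor[OF z(1) w(1) y(1) w(2)])
      (use assms(2) extensionsD[OF y(1)] ident_hom in \<open>simp_all add: in_Hom\<close>)
  then show ?thesis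
    unfolding x(2) ext_pull_eq[OF x(1) y] ext_push_eq[OF x(1) z] ext_pull_eq[OF z(1) w]
    by (rule ext_push_eq[OF y(1) w(1)])
qed

text \<open>A morphism with zero left component has a middle arrow killing \<open>fst x\<close>,
  which descends along \<open>snd x\<close> to a section. Conversely, a section after
  \<open>snd x\<close> is such a middle arrow.\<close>

lemma ext_push_zero:
  assumes "\<xi> \<in> carrier (Ext1 C A K)" "B \<in> Obj C"
  shows "ext_push C (Zero C K B) \<xi> = split_extensions C A B"
proof -
  obtain x where x: "x \<in> extensions C A K" "\<xi> = ext_class C A K x" using assms(1) carrier_Ext1 by blast
  note x' = extensionsD[OF x(1)]
  have z: "Zero C K B \<in> Hom C K B" using x' assms(2) by (simp add: in_Hom)
  have "ext_map C x y (Zero C K B) (Ident C A) \<longleftrightarrow> (\<exists>s\<in>Hom C A (Src C (snd y)). snd y \<^bold>\<circ> s = Ident C A)"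
    if y: "y \<in> extensions C A B" for y
  proof
    note y' = extensionsD[OF y]
    assume "ext_map C x y (Zero C K B) (Ident C A)"
    then obtain e where e: "e \<in> Arr C" "Src C e = Src C (snd x)" "Tgt C e = Src C (snd y)"
      "e \<^bold>\<circ> fst x = Zero C K (Src C (snd y))" "snd y \<^bold>\<circ> e = snd x"
      unfolding ext_map_iff[OF x(1) y] using x' y' assms by auto
    obtain s where s: "s \<in> Arr C" "Tgt C s = Src C (snd y)" "Src C s = A" "s \<^bold>\<circ> snd x = e"
      using cokernelE[OF x'(11), of e "Src C (snd y)"] e x' by auto
    have "(snd y \<^bold>\<circ> s) \<^bold>\<circ> snd x = Ident C A \<^bold>\<circ> snd x" using s x' y' e by simp
    then have "snd y \<^bold>\<circ> s = Ident C A" by (rule epiD[OF x'(13)]) (use s x' y' in simp_all)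
    with s show "\<exists>s\<in>Hom C A (Src C (snd y)). snd y \<^bold>\<circ> s = Ident C A" by (auto simp: in_Hom)
  next
    note y' = extensionsD[OF y]
    assume "\<exists>s\<in>Hom C A (Src C (snd y)). snd y \<^bold>\<circ> s = Ident C A"
    then obtain s where s: "s \<in> Arr C" "Tgt C s = Src C (snd y)" "Src C s = A" "snd y \<^bold>\<circ> s = Ident C A"
      by (auto simp: in_Hom)
    show "ext_map C x y (Zero C K B) (Ident C A)"
      unfolding ext_map_iff[OF x(1) y] using x' y' s z ident_hom comp_cong_left[OF s(4), of "snd x"]
      by (intro conjI exI[of _ "s \<^bold>\<circ> snd x"]) simp_all
  qed
  then show ?thesis unfolding x(2) ext_push_class[OF x(1) z] split_extensions_def by blast
qed

text \<open>In \<open>baer_sum\<close> the pullback is taken of the singleton of one extension and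
  not of a class. Membership in the result is therefore expressed through an intermediate extension
  \<open>w\<close>.\<close>

lemma in_ext_push_pull_iff:
  assumes "d \<in> extensions C T S" "k \<in> Hom C A T" "p \<in> Hom C S B"
  shows "z \<in> ext_push C p (ext_pull C k {d}) \<longleftrightarrow> z \<in> extensions C A B \<and>
    (\<exists>w \<in> extensions C A S. ext_map C w d (Ident C S) k \<and> ext_map C w z p (Ident C A))"
  using extensionsD(3)[OF assms(1)] assms(2,3) extensionsD(4)[of _ A S]
  unfolding ext_push_def ext_pull_def by (auto simp: in_Hom ext_map_def)

text \<open>The morphisms from \<open>x\<close> to its two pushouts combine to a morphism into their
  direct sum, lying over the diagonal of A. It factors through the pullback along the diagonal, and
  the codiagonal after its left component \<open>i\<^sub>1 f + i\<^sub>2 g\<close> is f + g.\<close>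

lemma ext_push_plus:
  assumes "\<xi> \<in> carrier (Ext1 C A K)" "f \<in> Hom C K B" "g \<in> Hom C K B"
  shows "baer_sum C A B (ext_push C f \<xi>) (ext_push C g \<xi>) = ext_push C (f \<^bold>+ g) \<xi>"
proof -
  obtain x where x: "x \<in> extensions C A K" "\<xi> = ext_class C A K x" using assms(1) carrier_Ext1 by blast
  note x' = extensionsD[OF x(1)]
  have fg: "f \<in> Arr C" "Src C f = K" "Tgt C f = B" "g \<in> Arr C" "Src C g = K" "Tgt C g = B"
    using assms(2,3) by (auto simp: in_Hom)
  then have fgH: "f \<^bold>+ g \<in> Hom C K B" by (simp add: in_Hom)
  have B: "B \<in> Obj C" using tgt_obj[OF fg(1)] fg by simp
  note A = x'(6)
  \<comment> \<open>All representatives and biproducts are arbitrary here: one inclusion below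
    receives them from the union in \<open>baer_sum\<close>, the other chooses them.\<close>
  have main: "((j\<^sub>1 \<^bold>\<circ> fst y \<^bold>\<circ> p\<^sub>1) \<^bold>+ (j\<^sub>2 \<^bold>\<circ> fst y' \<^bold>\<circ> p\<^sub>2),
           (k\<^sub>1 \<^bold>\<circ> snd y \<^bold>\<circ> r\<^sub>1) \<^bold>+ (k\<^sub>2 \<^bold>\<circ> snd y' \<^bold>\<circ> r\<^sub>2)) \<in> extensions C T S \<and>
      (\<forall>w \<in> extensions C A S. ext_map C w ((j\<^sub>1 \<^bold>\<circ> fst y \<^bold>\<circ> p\<^sub>1) \<^bold>+ (j\<^sub>2 \<^bold>\<circ> fst y' \<^bold>\<circ> p\<^sub>2),
           (k\<^sub>1 \<^bold>\<circ> snd y \<^bold>\<circ> r\<^sub>1) \<^bold>+ (k\<^sub>2 \<^bold>\<circ> snd y' \<^bold>\<circ> r\<^sub>2)) (Ident C S) (k\<^sub>1 \<^bold>+ k\<^sub>2) \<longrightarrow>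
        (\<forall>z \<in> extensions C A B. ext_map C w z (p\<^sub>1 \<^bold>+ p\<^sub>2) (Ident C A) \<longleftrightarrow> ext_map C x z (f \<^bold>+ g) (Ident C A)))"
    (is "?d \<in> _ \<and> _")
    if y: "y \<in> extensions C A B" "ext_map C x y f (Ident C A)"
      and y': "y' \<in> extensions C A B" "ext_map C x y' g (Ident C A)"
      and S: "is_biproduct C B B S i\<^sub>1 i\<^sub>2 p\<^sub>1 p\<^sub>2" and T: "is_biproduct C A A T k\<^sub>1 k\<^sub>2 q\<^sub>1 q\<^sub>2"
      and U: "is_biproduct C (Tgt C (fst y)) (Tgt C (fst y')) U j\<^sub>1 j\<^sub>2 r\<^sub>1 r\<^sub>2"
    for y y' S i\<^sub>1 i\<^sub>2 p\<^sub>1 p\<^sub>2 T k\<^sub>1 k\<^sub>2 q\<^sub>1 q\<^sub>2 U j\<^sub>1 j\<^sub>2 r\<^sub>1 r\<^sub>2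
  proof (intro conjI ballI impI)
    note S' = biproductD(1-15)[OF S] and T' = biproductD(1-15)[OF T] and U' = biproductD(1-15)[OF U]
    note bc = biproduct_comp[OF S] biproduct_comp[OF T] biproduct_comp[OF U]
    note y1 = extensionsD(1-8)[OF y(1)] and y1' = extensionsD(1-8)[OF y'(1)]
    show d: "?d \<in> extensions C T S" by (rule biproduct_extension[OF S T U y(1) y'(1)])
    obtain e where e: "e \<in> Arr C" "Src C e = Src C (snd x)" "Tgt C e = Src C (snd y)"
      "e \<^bold>\<circ> fst x = fst y \<^bold>\<circ> f" "snd y \<^bold>\<circ> e = snd x"
      using y(2) x' unfolding ext_map_iff[OF x(1) y(1)] by auto
    obtain e' where e': "e' \<in> Arr C" "Src C e' = Src C (snd x)" "Tgt C e' = Src C (snd y')"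
      "e' \<^bold>\<circ> fst x = fst y' \<^bold>\<circ> g" "snd y' \<^bold>\<circ> e' = snd x"
      using y'(2) x' unfolding ext_map_iff[OF x(1) y'(1)] by auto
    have k: "k\<^sub>1 \<^bold>+ k\<^sub>2 \<in> Hom C A T" using T' by (simp add: in_Hom)
    have b: "i\<^sub>1 \<^bold>\<circ> f \<^bold>+ i\<^sub>2 \<^bold>\<circ> g \<in> Hom C K S" using S' fg by (simp add: in_Hom)
    have "(j\<^sub>1 \<^bold>\<circ> e \<^bold>+ j\<^sub>2 \<^bold>\<circ> e') \<^bold>\<circ> fst x = fst ?d \<^bold>\<circ> (i\<^sub>1 \<^bold>\<circ> f \<^bold>+ i\<^sub>2 \<^bold>\<circ> g)"
      using e e' fg x' y1 y1' S' U' bc by (simp add: distrib)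
    moreover have "snd ?d \<^bold>\<circ> (j\<^sub>1 \<^bold>\<circ> e \<^bold>+ j\<^sub>2 \<^bold>\<circ> e') = (k\<^sub>1 \<^bold>+ k\<^sub>2) \<^bold>\<circ> snd x"
      using e e' fg x' y1 y1' T' U' bc by (simp add: distrib)
    ultimately have xd: "ext_map C x ?d (i\<^sub>1 \<^bold>\<circ> f \<^bold>+ i\<^sub>2 \<^bold>\<circ> g) (k\<^sub>1 \<^bold>+ k\<^sub>2)"
      unfolding ext_map_iff[OF x(1) d] using b k e(1-3) e'(1-3) U' T' y1 y1'
      by (intro conjI exI[of _ "j\<^sub>1 \<^bold>\<circ> e \<^bold>+ j\<^sub>2 \<^bold>\<circ> e'"]) simp_all
    fix w z assume w: "w \<in> extensions C A S" "ext_map C w ?d (Ident C S) (k\<^sub>1 \<^bold>+ k\<^sub>2)"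
      and z: "z \<in> extensions C A B"
    have xw: "ext_map C x w (i\<^sub>1 \<^bold>\<circ> f \<^bold>+ i\<^sub>2 \<^bold>\<circ> g) (Ident C A)"
      by (rule ext_map_pull_factor[OF d w(1) x(1) w(2)]) (use xd k A ident_hom in \<open>simp_all add: in_Hom\<close>)
    have eq: "f \<^bold>+ g = (p\<^sub>1 \<^bold>+ p\<^sub>2) \<^bold>\<circ> (i\<^sub>1 \<^bold>\<circ> f \<^bold>+ i\<^sub>2 \<^bold>\<circ> g)" using S' fg bc by (simp add: distrib)
    show "ext_map C w z (p\<^sub>1 \<^bold>+ p\<^sub>2) (Ident C A) \<longleftrightarrow> ext_map C x z (f \<^bold>+ g) (Ident C A)"
    proof
      show "ext_map C w z (p\<^sub>1 \<^bold>+ p\<^sub>2) (Ident C A) \<Longrightarrow> ext_map C x z (f \<^bold>+ g) (Ident C A)"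
        by (rule ext_map_comp'[OF x(1) w(1) z xw _ eq], assumption) (simp add: A)
      show "ext_map C x z (f \<^bold>+ g) (Ident C A) \<Longrightarrow> ext_map C w z (p\<^sub>1 \<^bold>+ p\<^sub>2) (Ident C A)"
        unfolding eq by (rule ext_map_push_factor[OF x(1) w(1) z xw]) (use S' in \<open>simp_all add: in_Hom\<close>)
    qed
  qed
  show ?thesis
  proof (intro Set.set_eqI iffI)
    fix z assume "z \<in> baer_sum C A B (ext_push C f \<xi>) (ext_push C g \<xi>)"
    then obtain y y' S i\<^sub>1 i\<^sub>2 p\<^sub>1 p\<^sub>2 T k\<^sub>1 k\<^sub>2 q\<^sub>1 q\<^sub>2 U j\<^sub>1 j\<^sub>2 r\<^sub>1 r\<^sub>2 where
      y: "y \<in> extensions C A B" "ext_map C x y f (Ident C A)"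
      and y': "y' \<in> extensions C A B" "ext_map C x y' g (Ident C A)"
      and S: "is_biproduct C B B S i\<^sub>1 i\<^sub>2 p\<^sub>1 p\<^sub>2" and T: "is_biproduct C A A T k\<^sub>1 k\<^sub>2 q\<^sub>1 q\<^sub>2"
      and U: "is_biproduct C (Tgt C (fst y)) (Tgt C (fst y')) U j\<^sub>1 j\<^sub>2 r\<^sub>1 r\<^sub>2"
      and z: "z \<in> ext_push C (p\<^sub>1 \<^bold>+ p\<^sub>2) (ext_pull C (k\<^sub>1 \<^bold>+ k\<^sub>2) {((j\<^sub>1 \<^bold>\<circ> fst y \<^bold>\<circ> p\<^sub>1) \<^bold>+ (j\<^sub>2 \<^bold>\<circ> fst y' \<^bold>\<circ> p\<^sub>2),
           (k\<^sub>1 \<^bold>\<circ> snd y \<^bold>\<circ> r\<^sub>1) \<^bold>+ (k\<^sub>2 \<^bold>\<circ> snd y' \<^bold>\<circ> r\<^sub>2))})"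
      unfolding baer_sum_def x(2) ext_push_class[OF x(1) assms(2)] ext_push_class[OF x(1) assms(3)]
      by blast
    have h: "k\<^sub>1 \<^bold>+ k\<^sub>2 \<in> Hom C A T" "p\<^sub>1 \<^bold>+ p\<^sub>2 \<in> Hom C S B"
      using biproductD[OF S] biproductD[OF T] by (simp_all add: in_Hom)
    note m = main[OF y y' S T U]
    show "z \<in> ext_push C (f \<^bold>+ g) \<xi>"
      using z m unfolding in_ext_push_pull_iff[OF conjunct1[OF m] h] x(2) ext_push_class[OF x(1) fgH] by blast
  next
    fix z assume "z \<in> ext_push C (f \<^bold>+ g) \<xi>"
    then have z: "z \<in> extensions C A B" "ext_map C x z (f \<^bold>+ g) (Ident C A)"
      unfolding x(2) ext_push_class[OF x(1) fgH] by auto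
    obtain y where y: "y \<in> extensions C A B" "ext_map C x y f (Ident C A)"
      using ext_map_push_ex[OF x(1) assms(2)] by blast
    obtain y' where y': "y' \<in> extensions C A B" "ext_map C x y' g (Ident C A)"
      using ext_map_push_ex[OF x(1) assms(3)] by blast
    obtain S i\<^sub>1 i\<^sub>2 p\<^sub>1 p\<^sub>2 where S: "is_biproduct C B B S i\<^sub>1 i\<^sub>2 p\<^sub>1 p\<^sub>2" using ex_biproduct[OF B B] by blast
    obtain T k\<^sub>1 k\<^sub>2 q\<^sub>1 q\<^sub>2 where T: "is_biproduct C A A T k\<^sub>1 k\<^sub>2 q\<^sub>1 q\<^sub>2" using ex_biproduct[OF A A] by blast
    obtain U j\<^sub>1 j\<^sub>2 r\<^sub>1 r\<^sub>2 where U: "is_biproduct C (Tgt C (fst y)) (Tgt C (fst y')) U j\<^sub>1 j\<^sub>2 r\<^sub>1 r\<^sub>2"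
      using ex_biproduct extensionsD[OF y(1)] extensionsD[OF y'(1)] by metis
    have h: "k\<^sub>1 \<^bold>+ k\<^sub>2 \<in> Hom C A T" "p\<^sub>1 \<^bold>+ p\<^sub>2 \<in> Hom C S B"
      using biproductD[OF S] biproductD[OF T] by (simp_all add: in_Hom)
    note m = main[OF y y' S T U]
    have "z \<in> ext_push C (p\<^sub>1 \<^bold>+ p\<^sub>2) (ext_pull C (k\<^sub>1 \<^bold>+ k\<^sub>2) {((j\<^sub>1 \<^bold>\<circ> fst y \<^bold>\<circ> p\<^sub>1) \<^bold>+ (j\<^sub>2 \<^bold>\<circ> fst y' \<^bold>\<circ> p\<^sub>2),
           (k\<^sub>1 \<^bold>\<circ> snd y \<^bold>\<circ> r\<^sub>1) \<^bold>+ (k\<^sub>2 \<^bold>\<circ> snd y' \<^bold>\<circ> r\<^sub>2))})"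
      using z m ext_map_pull_ex[OF conjunct1[OF m] h(1)] unfolding in_ext_push_pull_iff[OF conjunct1[OF m] h] by blast
    then show "z \<in> baer_sum C A B (ext_push C f \<xi>) (ext_push C g \<xi>)"
      using y y' S T U
      unfolding baer_sum_def x(2) ext_push_class[OF x(1) assms(2)] ext_push_class[OF x(1) assms(3)]
      by blast
  qed
qed

end


section \<open>Stable categories\<close>

text \<open>These closure properties make the arrows that factor through objects of
  \<open>\<P>\<close> a two-sided ideal. The two instances are the projective and the injective
  objects.\<close>

locale stable_ideal = abelian_category +
  fixes \<P> :: "'a \<Rightarrow> bool"
  assumes P_obj: "\<P> Q \<Longrightarrow> Q \<in> Obj C"
    and P_zero: "\<exists>Z. is_zero_object C Z \<and> \<P> Z"
    and P_biproduct: "is_biproduct C Q Q' S i\<^sub>1 i\<^sub>2 p\<^sub>1 p\<^sub>2 \<Longrightarrow> \<P> Q \<Longrightarrow> \<P> Q' \<Longrightarrow> \<P> S"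
begin

abbreviation "ft \<equiv> factors_through C \<P>"

section \<open>The ideal of factoring arrows and its congruence\<close>

lemma ftI: "\<P> Q \<Longrightarrow> u \<in> Arr C \<Longrightarrow> v \<in> Arr C \<Longrightarrow> Tgt C u = Q \<Longrightarrow> Src C v = Q \<Longrightarrow> h = v \<^bold>\<circ> u \<Longrightarrow> ft h"
  unfolding factors_through_def by (intro exI[of _ Q] conjI bexI[of _ u] bexI[of _ v]) (auto simp: in_Hom)

lemma ftE:
  assumes "ft h"
  obtains Q u v where "\<P> Q" "u \<in> Arr C" "v \<in> Arr C" "Src C u = Src C h" "Tgt C u = Q" "Src C v = Q"
    "Tgt C v = Tgt C h" "h = v \<^bold>\<circ> u"
  using assms unfolding factors_through_def by (auto simp: in_Hom)

lemma ft_zero: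
  assumes "A \<in> Obj C" "B \<in> Obj C"
  shows "ft (Zero C A B)"
proof -
  obtain Z where Z: "is_zero_object C Z" "\<P> Z" using P_zero by blast
  then have "Z \<in> Obj C" by (simp add: P_obj)
  then show ?thesis using assms Z(2) by (intro ftI[of Z "Zero C A Z" "Zero C Z B"]) simp_all
qed

text \<open>The sum of two factorizations runs through the biproduct of their middle
  objects.\<close>

lemma ft_plus:
  assumes "ft h" "ft h'" "h \<in> Arr C" "h' \<in> Arr C" "Src C h = Src C h'" "Tgt C h = Tgt C h'"
  shows "ft (h \<^bold>+ h')"
proof -
  obtain Q u v where q: "\<P> Q" "u \<in> Arr C" "v \<in> Arr C" "Src C u = Src C h" "Tgt C u = Q" "Src C v = Q"
    "Tgt C v = Tgt C h" and h: "h = v \<^bold>\<circ> u" using ftE[OF assms(1)] .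
  obtain Q' u' v' where q': "\<P> Q'" "u' \<in> Arr C" "v' \<in> Arr C" "Src C u' = Src C h'" "Tgt C u' = Q'"
    "Src C v' = Q'" "Tgt C v' = Tgt C h'" and h': "h' = v' \<^bold>\<circ> u'" using ftE[OF assms(2)] .
  obtain S i\<^sub>1 i\<^sub>2 p\<^sub>1 p\<^sub>2 where S: "is_biproduct C Q Q' S i\<^sub>1 i\<^sub>2 p\<^sub>1 p\<^sub>2"
    using ex_biproduct P_obj q(1) q'(1) by blast
  note s = biproductD(1-15)[OF S]
  have t: "Src C u = Src C u'" "Tgt C v = Tgt C v'" using q q' assms by auto
  show ?thesis
  proof (rule ftI[OF P_biproduct[OF S q(1) q'(1)]])
    show "h \<^bold>+ h' = (v \<^bold>\<circ> p\<^sub>1 \<^bold>+ v' \<^bold>\<circ> p\<^sub>2) \<^bold>\<circ> (i\<^sub>1 \<^bold>\<circ> u \<^bold>+ i\<^sub>2 \<^bold>\<circ> u')"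
      unfolding h h' using q(2,3,5,6) q'(2,3,5,6) s t biproduct_comp[OF S] src_obj[of u'] tgt_obj[of v']
      by (simp add: distrib)
  qed (use q(2,3,5,6) q'(2,3,5,6) s t in simp_all)
qed

lemma ft_comp:
  assumes "ft h" "g \<in> Arr C" "h \<in> Arr C"
  shows "Tgt C h = Src C g \<Longrightarrow> ft (g \<^bold>\<circ> h)" "Tgt C g = Src C h \<Longrightarrow> ft (h \<^bold>\<circ> g)"
proof -
  obtain Q u v where q: "\<P> Q" "u \<in> Arr C" "v \<in> Arr C" "Src C u = Src C h" "Tgt C u = Q" "Src C v = Q"
    "Tgt C v = Tgt C h" and h: "h = v \<^bold>\<circ> u" using ftE[OF assms(1)] .
  show "Tgt C h = Src C g \<Longrightarrow> ft (g \<^bold>\<circ> h)"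
    by (rule ftI[OF q(1), of u "g \<^bold>\<circ> v"]; unfold h) (use q(2,3,5,6) assms(2) in simp_all)
  show "Tgt C g = Src C h \<Longrightarrow> ft (h \<^bold>\<circ> g)"
    by (rule ftI[OF q(1), of "u \<^bold>\<circ> g" v]; unfold h) (use q(2,3,5,6) assms(2) in simp_all)
qed

lemma ft_neg:
  assumes "ft h" "h \<in> Arr C"
  shows "ft (neg h)"
proof -
  have "neg h = neg (Ident C (Tgt C h)) \<^bold>\<circ> h" using assms tgt_obj by simp
  then show ?thesis using ft_comp(1)[OF assms(1), of "neg (Ident C (Tgt C h))"] assms tgt_obj by simp
qed

text \<open>Congruence modulo the ideal. The typing is built in because sums and differences are
  meaningful only for parallel arrows.\<close>

definition scong where
  "scong f g \<longleftrightarrow> f \<in> Arr C \<and> g \<in> Arr C \<and> Src C f = Src C g \<and> Tgt C f = Tgt C g \<and> ft (f \<^bold>+ neg g)"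

lemma scong_refl: "f \<in> Arr C \<Longrightarrow> scong f f"
  using ft_zero src_obj tgt_obj by (simp add: scong_def)

lemma scong_sym:
  assumes "scong f g"
  shows "scong g f"
proof -
  have t: "f \<in> Arr C" "g \<in> Arr C" "Src C f = Src C g" "Tgt C f = Tgt C g" "ft (f \<^bold>+ neg g)"
    using assms by (auto simp: scong_def)
  have "neg (f \<^bold>+ neg g) = g \<^bold>+ neg f" using t(1-4) by (simp add: plus_comm[of g])
  with ft_neg[OF t(5)] t show ?thesis by (simp add: scong_def)
qed

lemma scong_trans:
  assumes "scong f g" "scong g h"
  shows "scong f h"
proof -
  have t: "f \<in> Arr C" "g \<in> Arr C" "Src C f = Src C g" "Tgt C f = Tgt C g" "ft (f \<^bold>+ neg g)"
    "h \<in> Arr C" "Src C g = Src C h" "Tgt C g = Tgt C h" "ft (g \<^bold>+ neg h)"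
    using assms by (auto simp: scong_def)
  have "(f \<^bold>+ neg g) \<^bold>+ (g \<^bold>+ neg h) = f \<^bold>+ neg h" using t(1-4,6-8) by (simp add: plus_assoc)
  with ft_plus[OF t(5,9)] t(1-4,6-8) show ?thesis by (simp add: scong_def)
qed

lemma scong_comp:
  assumes "scong f f'" "scong g g'" "Tgt C f = Src C g"
  shows "scong (g \<^bold>\<circ> f) (g' \<^bold>\<circ> f')"
proof -
  have t: "f \<in> Arr C" "f' \<in> Arr C" "Src C f = Src C f'" "Tgt C f = Tgt C f'" "ft (f \<^bold>+ neg f')"
    "g \<in> Arr C" "g' \<in> Arr C" "Src C g = Src C g'" "Tgt C g = Tgt C g'" "ft (g \<^bold>+ neg g')"
    "Tgt C f' = Src C g'"
    using assms by (auto simp: scong_def)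
  have "scong (g \<^bold>\<circ> f) (g \<^bold>\<circ> f')"
    using ft_comp(1)[OF t(5), of g] t(1-4,6-9,11) by (simp add: scong_def distrib)
  moreover have "scong (g \<^bold>\<circ> f') (g' \<^bold>\<circ> f')"
    using ft_comp(2)[OF t(10), of f'] t(1-4,6-9,11) by (simp add: scong_def distrib)
  ultimately show ?thesis by (rule scong_trans)
qed

lemma scong_plus:
  assumes "scong f f'" "scong g g'" "Src C f = Src C g" "Tgt C f = Tgt C g"
  shows "scong (f \<^bold>+ g) (f' \<^bold>+ g')"
proof -
  have t: "f \<in> Arr C" "f' \<in> Arr C" "Src C f = Src C g'" "Tgt C f = Tgt C g'" "ft (f \<^bold>+ neg f')"
    "g \<in> Arr C" "g' \<in> Arr C" "Src C g = Src C g'" "Tgt C g = Tgt C g'" "ft (g \<^bold>+ neg g')"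
    "Src C f' = Src C g'" "Tgt C f' = Tgt C g'"
    using assms by (auto simp: scong_def)
  have "(f \<^bold>+ neg f') \<^bold>+ (g \<^bold>+ neg g') = f \<^bold>+ (neg f' \<^bold>+ (g \<^bold>+ neg g'))"
    using t(1-4,6-9,11-12) by (simp add: plus_assoc)
  also have "\<dots> = f \<^bold>+ (g \<^bold>+ (neg f' \<^bold>+ neg g'))"
    using t(1-4,6-9,11-12) plus_left_comm[of "neg f'" g "neg g'"] by simp
  also have "\<dots> = (f \<^bold>+ g) \<^bold>+ neg (f' \<^bold>+ g')" using t(1-4,6-9,11-12) by (simp add: plus_assoc)
  finally have e: "(f \<^bold>+ neg f') \<^bold>+ (g \<^bold>+ neg g') = (f \<^bold>+ g) \<^bold>+ neg (f' \<^bold>+ g')" .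
  have "ft ((f \<^bold>+ neg f') \<^bold>+ (g \<^bold>+ neg g'))"
    by (rule ft_plus[OF t(5,10)]) (use t(1-4,6-9,11-12) in simp_all)
  then have "ft ((f \<^bold>+ g) \<^bold>+ neg (f' \<^bold>+ g'))" unfolding e .
  then show ?thesis unfolding scong_def
    using t(1-4,6-9,11-12) by (intro conjI) (simp_all del: neg_plus)
qed

text \<open>\<open>stable_class\<close> asks for a summand \<open>h\<close> with f = g + h. Solving
  for \<open>h\<close> exhibits it as a congruence class, so that equality of classes becomes
  \<open>scong\<close>.\<close>

lemma stable_class_eq: "f \<in> Arr C \<Longrightarrow> stable_class C \<P> f = {g. scong f g}"
proof (intro Set.set_eqI iffI)
  fix g assume f: "f \<in> Arr C" and "g \<in> stable_class C \<P> f"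
  then have g: "g \<in> Hom C (Src C f) (Tgt C f)" "\<exists>h \<in> Hom C (Src C f) (Tgt C f). ft h \<and> f = g \<^bold>+ h"
    unfolding stable_class_def by simp_all
  then obtain h where h': "h \<in> Hom C (Src C f) (Tgt C f)" "ft h" and fg: "f = g \<^bold>+ h" by blast
  have h: "g \<in> Arr C" "Src C g = Src C f" "Tgt C g = Tgt C f" "h \<in> Arr C"
    "Src C h = Src C f" "Tgt C h = Tgt C f" "ft h" using g(1) h' by (simp_all add: in_Hom)
  have "f \<^bold>+ neg g = (h \<^bold>+ g) \<^bold>+ neg g" using fg plus_comm[of g h] h(1-6) by metis
  also have "\<dots> = h" using h(1-6) by (simp add: plus_assoc)
  finally have "f \<^bold>+ neg g = h" .
  then show "g \<in> {g. scong f g}" using h f by (simp add: scong_def)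
next
  fix g assume f: "f \<in> Arr C" and "g \<in> {g. scong f g}"
  then have g: "g \<in> Arr C" "Src C f = Src C g" "Tgt C f = Tgt C g" "ft (f \<^bold>+ neg g)" by (auto simp: scong_def)
  have e: "f = g \<^bold>+ (f \<^bold>+ neg g)" using g f by simp
  show "g \<in> stable_class C \<P> f"
    unfolding stable_class_def
    by (intro CollectI conjI bexI[of _ "f \<^bold>+ neg g"]; (rule e)?) (use g f in \<open>simp_all add: in_Hom\<close>)
qed

lemma stable_class_eq_iff:
  "f \<in> Arr C \<Longrightarrow> g \<in> Arr C \<Longrightarrow> stable_class C \<P> f = stable_class C \<P> g \<longleftrightarrow> scong f g"
  unfolding stable_class_eq by (blast intro: scong_refl scong_sym scong_trans)

text \<open>\<open>stable_cat\<close> computes with representatives picked by \<open>SOME\<close>.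
  They are congruent to the given arrow, so the operations agree with those on arbitrary
  representatives, as stated in \<open>stable_simps\<close>.\<close>

lemma some_stable_class:
  assumes "f \<in> Arr C"
  shows "scong f (SOME g. g \<in> stable_class C \<P> f)"
  using someI[of "\<lambda>g. g \<in> stable_class C \<P> f" f] scong_refl assms by (simp add: stable_class_eq)

section \<open>The stable category as a preadditive category\<close>

context
  fixes X assumes X: "X \<subseteq> Obj C"
begin

abbreviation "SC \<equiv> stable_cat C X \<P>"
abbreviation "cl \<equiv> stable_class C \<P>"

lemma stable_simps:
  "Obj SC = X" "Ident SC A = cl (Ident C A)" "Zero SC A B = cl (Zero C A B)"
  "f \<in> Arr C \<Longrightarrow> Src SC (cl f) = Src C f" "f \<in> Arr C \<Longrightarrow> Tgt SC (cl f) = Tgt C f"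
  "f \<in> Arr C \<Longrightarrow> g \<in> Arr C \<Longrightarrow> Tgt C f = Src C g \<Longrightarrow> cl g \<^bold>\<circ>\<^bsub>SC\<^esub> cl f = cl (g \<^bold>\<circ> f)"
  "f \<in> Arr C \<Longrightarrow> g \<in> Arr C \<Longrightarrow> Src C f = Src C g \<Longrightarrow> Tgt C f = Tgt C g \<Longrightarrow> cl f \<^bold>+\<^bsub>SC\<^esub> cl g = cl (f \<^bold>+ g)"
proof -
  show "Obj SC = X" "Ident SC A = cl (Ident C A)" "Zero SC A B = cl (Zero C A B)"
    by (simp_all add: stable_cat_def)
  show "f \<in> Arr C \<Longrightarrow> Src SC (cl f) = Src C f" "f \<in> Arr C \<Longrightarrow> Tgt SC (cl f) = Tgt C f"
    using some_stable_class[of f] by (simp_all add: stable_cat_def scong_def)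
  show "cl g \<^bold>\<circ>\<^bsub>SC\<^esub> cl f = cl (g \<^bold>\<circ> f)" if "f \<in> Arr C" "g \<in> Arr C" "Tgt C f = Src C g"
  proof -
    have s: "scong (g \<^bold>\<circ> f) ((SOME h. h \<in> cl g) \<^bold>\<circ> (SOME h. h \<in> cl f))"
      using that by (intro scong_comp some_stable_class)
    then have "cl (g \<^bold>\<circ> f) = cl ((SOME h. h \<in> cl g) \<^bold>\<circ> (SOME h. h \<in> cl f))"
      using that by (subst stable_class_eq_iff) (auto simp: scong_def)
    then show ?thesis by (simp add: stable_cat_def)
  qed
  show "cl f \<^bold>+\<^bsub>SC\<^esub> cl g = cl (f \<^bold>+ g)" if "f \<in> Arr C" "g \<in> Arr C" "Src C f = Src C g" "Tgt C f = Tgt C g"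
  proof -
    have s: "scong (f \<^bold>+ g) ((SOME h. h \<in> cl f) \<^bold>+ (SOME h. h \<in> cl g))"
      using that by (intro scong_plus some_stable_class)
    then have "cl (f \<^bold>+ g) = cl ((SOME h. h \<in> cl f) \<^bold>+ (SOME h. h \<in> cl g))"
      using that by (subst stable_class_eq_iff) (auto simp: scong_def)
    then show ?thesis by (simp add: stable_cat_def)
  qed
qed

lemma stable_Hom: "u \<in> Hom SC A B \<longleftrightarrow> A \<in> X \<and> B \<in> X \<and> (\<exists>f \<in> Hom C A B. u = cl f)"
proof -
  have "Arr SC = cl ` {f \<in> Arr C. Src C f \<in> X \<and> Tgt C f \<in> X}" by (simp add: stable_cat_def)
  then show ?thesis by (auto simp: in_Hom stable_simps)
qed

lemma stable_HomE:
  assumes "u \<in> Hom SC A B"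
  obtains f where "A \<in> X" "B \<in> X" "u = cl f" "f \<in> Arr C" "Src C f = A" "Tgt C f = B"
  using assms unfolding stable_Hom by (auto simp: in_Hom)

lemma stable_HomI: "f \<in> Arr C \<Longrightarrow> Src C f = A \<Longrightarrow> Tgt C f = B \<Longrightarrow> A \<in> X \<Longrightarrow> B \<in> X \<Longrightarrow> cl f \<in> Hom SC A B"
  unfolding stable_Hom by (auto simp: in_Hom)

lemma stable_category: "category SC"
proof
  show "Src SC u \<in> Obj SC" "Tgt SC u \<in> Obj SC" if "u \<in> Arr SC" for u
  proof -
    have "u \<in> Hom SC (Src SC u) (Tgt SC u)" using that by (simp add: in_Hom)
    then show "Src SC u \<in> Obj SC" "Tgt SC u \<in> Obj SC" unfolding stable_simps stable_Hom by simp_all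
  qed
  show "Ident SC A \<in> Hom SC A A" if "A \<in> Obj SC" for A
    using that X by (auto simp: stable_simps intro!: stable_HomI)
  show "g \<^bold>\<circ>\<^bsub>SC\<^esub> f \<in> Hom SC A D" if "f \<in> Hom SC A B" "g \<in> Hom SC B D" for f g A B D
    using that by (elim stable_HomE) (simp add: stable_simps stable_HomI)
  show "f \<^bold>\<circ>\<^bsub>SC\<^esub> Ident SC A = f" "Ident SC B \<^bold>\<circ>\<^bsub>SC\<^esub> f = f" if "f \<in> Hom SC A B" for f A B
    using that by (elim stable_HomE, simp add: stable_simps subsetD[OF X])+
  show "(h \<^bold>\<circ>\<^bsub>SC\<^esub> g) \<^bold>\<circ>\<^bsub>SC\<^esub> f = h \<^bold>\<circ>\<^bsub>SC\<^esub> g \<^bold>\<circ>\<^bsub>SC\<^esub> f"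
    if "f \<in> Hom SC A B" "g \<in> Hom SC B D" "h \<in> Hom SC D E" for f g h A B D E
    using that by (elim stable_HomE) (simp add: stable_simps)
qed

lemma stable_preadditive: "preadditive_category SC"
proof (intro preadditive_category.intro preadditive_category_axioms.intro stable_category)
  show "comm_group (hom_group SC A B)" if "A \<in> Obj SC" "B \<in> Obj SC" for A B
  proof -
    have AB: "A \<in> X" "B \<in> X" "A \<in> Obj C" "B \<in> Obj C" using that X by (auto simp: stable_simps)
    show ?thesis
    proof (rule comm_groupI, unfold hom_group_def, simp_all)
      show "u \<^bold>+\<^bsub>SC\<^esub> v \<in> Hom SC A B" if "u \<in> Hom SC A B" "v \<in> Hom SC A B" for u v
        using that by (elim stable_HomE) (simp add: stable_simps stable_HomI)
      show "Zero SC A B \<in> Hom SC A B" using AB by (simp add: stable_simps stable_HomI)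
      show "u \<^bold>+\<^bsub>SC\<^esub> v \<^bold>+\<^bsub>SC\<^esub> w = u \<^bold>+\<^bsub>SC\<^esub> (v \<^bold>+\<^bsub>SC\<^esub> w)"
        if "u \<in> Hom SC A B" "v \<in> Hom SC A B" "w \<in> Hom SC A B" for u v w
        using that by (elim stable_HomE) (simp add: stable_simps plus_assoc)
      show "u \<^bold>+\<^bsub>SC\<^esub> v = v \<^bold>+\<^bsub>SC\<^esub> u" if "u \<in> Hom SC A B" "v \<in> Hom SC A B" for u v
        using that by (elim stable_HomE) (simp add: stable_simps plus_comm)
      show "Zero SC A B \<^bold>+\<^bsub>SC\<^esub> u = u" if "u \<in> Hom SC A B" for u
        using that AB by (elim stable_HomE) (simp add: stable_simps)
      show "\<exists>v\<in>Hom SC A B. v \<^bold>+\<^bsub>SC\<^esub> u = Zero SC A B" if u: "u \<in> Hom SC A B" for u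
      proof -
        obtain f where f: "u = cl f" "f \<in> Arr C" "Src C f = A" "Tgt C f = B" using u by (rule stable_HomE)
        then show ?thesis using AB by (intro bexI[of _ "cl (neg f)"]) (simp_all add: stable_simps stable_HomI)
      qed
    qed
  qed
  show "g \<^bold>\<circ>\<^bsub>SC\<^esub> (f \<^bold>+\<^bsub>SC\<^esub> f') = (g \<^bold>\<circ>\<^bsub>SC\<^esub> f) \<^bold>+\<^bsub>SC\<^esub> (g \<^bold>\<circ>\<^bsub>SC\<^esub> f')"
    if "f \<in> Hom SC A B" "f' \<in> Hom SC A B" "g \<in> Hom SC B D" for f f' g A B D
    using that by (elim stable_HomE) (simp add: stable_simps distrib)
  show "(g \<^bold>+\<^bsub>SC\<^esub> g') \<^bold>\<circ>\<^bsub>SC\<^esub> f = (g \<^bold>\<circ>\<^bsub>SC\<^esub> f) \<^bold>+\<^bsub>SC\<^esub> (g' \<^bold>\<circ>\<^bsub>SC\<^esub> f)"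
    if "f \<in> Hom SC A B" "g \<in> Hom SC B D" "g' \<in> Hom SC B D" for f g g' A B D
    using that by (elim stable_HomE) (simp add: stable_simps distrib)
qed

lemma stable_biproduct:
  assumes "is_biproduct C A B S i\<^sub>1 i\<^sub>2 p\<^sub>1 p\<^sub>2" "A \<in> X" "B \<in> X" "S \<in> X"
  shows "is_biproduct SC A B S (cl i\<^sub>1) (cl i\<^sub>2) (cl p\<^sub>1) (cl p\<^sub>2)"
  using assms(2-) biproductD[OF assms(1)] unfolding is_biproduct_def
  by (simp add: stable_simps stable_HomI)

end

end

text \<open>An arrow out of a zero object is zero and lifts by zero; a lift from a biproduct is
  assembled from lifts on its two summands.\<close>

lemma (in abelian_category) projective_stable_ideal: "stable_ideal C (projective C)"
proof (intro stable_ideal.intro stable_ideal_axioms.intro abelian_category_axioms)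
  show "projective C Q \<Longrightarrow> Q \<in> Obj C" for Q by (simp add: projective_def)
  obtain Z where Z: "is_zero_object C Z" using ex_zero_object by blast
  have "projective C Z"
    unfolding projective_def
  proof (intro conjI allI impI ballI)
    show "Z \<in> Obj C" using Z by (simp add: is_zero_object_def)
    fix e f assume e: "is_epi C e" and f: "f \<in> Hom C Z (Tgt C e)"
    have e': "e \<in> Arr C" using e by (simp add: is_epi_def)
    note o = src_obj[OF e'] tgt_obj[OF e'] \<open>Z \<in> Obj C\<close>
    have "e \<^bold>\<circ> Zero C Z (Src C e) \<in> Hom C Z (Tgt C e)" using e' o by (simp add: in_Hom)
    then have "e \<^bold>\<circ> Zero C Z (Src C e) = f" using Z f o unfolding is_zero_object_def by blast
    then show "\<exists>g\<in>Hom C Z (Src C e). e \<^bold>\<circ> g = f" using o by (intro bexI) (auto simp: in_Hom)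
  qed
  with Z show "\<exists>Z. is_zero_object C Z \<and> projective C Z" by blast
  fix Q Q' S i\<^sub>1 i\<^sub>2 p\<^sub>1 p\<^sub>2
  assume S: "is_biproduct C Q Q' S i\<^sub>1 i\<^sub>2 p\<^sub>1 p\<^sub>2" and q: "projective C Q" "projective C Q'"
  note s = biproductD(1-15)[OF S]
  show "projective C S"
    unfolding projective_def
  proof (intro conjI allI impI ballI)
    fix e f assume e: "is_epi C e" and "f \<in> Hom C S (Tgt C e)"
    then have f: "e \<in> Arr C" "f \<in> Arr C" "Src C f = S" "Tgt C f = Tgt C e" by (auto simp: in_Hom is_epi_def)
    have "f \<^bold>\<circ> i\<^sub>1 \<in> Hom C Q (Tgt C e)" "f \<^bold>\<circ> i\<^sub>2 \<in> Hom C Q' (Tgt C e)" using f s by (auto simp: in_Hom)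
    then obtain g g' where g: "g \<in> Hom C Q (Src C e)" "e \<^bold>\<circ> g = f \<^bold>\<circ> i\<^sub>1" "g' \<in> Hom C Q' (Src C e)" "e \<^bold>\<circ> g' = f \<^bold>\<circ> i\<^sub>2"
      using q e unfolding projective_def by metis
    have g': "g \<in> Arr C" "Src C g = Q" "Tgt C g = Src C e" "g' \<in> Arr C" "Src C g' = Q'" "Tgt C g' = Src C e"
      using g by (auto simp: in_Hom)
    have "e \<^bold>\<circ> (g \<^bold>\<circ> p\<^sub>1 \<^bold>+ g' \<^bold>\<circ> p\<^sub>2) = f"
      using g' f s comp_cong_left[OF g(2), of p\<^sub>1] comp_cong_left[OF g(4), of p\<^sub>2] biproduct_comp(6)[OF S, of f]
      by (simp add: distrib)
    then show "\<exists>g\<in>Hom C S (Src C e). e \<^bold>\<circ> g = f" using g' s by (intro bexI) (auto simp: in_Hom)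
  qed (use s in simp)
qed

lemma (in abelian_category) injective_stable_ideal: "stable_ideal C (injective C)"
proof -
  interpret op: stable_ideal "op_cat C" "injective C"
    using abelian_category.projective_stable_ideal[OF abelian_op] by simp
  show ?thesis
    using op.P_obj op.P_zero op.P_biproduct
    by (intro stable_ideal.intro stable_ideal_axioms.intro abelian_category_axioms) simp_all
qed


section \<open>Natural transformations between \<open>Ext\<^sup>1\<close>-functors\<close>

context abelian_category begin

lemma projective_liftE:
  assumes "projective C P" "is_epi C e" "f \<in> Arr C" "Src C f = P" "Tgt C f = Tgt C e"
  obtains g where "g \<in> Arr C" "Src C g = P" "Tgt C g = Src C e" "e \<^bold>\<circ> g = f"
proof -
  have "f \<in> Hom C P (Tgt C e)" using assms(3-5) by (simp add: in_Hom)
  then have "\<exists>g \<in> Hom C P (Src C e). e \<^bold>\<circ> g = f" using assms(1,2) unfolding projective_def by blast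
  then show thesis using that by (auto simp: in_Hom)
qed

lemma projective_presentation:
  assumes "enough_projectives C" "A \<in> Obj C"
  obtains x K where "x \<in> extensions C A K" "projective C (Src C (snd x))"
proof -
  obtain P e where P: "projective C P" "e \<in> Hom C P A" "is_epi C e"
    using assms unfolding enough_projectives_def by blast
  then have e: "e \<in> Arr C" "Src C e = P" "Tgt C e = A" by (auto simp: in_Hom)
  obtain i where i: "is_kernel C i e" using ex_kernel e by blast
  have "(i, e) \<in> extensions C A (Src C i)"
    using i epi_cokernel_of_kernel[OF P(3) i] e by (intro extensionsI) simp_all
  then show thesis using that[of "(i, e)"] P e by simp
qed

text \<open>Projectivity lifts \<open>snd x\<close> along \<open>snd y\<close>, and the lift carries
  kernel to kernel, which gives the left component.\<close>

lemma ext_map_from_projective: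
  assumes "x \<in> extensions C A K" "projective C (Src C (snd x))" "y \<in> extensions C A B"
  shows "\<exists>f \<in> Hom C K B. ext_map C x y f (Ident C A)"
proof -
  note x = extensionsD[OF assms(1)] and y = extensionsD[OF assms(3)]
  obtain w where w: "w \<in> Arr C" "Src C w = Src C (snd x)" "Tgt C w = Src C (snd y)" "snd y \<^bold>\<circ> w = snd x"
    using projective_liftE[OF assms(2) y(13), of "snd x"] x y by auto
  have "snd y \<^bold>\<circ> w \<^bold>\<circ> fst x = Zero C K A" using comp_cong_left[OF w(4), of "fst x"] w x y by simp
  then obtain f where f: "f \<in> Arr C" "Src C f = K" "Tgt C f = B" "fst y \<^bold>\<circ> f = w \<^bold>\<circ> fst x"
    using kernelE[OF y(10), of "w \<^bold>\<circ> fst x" K] w x y by auto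
  then show ?thesis
    unfolding ext_map_iff[OF assms(1,3)] using w x y ident_hom
    by (intro bexI[of _ f] conjI exI[of _ w]) (auto simp: in_Hom)
qed

text \<open>The two middle arrows agree on K, so their difference descends to an arrow
  \<open>l\<close> from A' into the projective middle term of \<open>x\<close>. Then a - a' is
  \<open>snd x\<close> after \<open>l\<close>.\<close>

lemma ext_map_projective_unique:
  assumes "x \<in> extensions C A K" "projective C (Src C (snd x))" "y \<in> extensions C A' K"
    "ext_map C y x (Ident C K) a" "ext_map C y x (Ident C K) a'"
  shows "factors_through C (projective C) (a \<^bold>+ neg a')"
proof -
  note x = extensionsD[OF assms(1)] and y = extensionsD[OF assms(3)]
  obtain e where e: "e \<in> Arr C" "Src C e = Src C (snd y)" "Tgt C e = Src C (snd x)"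
    "e \<^bold>\<circ> fst y = fst x" "snd x \<^bold>\<circ> e = a \<^bold>\<circ> snd y"
    using assms(4) x unfolding ext_map_iff[OF assms(3,1)] by auto
  obtain e' where e': "e' \<in> Arr C" "Src C e' = Src C (snd y)" "Tgt C e' = Src C (snd x)"
    "e' \<^bold>\<circ> fst y = fst x" "snd x \<^bold>\<circ> e' = a' \<^bold>\<circ> snd y"
    using assms(5) x unfolding ext_map_iff[OF assms(3,1)] by auto
  have a: "a \<in> Arr C" "Src C a = A'" "Tgt C a = A" "a' \<in> Arr C" "Src C a' = A'" "Tgt C a' = A"
    using ext_map_HomD[OF assms(3,1,4)] ext_map_HomD[OF assms(3,1,5)] by (auto simp: in_Hom)
  have "(e \<^bold>+ neg e') \<^bold>\<circ> fst y = Zero C K (Src C (snd x))" using e e' x y by (simp add: distrib)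
  then obtain l where l: "l \<in> Arr C" "Tgt C l = Src C (snd x)" "Src C l = A'" "l \<^bold>\<circ> snd y = e \<^bold>+ neg e'"
    using cokernelE[OF y(11), of "e \<^bold>+ neg e'" "Src C (snd x)"] e(1-3) e'(1-3) x y by auto
  have "(snd x \<^bold>\<circ> l) \<^bold>\<circ> snd y = (a \<^bold>+ neg a') \<^bold>\<circ> snd y"
    using l e e' a x y by (simp add: distrib)
  then have "a \<^bold>+ neg a' = snd x \<^bold>\<circ> l"
    by (rule epiD[OF y(13), symmetric]) (use l(1-3) a x y in simp_all)
  then show ?thesis
    unfolding factors_through_def using assms(2) l(1-3) a x
    by (intro exI[of _ "Src C (snd x)"] conjI bexI[of _ l] bexI[of _ "snd x"]) (simp_all add: in_Hom)
qed

text \<open>The second factor of a' - a starts at a projective and lifts along \<open>snd x\<close>.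
  Adding the lifted arrow to the middle arrow changes the right component from a to a'; the left one
  stays, because \<open>snd y\<close> kills \<open>fst y\<close>.\<close>

lemma ext_map_projective_cong:
  assumes "x \<in> extensions C A B" "y \<in> extensions C A' B'" "ext_map C y x b a" "a' \<in> Hom C A' A"
    "factors_through C (projective C) (a' \<^bold>+ neg a)"
  shows "ext_map C y x b a'"
proof -
  note x = extensionsD[OF assms(1)] and y = extensionsD[OF assms(2)]
  obtain e where e: "e \<in> Arr C" "Src C e = Src C (snd y)" "Tgt C e = Src C (snd x)"
    "e \<^bold>\<circ> fst y = fst x \<^bold>\<circ> b" "snd x \<^bold>\<circ> e = a \<^bold>\<circ> snd y"
    using assms(3) x unfolding ext_map_iff[OF assms(2,1)] by auto
  note bH = ext_map_HomD(1)[OF assms(2,1,3)]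
  have b: "b \<in> Arr C" "Src C b = B'" "Tgt C b = B" using bH by (auto simp: in_Hom)
  have a: "a \<in> Arr C" "Src C a = A'" "Tgt C a = A" "a' \<in> Arr C" "Src C a' = A'" "Tgt C a' = A"
    using ext_map_HomD[OF assms(2,1,3)] assms(4) by (auto simp: in_Hom)
  obtain Q u v where q: "projective C Q" "u \<in> Hom C A' Q" "v \<in> Hom C Q A" and h: "a' \<^bold>+ neg a = v \<^bold>\<circ> u"
    using assms(5) a unfolding factors_through_def by auto
  have uv: "u \<in> Arr C" "Src C u = A'" "Tgt C u = Q" "v \<in> Arr C" "Src C v = Q" "Tgt C v = A"
    using q by (auto simp: in_Hom)
  obtain w where w: "w \<in> Arr C" "Src C w = Q" "Tgt C w = Src C (snd x)" "snd x \<^bold>\<circ> w = v"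
    using projective_liftE[OF q(1) x(13), of v] uv x by auto
  have "a \<^bold>+ v \<^bold>\<circ> u = a'" unfolding h[symmetric] using a by simp
  then have eq: "a \<^bold>\<circ> snd y \<^bold>+ v \<^bold>\<circ> u \<^bold>\<circ> snd y = a' \<^bold>\<circ> snd y"
    using distrib_right[of "snd y" "v \<^bold>\<circ> u" a] uv a y by simp
  let ?e = "e \<^bold>+ w \<^bold>\<circ> u \<^bold>\<circ> snd y"
  have "?e \<^bold>\<circ> fst y = fst x \<^bold>\<circ> b" using e w(1-3) uv x y b by (simp add: distrib)
  moreover have "snd x \<^bold>\<circ> ?e = a' \<^bold>\<circ> snd y"
    using e w(1-3) uv x y eq comp_cong_left[OF w(4), of "u \<^bold>\<circ> snd y"] by (simp add: distrib)
  ultimately show ?thesis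
    unfolding ext_map_iff[OF assms(2,1)] using bH assms(4) e(1-3) w(1-3) uv y
    by (intro conjI exI[of _ ?e]) simp_all
qed

text \<open>Subtracting \<open>fst d\<close> from the middle arrow of the pushout makes the left
  component zero, so the pushout along the inclusion is also the pushout along zero.\<close>

lemma ext_push_inclusion:
  assumes "x \<in> extensions C A K"
  shows "ext_push C (fst x) (ext_class C A K x) = split_extensions C A (Src C (snd x))"
proof -
  note x = extensionsD[OF assms]
  let ?P = "Src C (snd x)"
  have i: "fst x \<in> Hom C K ?P" using x by (simp add: in_Hom)
  obtain d where d: "d \<in> extensions C A ?P" "ext_map C x d (fst x) (Ident C A)"
    using ext_map_push_ex[OF assms i] by blast
  note d' = extensionsD[OF d(1)]
  obtain e where e: "e \<in> Arr C" "Src C e = ?P" "Tgt C e = Src C (snd d)"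
    "e \<^bold>\<circ> fst x = fst d \<^bold>\<circ> fst x" "snd d \<^bold>\<circ> e = snd x"
    using d(2) x unfolding ext_map_iff[OF assms d(1)] by auto
  have "ext_map C x d (Zero C K ?P) (Ident C A)"
    unfolding ext_map_iff[OF assms d(1)] using x d' e ident_hom
    by (intro conjI exI[of _ "e \<^bold>+ neg (fst d)"]) (simp_all add: in_Hom distrib)
  then have "ext_push C (Zero C K ?P) (ext_class C A K x) = ext_class C A ?P d"
    by (rule ext_push_eq[OF assms d(1)])
  moreover have "ext_class C A K x \<in> carrier (Ext1 C A K)" using assms carrier_Ext1 by blast
  ultimately show ?thesis using ext_push_eq[OF assms d] ext_push_zero x by simp
qed

text \<open>With P the middle term of \<open>x\<close>, this is half of the exactness of Hom(B, A)
  -> Ext(B, K) -> Ext(B, P): a class that dies in Ext(B, P) is a pullback of the class of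
  \<open>x\<close>.\<close>

lemma ext_map_of_push_split:
  assumes "x \<in> extensions C A K" "y \<in> extensions C B K"
    "ext_push C (fst x) (ext_class C B K y) = split_extensions C B (Src C (snd x))"
  shows "\<exists>a. ext_map C y x (Ident C K) a"
proof -
  note x = extensionsD[OF assms(1)] and y = extensionsD[OF assms(2)]
  let ?P = "Src C (snd x)"
  have i: "fst x \<in> Hom C K ?P" using x by (simp add: in_Hom)
  have z: "Zero C K ?P \<in> Hom C K ?P" using x by (simp add: in_Hom)
  have yc: "ext_class C B K y \<in> carrier (Ext1 C B K)" using assms carrier_Ext1 by blast
  obtain d where d: "d \<in> extensions C B ?P" "ext_map C y d (fst x) (Ident C B)"
    using ext_map_push_ex[OF assms(2) i] by blast
  note d' = extensionsD[OF d(1)]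
  have "d \<in> ext_push C (Zero C K ?P) (ext_class C B K y)"
    using d assms(3) ext_push_zero[OF yc, of ?P] x ext_push_class[OF assms(2) i] by auto
  then have m: "ext_map C y d (Zero C K ?P) (Ident C B)" unfolding ext_push_class[OF assms(2) z] by simp
  obtain e where e: "e \<in> Arr C" "Src C e = Src C (snd y)" "Tgt C e = Src C (snd d)"
    "e \<^bold>\<circ> fst y = fst d \<^bold>\<circ> fst x" "snd d \<^bold>\<circ> e = snd y"
    using d(2) y unfolding ext_map_iff[OF assms(2) d(1)] by auto
  obtain e' where e': "e' \<in> Arr C" "Src C e' = Src C (snd y)" "Tgt C e' = Src C (snd d)"
    "e' \<^bold>\<circ> fst y = Zero C K (Src C (snd d))" "snd d \<^bold>\<circ> e' = snd y"
    using m x y d' unfolding ext_map_iff[OF assms(2) d(1)] by auto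
  \<comment> \<open>The extension \<open>d\<close> receives morphisms from \<open>y\<close> with
    left components \<open>fst x\<close> and zero. Their middle arrows differ by an arrow into the
    kernel of \<open>snd d\<close>, and this \<open>w\<close> extends \<open>fst x\<close> to the
    middle term of \<open>y\<close>.\<close>
  have "snd d \<^bold>\<circ> (e \<^bold>+ neg e') = Zero C (Src C (snd y)) B" using e e' y d' by (simp add: distrib)
  then obtain w where w: "w \<in> Arr C" "Src C w = Src C (snd y)" "Tgt C w = ?P" "fst d \<^bold>\<circ> w = e \<^bold>+ neg e'"
    using kernelE[OF d'(10), of "e \<^bold>+ neg e'" "Src C (snd y)"] e(1-3) e'(1-3) d' by auto
  have "fst d \<^bold>\<circ> w \<^bold>\<circ> fst y = fst d \<^bold>\<circ> fst x"
    using comp_cong_left[OF w(4), of "fst y"] w(1-3) e e' x y d' by (simp add: distrib)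
  then have wj: "w \<^bold>\<circ> fst y = fst x"
    by (rule monoD[OF d'(12)]) (use w(1-3) x y d' in simp_all)
  have "(snd x \<^bold>\<circ> w) \<^bold>\<circ> fst y = Zero C K A" using wj w(1-3) x y by simp
  then obtain a where a: "a \<in> Arr C" "Tgt C a = A" "Src C a = B" "a \<^bold>\<circ> snd y = snd x \<^bold>\<circ> w"
    using cokernelE[OF y(11), of "snd x \<^bold>\<circ> w" A] w(1-3) x y by auto
  have "ext_map C y x (Ident C K) a"
    unfolding ext_map_iff[OF assms(2,1)] using a w(1-3) wj x y ident_hom
    by (intro conjI exI[of _ w]) (simp_all add: in_Hom)
  then show ?thesis ..
qed

text \<open>Naturality along the inclusion of K is what makes the image of the presentation class
  die at the middle term. Additivity of \<open>\<phi>\<close> enters only through the hypothesis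
  \<open>split\<close>, preservation of the zero class at that one object.\<close>

lemma natural_transformation_is_pull:
  assumes x: "x \<in> extensions C A K" "projective C (Src C (snd x))"
    and X: "K \<in> X" "Src C (snd x) \<in> X"
    and closed: "\<And>Y \<xi>. Y \<in> X \<Longrightarrow> \<xi> \<in> carrier (Ext1 C A Y) \<Longrightarrow> \<phi> Y \<xi> \<in> carrier (Ext1 C B Y)"
    and natural: "\<And>Y Y' f \<xi>. Y \<in> X \<Longrightarrow> Y' \<in> X \<Longrightarrow> f \<in> Hom C Y Y' \<Longrightarrow> \<xi> \<in> carrier (Ext1 C A Y) \<Longrightarrow>
      \<phi> Y' (ext_push C f \<xi>) = ext_push C f (\<phi> Y \<xi>)"
    and split: "\<phi> (Src C (snd x)) (split_extensions C A (Src C (snd x))) = split_extensions C B (Src C (snd x))"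
  shows "\<exists>a \<in> Hom C B A. \<forall>Y \<in> X. \<forall>\<xi> \<in> carrier (Ext1 C A Y). \<phi> Y \<xi> = ext_pull C a \<xi>"
proof -
  note x' = extensionsD[OF x(1)]
  let ?P = "Src C (snd x)" and ?\<xi> = "ext_class C A K x"
  have i: "fst x \<in> Hom C K ?P" using x' by (simp add: in_Hom)
  have \<xi>: "?\<xi> \<in> carrier (Ext1 C A K)" using x carrier_Ext1 by blast
  obtain y where y: "y \<in> extensions C B K" "\<phi> K ?\<xi> = ext_class C B K y"
    using closed[OF X(1) \<xi>] carrier_Ext1 by blast
  have "ext_push C (fst x) (ext_class C B K y) = split_extensions C B ?P"
    using natural[OF X i \<xi>] y(2) split ext_push_inclusion[OF x(1)] by simp
  then obtain a where m: "ext_map C y x (Ident C K) a" using ext_map_of_push_split[OF x(1) y(1)] by blast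
  have a: "a \<in> Hom C B A" using ext_map_HomD[OF y(1) x(1) m] by blast
  show ?thesis
  proof (intro bexI[OF _ a] ballI)
    fix Y \<eta> assume Y: "Y \<in> X" and \<eta>: "\<eta> \<in> carrier (Ext1 C A Y)"
    obtain z where z: "z \<in> extensions C A Y" "\<eta> = ext_class C A Y z" using \<eta> carrier_Ext1 by blast
    obtain f where f: "f \<in> Hom C K Y" "ext_map C x z f (Ident C A)"
      using ext_map_from_projective[OF x z(1)] by blast
    have \<eta>f: "\<eta> = ext_push C f ?\<xi>" using ext_push_eq[OF x(1) z(1) f(2)] z by simp
    have "\<phi> Y \<eta> = ext_push C f (ext_pull C a ?\<xi>)"
      unfolding \<eta>f natural[OF X(1) Y f(1) \<xi>] y(2) ext_pull_eq[OF x(1) y(1) m] ..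
    then show "\<phi> Y \<eta> = ext_pull C a \<eta>" unfolding \<eta>f ext_push_pull[OF \<xi> a f(1)] .
  qed
qed

section \<open>Additive structure computed from a presentation\<close>

lemma Ext1_presentation:
  assumes "x \<in> extensions C A K" "projective C (Src C (snd x))" "\<eta> \<in> carrier (Ext1 C A Y)"
  shows "\<exists>f \<in> Hom C K Y. \<eta> = ext_push C f (ext_class C A K x)"
proof -
  obtain z where z: "z \<in> extensions C A Y" "\<eta> = ext_class C A Y z" using assms carrier_Ext1 by blast
  with ext_map_from_projective[OF assms(1,2) z(1)] show ?thesis using ext_push_eq[OF assms(1) z(1)] by metis
qed

lemma Ext1_simps: "\<xi> \<otimes>\<^bsub>Ext1 C A Y\<^esub> \<eta> = baer_sum C A Y \<xi> \<eta>" "\<one>\<^bsub>Ext1 C A Y\<^esub> = split_extensions C A Y"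
  by (simp_all add: Ext1_def)

text \<open>Both classes are pushouts of the class of one presentation, so by
  \<open>ext_push_plus\<close> their sum is such a pushout too.\<close>

lemma Ext1_mult_closed:
  assumes "enough_projectives C" "\<xi> \<in> carrier (Ext1 C A Y)" "\<eta> \<in> carrier (Ext1 C A Y)"
  shows "\<xi> \<otimes>\<^bsub>Ext1 C A Y\<^esub> \<eta> \<in> carrier (Ext1 C A Y)"
proof -
  have A: "A \<in> Obj C" using assms(2) unfolding carrier_Ext1 by (auto dest: extensionsD(6))
  obtain x K where x: "x \<in> extensions C A K" "projective C (Src C (snd x))"
    using projective_presentation[OF assms(1) A] .
  have c: "ext_class C A K x \<in> carrier (Ext1 C A K)" using x carrier_Ext1 by blast
  obtain f g where f: "f \<in> Hom C K Y" "\<xi> = ext_push C f (ext_class C A K x)"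
    and g: "g \<in> Hom C K Y" "\<eta> = ext_push C g (ext_class C A K x)"
    using Ext1_presentation[OF x] assms(2,3) by metis
  have "f \<^bold>+ g \<in> Hom C K Y" using f g by (simp add: in_Hom)
  then show ?thesis unfolding Ext1_simps f g ext_push_plus[OF c f(1) g(1)] by (rule ext_push_closed[OF c])
qed

text \<open>The split class is the pushout along zero, and zero plus zero is zero. Idempotence
  locates its image under a homomorphism into a group, where only the neutral element is
  idempotent.\<close>

lemma Ext1_one_idem:
  assumes "enough_projectives C" "A \<in> Obj C" "Y \<in> Obj C"
  shows "\<one>\<^bsub>Ext1 C A Y\<^esub> \<in> carrier (Ext1 C A Y)"
    "\<one>\<^bsub>Ext1 C A Y\<^esub> \<otimes>\<^bsub>Ext1 C A Y\<^esub> \<one>\<^bsub>Ext1 C A Y\<^esub> = \<one>\<^bsub>Ext1 C A Y\<^esub>"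
proof -
  obtain x K where x: "x \<in> extensions C A K" "projective C (Src C (snd x))"
    using projective_presentation[OF assms(1,2)] .
  have c: "ext_class C A K x \<in> carrier (Ext1 C A K)" using x carrier_Ext1 by blast
  have z: "Zero C K Y \<in> Hom C K Y" using extensionsD[OF x(1)] assms(3) by (simp add: in_Hom)
  note e = ext_push_zero[OF c assms(3)]
  show "\<one>\<^bsub>Ext1 C A Y\<^esub> \<in> carrier (Ext1 C A Y)"
    using ext_push_closed[OF c z] unfolding Ext1_simps e .
  show "\<one>\<^bsub>Ext1 C A Y\<^esub> \<otimes>\<^bsub>Ext1 C A Y\<^esub> \<one>\<^bsub>Ext1 C A Y\<^esub> = \<one>\<^bsub>Ext1 C A Y\<^esub>"
    using ext_push_plus[OF c z z] e z unfolding Ext1_simps by (simp add: in_Hom extensionsD[OF x(1)] assms(3))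
qed

text \<open>Pulling back commutes with pushing out, so both sides are the pushout along f + g of the
  pulled back presentation class.\<close>

lemma ext_pull_hom:
  assumes "enough_projectives C" "a \<in> Hom C B A"
  shows "ext_pull C a \<in> hom (Ext1 C A Y) (Ext1 C B Y)"
proof (rule homI)
  show "ext_pull C a \<xi> \<in> carrier (Ext1 C B Y)" if "\<xi> \<in> carrier (Ext1 C A Y)" for \<xi>
    using that assms(2) by (rule ext_pull_closed)
  fix \<xi> \<eta> assume "\<xi> \<in> carrier (Ext1 C A Y)" "\<eta> \<in> carrier (Ext1 C A Y)"
  have A: "A \<in> Obj C" using assms(2) Hom_objs by blast
  obtain x K where x: "x \<in> extensions C A K" "projective C (Src C (snd x))"
    using projective_presentation[OF assms(1) A] .
  have c: "ext_class C A K x \<in> carrier (Ext1 C A K)" using x carrier_Ext1 by blast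
  obtain f g where f: "f \<in> Hom C K Y" "\<xi> = ext_push C f (ext_class C A K x)"
    and g: "g \<in> Hom C K Y" "\<eta> = ext_push C g (ext_class C A K x)"
    using Ext1_presentation[OF x] \<open>\<xi> \<in> _\<close> \<open>\<eta> \<in> _\<close> by metis
  have fg: "f \<^bold>+ g \<in> Hom C K Y" using f g by (simp add: in_Hom)
  note c' = ext_pull_closed[OF c assms(2)]
  show "ext_pull C a (\<xi> \<otimes>\<^bsub>Ext1 C A Y\<^esub> \<eta>) = ext_pull C a \<xi> \<otimes>\<^bsub>Ext1 C B Y\<^esub> ext_pull C a \<eta>"
    unfolding Ext1_simps f(2) g(2) ext_push_plus[OF c f(1) g(1)]
      ext_push_pull[OF c assms(2) f(1), symmetric] ext_push_pull[OF c assms(2) g(1), symmetric]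
      ext_push_plus[OF c' f(1) g(1)] ext_push_pull[OF c assms(2) fg] ..
qed

lemma ext_pull_projective_cong:
  assumes "\<xi> \<in> carrier (Ext1 C A Y)" "a \<in> Hom C B A" "a' \<in> Hom C B A"
    "factors_through C (projective C) (a' \<^bold>+ neg a)"
  shows "ext_pull C a' \<xi> = ext_pull C a \<xi>"
proof -
  obtain x where x: "x \<in> extensions C A Y" "\<xi> = ext_class C A Y x" using assms(1) carrier_Ext1 by blast
  obtain y where y: "y \<in> extensions C B Y" "ext_map C y x (Ident C Y) a"
    using ext_map_pull_ex[OF x(1) assms(2)] by blast
  have "ext_map C y x (Ident C Y) a'" by (rule ext_map_projective_cong[OF x(1) y assms(3,4)])
  then show ?thesis unfolding x(2) using ext_pull_eq[OF x(1) y(1)] y(2) by simp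
qed

text \<open>Equal pullbacks share a representative, which maps to \<open>x\<close> over both arrows.
  Thus the presentation class detects arrows modulo projectives.\<close>

lemma ext_pull_eqD:
  assumes "x \<in> extensions C A K" "projective C (Src C (snd x))" "a \<in> Hom C B A" "a' \<in> Hom C B A"
    "ext_pull C a (ext_class C A K x) = ext_pull C a' (ext_class C A K x)"
  shows "factors_through C (projective C) (a \<^bold>+ neg a')"
proof -
  obtain y where y: "y \<in> extensions C B K" "ext_map C y x (Ident C K) a"
    using ext_map_pull_ex[OF assms(1,3)] by blast
  then have "ext_map C y x (Ident C K) a'"
    using assms(5) unfolding ext_pull_class[OF assms(1,3)] ext_pull_class[OF assms(1,4)] by blast
  then show ?thesis by (rule ext_map_projective_unique[OF assms(1,2) y])
qed

end

section \<open>Direct summands of the covariant functor\<close>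

lemma direct_summandE:
  assumes "direct_summand_compl C X F G E"
  obtains \<tau> where "additive_functor C X F" "additive_functor C X G"
    "\<And>Y. Y \<in> X \<Longrightarrow> \<tau> Y \<in> iso (FObj E Y) (FObj F Y \<times>\<times> FObj G Y)"
    "\<And>Y Y' f x. Y \<in> X \<Longrightarrow> Y' \<in> X \<Longrightarrow> f \<in> Hom C Y Y' \<Longrightarrow> x \<in> carrier (FObj E Y) \<Longrightarrow>
      \<tau> Y' (FMap E f x) = map_prod (FMap F f) (FMap G f) (\<tau> Y x)"
proof -
  obtain \<tau> where "\<forall>Y \<in> X. \<tau> Y \<in> iso (FObj E Y) (FObj F Y \<times>\<times> FObj G Y)"
    "\<forall>Y \<in> X. \<forall>Y' \<in> X. \<forall>f \<in> Hom C Y Y'. \<forall>x \<in> carrier (FObj E Y).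
      \<tau> Y' (FMap E f x) = map_prod (FMap F f) (FMap G f) (\<tau> Y x)"
    using assms unfolding direct_summand_compl_def functor_iso_def functor_sum_def by auto
  with that[of \<tau>] assms show thesis unfolding direct_summand_compl_def by simp
qed

lemma additive_functorD:
  assumes "additive_functor C X F"
  shows "Y \<in> X \<Longrightarrow> comm_group (FObj F Y)"
    "Y \<in> X \<Longrightarrow> Y' \<in> X \<Longrightarrow> f \<in> Hom C Y Y' \<Longrightarrow> FMap F f \<in> hom (FObj F Y) (FObj F Y')"
  using assms unfolding additive_functor_def by auto

context abelian_category begin

theorem Ext1_cov_summand:
  fixes F :: "('a, 'b, 'g) ab_functor" and G :: "('a, 'b, 'h) ab_functor"
  assumes ep: "enough_projectives C" and X: "X \<subseteq> Obj C" and PX: "\<And>P. projective C P \<Longrightarrow> P \<in> X"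
    and ck: "closed_kernels_of_epis C X" and si: "has_split_idempotents (stable_cat C X (projective C))"
    and A: "A \<in> X" and ds: "direct_summand_compl C X F G (Ext1_cov C A)"
  shows "\<exists>B \<in> X. functor_iso C X F (Ext1_cov C B)"
proof -
  interpret S: stable_ideal C "projective C" by (rule projective_stable_ideal)
  obtain \<tau> where F: "additive_functor C X F" and G: "additive_functor C X G"
    and iso: "\<And>Y. Y \<in> X \<Longrightarrow> \<tau> Y \<in> iso (Ext1 C A Y) (FObj F Y \<times>\<times> FObj G Y)"
    and nat: "\<And>Y Y' f \<xi>. Y \<in> X \<Longrightarrow> Y' \<in> X \<Longrightarrow> f \<in> Hom C Y Y' \<Longrightarrow> \<xi> \<in> carrier (Ext1 C A Y) \<Longrightarrow>
      \<tau> Y' (ext_push C f \<xi>) = map_prod (FMap F f) (FMap G f) (\<tau> Y \<xi>)"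
    using ds by (rule direct_summandE) (auto simp: Ext1_cov_def)
  note gF = additive_functorD(1)[OF F] and gG = additive_functorD(1)[OF G]
  have bij: "bij_betw (\<tau> Y) (carrier (Ext1 C A Y)) (carrier (FObj F Y) \<times> carrier (FObj G Y))"
    and hom: "\<tau> Y \<in> hom (Ext1 C A Y) (FObj F Y \<times>\<times> FObj G Y)" if "Y \<in> X" for Y
    using iso[OF that] by (auto simp: iso_def)
  have inj: "\<xi> = \<eta>" if "Y \<in> X" "\<tau> Y \<xi> = \<tau> Y \<eta>" "\<xi> \<in> carrier (Ext1 C A Y)" "\<eta> \<in> carrier (Ext1 C A Y)" for Y \<xi> \<eta>
    using bij[OF that(1)] that(2-4) unfolding bij_betw_def by (blast dest: inj_onD)
  have \<tau>c: "\<tau> Y \<xi> \<in> carrier (FObj F Y) \<times> carrier (FObj G Y)" if "Y \<in> X" "\<xi> \<in> carrier (Ext1 C A Y)" for Y \<xi>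
    using bij[OF that(1)] that(2) by (rule bij_betwE[THEN bspec])
  define \<rho> where "\<rho> Y = inv_into (carrier (Ext1 C A Y)) (\<tau> Y)" for Y
  have \<rho>: "\<rho> Y p \<in> carrier (Ext1 C A Y)" "\<tau> Y (\<rho> Y p) = p"
    if "Y \<in> X" "p \<in> carrier (FObj F Y) \<times> carrier (FObj G Y)" for Y p
    using that bij[OF that(1)] inv_into_into[of p "\<tau> Y" "carrier (Ext1 C A Y)"]
      f_inv_into_f[of p "\<tau> Y" "carrier (Ext1 C A Y)"] unfolding \<rho>_def bij_betw_def by auto
  have Fone: "\<one>\<^bsub>FObj F Y\<^esub> \<in> carrier (FObj F Y)" and Gone: "\<one>\<^bsub>FObj G Y\<^esub> \<in> carrier (FObj G Y)" if "Y \<in> X" for Y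
    using gF[OF that] gG[OF that] by (simp_all add: comm_group_def comm_monoid_def monoid.one_closed)
  have Fmap: "FMap F f u \<in> carrier (FObj F Y')" "FMap G f \<one>\<^bsub>FObj G Y\<^esub> = \<one>\<^bsub>FObj G Y'\<^esub>"
    if "Y \<in> X" "Y' \<in> X" "f \<in> Hom C Y Y'" "u \<in> carrier (FObj F Y)" for Y Y' f u
  proof -
    show "FMap F f u \<in> carrier (FObj F Y')"
      using additive_functorD(2)[OF F that(1-3)] that(4) by (rule hom_in_carrier)
    show "FMap G f \<one>\<^bsub>FObj G Y\<^esub> = \<one>\<^bsub>FObj G Y'\<^esub>"
      using additive_functorD(2)[OF G that(1-3)] gG[OF that(1)] gG[OF that(2)]
      by (intro hom_one) (simp_all add: comm_group_def)
  qed
  \<comment> \<open>The image of the split class is idempotent in the product group, hence neutral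
    there.\<close>
  have \<tau>one: "\<tau> Y (split_extensions C A Y) = (\<one>\<^bsub>FObj F Y\<^esub>, \<one>\<^bsub>FObj G Y\<^esub>)"
    and split: "split_extensions C A Y \<in> carrier (Ext1 C A Y)" if "Y \<in> X" for Y
  proof -
    interpret FG: group "FObj F Y \<times>\<times> FObj G Y"
      using gF[OF that] gG[OF that] by (intro DirProd_group) (simp_all add: comm_group_def)
    note one = Ext1_one_idem[OF ep, of A Y]
    have o: "A \<in> Obj C" "Y \<in> Obj C" using X A that by auto
    show "split_extensions C A Y \<in> carrier (Ext1 C A Y)" using one(1)[OF o] unfolding Ext1_simps .
    have "\<tau> Y \<one>\<^bsub>Ext1 C A Y\<^esub> \<otimes>\<^bsub>FObj F Y \<times>\<times> FObj G Y\<^esub> \<tau> Y \<one>\<^bsub>Ext1 C A Y\<^esub> = \<tau> Y \<one>\<^bsub>Ext1 C A Y\<^esub>"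
      using hom_mult[OF hom[OF that] one(1)[OF o] one(1)[OF o]] one(2)[OF o] by simp
    moreover have "\<tau> Y \<one>\<^bsub>Ext1 C A Y\<^esub> \<in> carrier (FObj F Y \<times>\<times> FObj G Y)"
      using hom[OF that] one(1)[OF o] by (rule hom_in_carrier)
    ultimately have "\<tau> Y \<one>\<^bsub>Ext1 C A Y\<^esub> = \<one>\<^bsub>FObj F Y \<times>\<times> FObj G Y\<^esub>" using FG.l_cancel_one' by metis
    then show "\<tau> Y (split_extensions C A Y) = (\<one>\<^bsub>FObj F Y\<^esub>, \<one>\<^bsub>FObj G Y\<^esub>)" by (simp add: Ext1_simps)
  qed
  \<comment> \<open>The inclusion of the summand F: the inverse of the decomposition applied to a
    pair with neutral second entry.\<close>
  define \<iota> where "\<iota> Y u = \<rho> Y (u, \<one>\<^bsub>FObj G Y\<^esub>)" for Y u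
  have \<iota>: "\<iota> Y u \<in> carrier (Ext1 C A Y)" "\<tau> Y (\<iota> Y u) = (u, \<one>\<^bsub>FObj G Y\<^esub>)" if "Y \<in> X" "u \<in> carrier (FObj F Y)" for Y u
    using \<rho>[OF that(1), of "(u, \<one>\<^bsub>FObj G Y\<^esub>)"] that Gone unfolding \<iota>_def by auto
  have \<iota>nat: "ext_push C f (\<iota> Y u) = \<iota> Y' (FMap F f u)"
    if Y: "Y \<in> X" "Y' \<in> X" "f \<in> Hom C Y Y'" and u: "u \<in> carrier (FObj F Y)" for Y Y' f u
    by (rule inj[OF Y(2)])
      (use nat[OF Y \<iota>(1)[OF Y(1) u]] \<iota>[OF Y(1) u] \<iota>[OF Y(2)] Fmap[OF Y u] ext_push_closed[OF \<iota>(1)[OF Y(1) u] Y(3)] in auto)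
  \<comment> \<open>The idempotent belonging to the summand: project to F, then include.\<close>
  define \<phi> where "\<phi> Y \<xi> = \<iota> Y (fst (\<tau> Y \<xi>))" for Y \<xi>
  have \<tau>1: "fst (\<tau> Y \<xi>) \<in> carrier (FObj F Y)" if "Y \<in> X" "\<xi> \<in> carrier (Ext1 C A Y)" for Y \<xi>
    using \<tau>c[OF that] by auto
  obtain x K where x: "x \<in> extensions C A K" "projective C (Src C (snd x))"
    using projective_presentation[OF ep] A X by blast
  note x' = extensionsD[OF x(1)]
  have PX': "Src C (snd x) \<in> X" using PX x(2) .
  \<comment> \<open>K is the kernel of an epi between the objects P and A of
    \<open>X\<close>.\<close>
  have KX: "K \<in> X" using ck x' PX' A unfolding closed_kernels_of_epis_def by metis
  have \<xi>: "ext_class C A K x \<in> carrier (Ext1 C A K)" using x carrier_Ext1 by blast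
  have "\<exists>a \<in> Hom C A A. \<forall>Y \<in> X. \<forall>\<xi> \<in> carrier (Ext1 C A Y). \<phi> Y \<xi> = ext_pull C a \<xi>"
  proof (rule natural_transformation_is_pull[OF x KX PX'])
    show "\<phi> Y \<xi> \<in> carrier (Ext1 C A Y)" if "Y \<in> X" "\<xi> \<in> carrier (Ext1 C A Y)" for Y \<xi>
      unfolding \<phi>_def using \<iota>(1)[OF that(1)] \<tau>1[OF that] by blast
    show "\<phi> Y' (ext_push C f \<xi>) = ext_push C f (\<phi> Y \<xi>)"
      if "Y \<in> X" "Y' \<in> X" "f \<in> Hom C Y Y'" "\<xi> \<in> carrier (Ext1 C A Y)" for Y Y' f \<xi>
      unfolding \<phi>_def nat[OF that] \<iota>nat[OF that(1-3) \<tau>1[OF that(1,4)]] by simp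
    show "\<phi> (Src C (snd x)) (split_extensions C A (Src C (snd x))) = split_extensions C A (Src C (snd x))"
      by (rule inj[OF PX']) (use \<tau>one[OF PX'] split[OF PX'] \<iota>[OF PX' Fone[OF PX']] in \<open>auto simp: \<phi>_def\<close>)
  qed
  then obtain a where a: "a \<in> Hom C A A" and \<phi>a: "\<And>Y \<xi>. Y \<in> X \<Longrightarrow> \<xi> \<in> carrier (Ext1 C A Y) \<Longrightarrow> \<phi> Y \<xi> = ext_pull C a \<xi>"
    by blast
  have a': "a \<in> Arr C" "Src C a = A" "Tgt C a = A" using a by (auto simp: in_Hom)
  have \<phi>\<iota>: "\<phi> Y (\<iota> Y u) = \<iota> Y u" if "Y \<in> X" "u \<in> carrier (FObj F Y)" for Y u
    unfolding \<phi>_def \<iota>(2)[OF that] by simp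
  \<comment> \<open>On the presentation class, idempotence of \<open>\<phi>\<close> compares the
    pullbacks along a after a and along a. \<open>ext_pull_eqD\<close> turns this into a congruence
    modulo projectives.\<close>
  have "ext_pull C (a \<^bold>\<circ> a) (ext_class C A K x) = ext_pull C a (ext_class C A K x)"
  proof -
    have "ext_pull C (a \<^bold>\<circ> a) (ext_class C A K x) = \<phi> K (\<phi> K (ext_class C A K x))"
      unfolding ext_pull_comp[OF \<xi> a a] using \<phi>a[OF KX] \<xi> ext_pull_closed[OF \<xi> a] by simp
    also have "\<dots> = \<phi> K (ext_class C A K x)" using \<phi>\<iota>[OF KX] \<tau>1[OF KX \<xi>] unfolding \<phi>_def by simp
    finally show ?thesis using \<phi>a[OF KX \<xi>] by simp
  qed
  then have "factors_through C (projective C) ((a \<^bold>\<circ> a) \<^bold>+ neg a)"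
    by (intro ext_pull_eqD[OF x comp_hom[OF a a] a])
  then have "S.scong (a \<^bold>\<circ> a) a" using a' by (simp add: S.scong_def)
  then have idem: "S.cl a \<^bold>\<circ>\<^bsub>stable_cat C X (projective C)\<^esub> S.cl a = S.cl a"
    using a' by (simp add: S.stable_simps[OF X] S.stable_class_eq_iff)
  have clH: "S.cl a \<in> Hom (stable_cat C X (projective C)) A A"
    by (rule S.stable_HomI[OF X]) (use a' A in auto)
  obtain B r s where B: "B \<in> X" and r: "r \<in> Hom (stable_cat C X (projective C)) A B"
    and s: "s \<in> Hom (stable_cat C X (projective C)) B A"
    and rs: "r \<^bold>\<circ>\<^bsub>stable_cat C X (projective C)\<^esub> s = Ident (stable_cat C X (projective C)) B"
    and sr: "s \<^bold>\<circ>\<^bsub>stable_cat C X (projective C)\<^esub> r = S.cl a"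
    using bspec[OF bspec[OF si[unfolded has_split_idempotents_def S.stable_simps(1)[OF X]] A] clH] idem
    by blast
  obtain r0 where r0: "r = S.cl r0" "r0 \<in> Arr C" "Src C r0 = A" "Tgt C r0 = B" using S.stable_HomE[OF X r] .
  obtain s0 where s0: "s = S.cl s0" "s0 \<in> Arr C" "Src C s0 = B" "Tgt C s0 = A" using S.stable_HomE[OF X s] .
  have Bo: "B \<in> Obj C" using B X by blast
  have r0H: "r0 \<in> Hom C A B" and s0H: "s0 \<in> Hom C B A" using r0 s0 by (simp_all add: in_Hom)
  have "S.scong (r0 \<^bold>\<circ> s0) (Ident C B)"
    using rs r0 s0 Bo by (simp add: S.stable_simps[OF X] S.stable_class_eq_iff)
  then have rs': "factors_through C (projective C) ((r0 \<^bold>\<circ> s0) \<^bold>+ neg (Ident C B))" by (simp add: S.scong_def)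
  have "S.scong (s0 \<^bold>\<circ> r0) a"
    using sr r0 s0 a' by (simp add: S.stable_simps[OF X] S.stable_class_eq_iff)
  then have sr': "factors_through C (projective C) ((s0 \<^bold>\<circ> r0) \<^bold>+ neg a)" by (simp add: S.scong_def)
  \<comment> \<open>Pullback is contravariant and does not see arrows through projectives. Pulling
    along \<open>s0\<close> and then \<open>r0\<close> is therefore pulling along \<open>a\<close>;
    in the other order it is the identity.\<close>
  have pull_sr: "ext_pull C r0 (ext_pull C s0 \<xi>) = ext_pull C a \<xi>" if "\<xi> \<in> carrier (Ext1 C A Y)" for Y \<xi>
    using ext_pull_projective_cong[OF that a comp_hom[OF r0H s0H] sr'] ext_pull_comp[OF that s0H r0H] by simp
  have pull_rs: "ext_pull C s0 (ext_pull C r0 \<xi>) = \<xi>" if "\<xi> \<in> carrier (Ext1 C B Y)" for Y \<xi>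
    using ext_pull_projective_cong[OF that ident_hom[OF Bo] comp_hom[OF s0H r0H] rs']
      ext_pull_comp[OF that r0H s0H] ext_pull_ident[OF that] by simp
  have a_fix: "ext_pull C a (\<iota> Y u) = \<iota> Y u" if "Y \<in> X" "u \<in> carrier (FObj F Y)" for Y u
    using \<phi>a[OF that(1) \<iota>(1)[OF that]] \<phi>\<iota>[OF that] by simp
  have \<iota>hom: "\<iota> Y (u \<otimes>\<^bsub>FObj F Y\<^esub> v) = \<iota> Y u \<otimes>\<^bsub>Ext1 C A Y\<^esub> \<iota> Y v"
    if Y: "Y \<in> X" and u: "u \<in> carrier (FObj F Y)" and v: "v \<in> carrier (FObj F Y)" for Y u v
  proof (rule inj[OF Y])
    interpret FY: comm_group "FObj F Y" by (rule gF[OF Y])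
    interpret GY: comm_group "FObj G Y" by (rule gG[OF Y])
    show "\<tau> Y (\<iota> Y (u \<otimes>\<^bsub>FObj F Y\<^esub> v)) = \<tau> Y (\<iota> Y u \<otimes>\<^bsub>Ext1 C A Y\<^esub> \<iota> Y v)"
      using hom_mult[OF hom[OF Y] \<iota>(1)[OF Y u] \<iota>(1)[OF Y v]] \<iota>(2)[OF Y] u v by simp
    show "\<iota> Y (u \<otimes>\<^bsub>FObj F Y\<^esub> v) \<in> carrier (Ext1 C A Y)" using \<iota>(1)[OF Y] u v by simp
    show "\<iota> Y u \<otimes>\<^bsub>Ext1 C A Y\<^esub> \<iota> Y v \<in> carrier (Ext1 C A Y)"
      using Ext1_mult_closed[OF ep] \<iota>(1)[OF Y] u v by blast
  qed
  \<comment> \<open>F sits in Ext(A, -) as the image of pulling back along \<open>a\<close>. On this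
    image pulling along \<open>s0\<close> is inverted by pulling along \<open>r0\<close>, after
    which one projects back to F.\<close>
  have "functor_iso C X F (Ext1_cov C B)"
    unfolding functor_iso_def
  proof (intro exI[of _ "\<lambda>Y u. ext_pull C s0 (\<iota> Y u)"] conjI ballI)
    fix Y assume Y: "Y \<in> X"
    have Yc: "ext_pull C s0 (\<iota> Y u) \<in> carrier (Ext1 C B Y)" if "u \<in> carrier (FObj F Y)" for u
      by (rule ext_pull_closed[OF \<iota>(1)[OF Y that] s0H])
    have "(\<lambda>u. ext_pull C s0 (\<iota> Y u)) \<in> hom (FObj F Y) (Ext1 C B Y)"
    proof (rule homI)
      show "ext_pull C s0 (\<iota> Y u) \<in> carrier (Ext1 C B Y)" if "u \<in> carrier (FObj F Y)" for u
        using Yc[OF that] .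
      show "ext_pull C s0 (\<iota> Y (u \<otimes>\<^bsub>FObj F Y\<^esub> v)) = ext_pull C s0 (\<iota> Y u) \<otimes>\<^bsub>Ext1 C B Y\<^esub> ext_pull C s0 (\<iota> Y v)"
        if "u \<in> carrier (FObj F Y)" "v \<in> carrier (FObj F Y)" for u v
        unfolding \<iota>hom[OF Y that] by (rule hom_mult[OF ext_pull_hom[OF ep s0H] \<iota>(1)[OF Y that(1)] \<iota>(1)[OF Y that(2)]])
    qed
    moreover have "bij_betw (\<lambda>u. ext_pull C s0 (\<iota> Y u)) (carrier (FObj F Y)) (carrier (Ext1 C B Y))"
    proof (rule bij_betw_byWitness[where f' = "\<lambda>\<eta>. fst (\<tau> Y (ext_pull C r0 \<eta>))"])
      show "\<forall>u\<in>carrier (FObj F Y). fst (\<tau> Y (ext_pull C r0 (ext_pull C s0 (\<iota> Y u)))) = u"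
        using pull_sr[OF \<iota>(1)[OF Y]] a_fix[OF Y] \<iota>(2)[OF Y] by simp
      show "\<forall>\<eta>\<in>carrier (Ext1 C B Y). ext_pull C s0 (\<iota> Y (fst (\<tau> Y (ext_pull C r0 \<eta>)))) = \<eta>"
      proof
        fix \<eta> assume \<eta>: "\<eta> \<in> carrier (Ext1 C B Y)"
        note c = ext_pull_closed[OF \<eta> r0H]
        \<comment> \<open>The left side is \<open>\<phi>\<close> applied to a class pulled back
          along \<open>r0\<close>, so it may be replaced by pulling back along \<open>a\<close>,
          that is along \<open>s0\<close> and then \<open>r0\<close>.\<close>
        have "\<iota> Y (fst (\<tau> Y (ext_pull C r0 \<eta>))) = ext_pull C r0 (ext_pull C s0 (ext_pull C r0 \<eta>))"
          using \<phi>a[OF Y c] pull_sr[OF c] unfolding \<phi>_def by simp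
        then show "ext_pull C s0 (\<iota> Y (fst (\<tau> Y (ext_pull C r0 \<eta>)))) = \<eta>"
          using pull_rs[OF \<eta>] by simp
      qed
      show "(\<lambda>u. ext_pull C s0 (\<iota> Y u)) ` carrier (FObj F Y) \<subseteq> carrier (Ext1 C B Y)" using Yc by blast
      show "(\<lambda>\<eta>. fst (\<tau> Y (ext_pull C r0 \<eta>))) ` carrier (Ext1 C B Y) \<subseteq> carrier (FObj F Y)"
        using \<tau>1[OF Y ext_pull_closed[OF _ r0H]] by blast
    qed
    ultimately show "(\<lambda>u. ext_pull C s0 (\<iota> Y u)) \<in> iso (FObj F Y) (FObj (Ext1_cov C B) Y)"
      by (simp add: iso_def Ext1_cov_def)
  next
    fix Y Y' f u assume Y: "Y \<in> X" "Y' \<in> X" "f \<in> Hom C Y Y'" "u \<in> carrier (FObj F Y)"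
    show "ext_pull C s0 (\<iota> Y' (FMap F f u)) = FMap (Ext1_cov C B) f (ext_pull C s0 (\<iota> Y u))"
      unfolding \<iota>nat[OF Y, symmetric] using ext_push_pull[OF \<iota>(1)[OF Y(1,4)] s0H Y(3)] by (simp add: Ext1_cov_def)
  qed
  with B show ?thesis by blast
qed

end


section \<open>Splitting idempotents in Krull--Schmidt categories\<close>

text \<open>The objectwise form of \<open>has_split_idempotents\<close>, so that splitting can be
  proved by induction on the number of summands of an object.\<close>

definition idempotents_split_on :: "('o, 'm) cat \<Rightarrow> 'o \<Rightarrow> bool" where
  "idempotents_split_on C A \<longleftrightarrow> (\<forall>e \<in> Hom C A A. e \<^bold>\<circ>\<^bsub>C\<^esub> e = e \<longrightarrow>
     (\<exists>B \<in> Obj C. \<exists>r \<in> Hom C A B. \<exists>s \<in> Hom C B A. r \<^bold>\<circ>\<^bsub>C\<^esub> s = Ident C B \<and> s \<^bold>\<circ>\<^bsub>C\<^esub> r = e))"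

context preadditive_category begin

lemma idempotents_split_onE:
  assumes "idempotents_split_on C A" "e \<in> Arr C" "Src C e = A" "Tgt C e = A" "e \<^bold>\<circ> e = e"
  obtains B r s where "B \<in> Obj C" "r \<in> Arr C" "Src C r = A" "Tgt C r = B"
    "s \<in> Arr C" "Src C s = B" "Tgt C s = A" "r \<^bold>\<circ> s = Ident C B" "s \<^bold>\<circ> r = e"
proof -
  have "e \<in> Hom C A A" using assms by (simp add: in_Hom)
  then have "\<exists>B \<in> Obj C. \<exists>r \<in> Hom C A B. \<exists>s \<in> Hom C B A. r \<^bold>\<circ> s = Ident C B \<and> s \<^bold>\<circ> r = e"
    using assms(1,5) unfolding idempotents_split_on_def by blast
  then obtain B r s where b: "B \<in> Obj C" "r \<in> Hom C A B" "s \<in> Hom C B A" "r \<^bold>\<circ> s = Ident C B" "s \<^bold>\<circ> r = e"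
    by blast
  show thesis by (rule that[of B r s]) (use b in \<open>simp_all add: in_Hom\<close>)
qed

text \<open>Invertibility is phrased by arrows alone, so that the same notion serves in C and in its
  stable categories.\<close>

definition is_unit where
  "is_unit B d \<longleftrightarrow> (\<exists>d' \<in> Hom C B B. d' \<^bold>\<circ> d = Ident C B \<and> d \<^bold>\<circ> d' = Ident C B)"

text \<open>Gaussian elimination with the invertible corner \<open>p\<^sub>2 e i\<^sub>2\<close> as
  pivot. \<open>u\<close> is the second column of \<open>e\<close>, and \<open>v\<close> is its
  second row normalised by the inverse \<open>d\<close> of the pivot, so \<open>u v\<close> is an
  idempotent below \<open>e\<close> that splits through B. The remainder has zero second row and
  column, and \<open>g\<close> is the Schur complement.\<close>

lemma split_off_corner:
  assumes S: "is_biproduct C A B S i\<^sub>1 i\<^sub>2 p\<^sub>1 p\<^sub>2"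
    and e: "e \<in> Arr C" "Src C e = S" "Tgt C e = S" and ee: "e \<^bold>\<circ> e = e" and unit: "is_unit B (p\<^sub>2 \<^bold>\<circ> e \<^bold>\<circ> i\<^sub>2)"
  obtains u v g d where "u \<in> Arr C" "Src C u = B" "Tgt C u = S" "v \<in> Arr C" "Src C v = S" "Tgt C v = B"
    "g \<in> Arr C" "Src C g = A" "Tgt C g = A" "d \<in> Arr C" "Src C d = B" "Tgt C d = B"
    "v \<^bold>\<circ> u = Ident C B" "e \<^bold>\<circ> u = u" "v \<^bold>\<circ> e = v" "g \<^bold>\<circ> g = g"
    "e = u \<^bold>\<circ> v \<^bold>+ i\<^sub>1 \<^bold>\<circ> g \<^bold>\<circ> p\<^sub>1" "g \<^bold>\<circ> p\<^sub>1 \<^bold>\<circ> u = Zero C B A" "v \<^bold>\<circ> i\<^sub>1 \<^bold>\<circ> g = Zero C A B"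
    "p\<^sub>2 \<^bold>\<circ> u \<^bold>\<circ> d = Ident C B" "d \<^bold>\<circ> p\<^sub>2 \<^bold>\<circ> u = Ident C B"
proof -
  note s = biproductD(1-15)[OF S] and bc = biproduct_comp[OF S]
  obtain d where "d \<in> Hom C B B" and d': "d \<^bold>\<circ> p\<^sub>2 \<^bold>\<circ> e \<^bold>\<circ> i\<^sub>2 = Ident C B" "(p\<^sub>2 \<^bold>\<circ> e \<^bold>\<circ> i\<^sub>2) \<^bold>\<circ> d = Ident C B"
    using unit unfolding is_unit_def by blast
  then have d: "d \<in> Arr C" "Src C d = B" "Tgt C d = B" by (auto simp: in_Hom)
  define u where "u = e \<^bold>\<circ> i\<^sub>2"
  define v where "v = d \<^bold>\<circ> p\<^sub>2 \<^bold>\<circ> e"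
  have uv: "u \<in> Arr C" "Src C u = B" "Tgt C u = S" "v \<in> Arr C" "Src C v = S" "Tgt C v = B"
    using s e d by (simp_all add: u_def v_def)
  have ee': "e \<^bold>\<circ> e \<^bold>\<circ> h = e \<^bold>\<circ> h" if "h \<in> Arr C" "Tgt C h = S" for h
    using comp_cong_left[OF ee, of h] that e by simp
  have eu: "e \<^bold>\<circ> u = u" using ee' s by (simp add: u_def)
  have ve: "v \<^bold>\<circ> e = v" using ee s e d by (simp add: v_def)
  have vu: "v \<^bold>\<circ> u = Ident C B" using ee' d' s e d by (simp add: u_def v_def)
  have pud: "p\<^sub>2 \<^bold>\<circ> u \<^bold>\<circ> d = Ident C B" and dpu: "d \<^bold>\<circ> p\<^sub>2 \<^bold>\<circ> u = Ident C B"
    using d' s e d by (simp_all add: u_def)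
  have vu': "v \<^bold>\<circ> u \<^bold>\<circ> h = h" if "h \<in> Arr C" "Tgt C h = B" for h
    using comp_cong_left[OF vu, of h] that uv by simp
  have eu': "e \<^bold>\<circ> u \<^bold>\<circ> h = u \<^bold>\<circ> h" if "h \<in> Arr C" "Tgt C h = B" for h
    using comp_cong_left[OF eu, of h] that uv e by simp
  \<comment> \<open>The complement of \<open>u v\<close> in \<open>e\<close>. It is killed by
    \<open>i\<^sub>2\<close> on one side and by \<open>p\<^sub>2\<close> on the other, so it lives
    on A alone.\<close>
  define w where "w = e \<^bold>+ neg (u \<^bold>\<circ> v)"
  have w: "w \<in> Arr C" "Src C w = S" "Tgt C w = S" using e uv by (simp_all add: w_def)
  have wu: "w \<^bold>\<circ> u = Zero C B S" using e uv vu eu s by (simp add: w_def distrib)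
  have vw: "v \<^bold>\<circ> w = Zero C S B" using e uv ve vu' s by (simp add: w_def distrib)
  have wi: "w \<^bold>\<circ> i\<^sub>2 = Zero C B S"
  proof -
    have "v \<^bold>\<circ> i\<^sub>2 = Ident C B" using d' s e d by (simp add: v_def)
    then show ?thesis using e uv s by (simp add: w_def distrib u_def[symmetric])
  qed
  have pw: "p\<^sub>2 \<^bold>\<circ> w = Zero C S B"
  proof -
    have "p\<^sub>2 \<^bold>\<circ> u \<^bold>\<circ> v = (p\<^sub>2 \<^bold>\<circ> u \<^bold>\<circ> d) \<^bold>\<circ> p\<^sub>2 \<^bold>\<circ> e" using uv s e d by (simp add: v_def)
    also have "\<dots> = p\<^sub>2 \<^bold>\<circ> e" unfolding pud using s e by simp
    finally show ?thesis using e uv s by (simp add: w_def distrib)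
  qed
  have ew: "e \<^bold>\<circ> w = w" using e uv ee eu' s by (simp add: w_def distrib)
  have "w \<^bold>\<circ> w = e \<^bold>\<circ> w \<^bold>+ neg (u \<^bold>\<circ> v \<^bold>\<circ> w)"
    using w e uv distrib_right[of w "neg (u \<^bold>\<circ> v)" e] by (simp add: w_def[symmetric])
  also have "\<dots> = w" unfolding ew vw using uv w s by simp
  finally have ww: "w \<^bold>\<circ> w = w" .
  define g where "g = p\<^sub>1 \<^bold>\<circ> w \<^bold>\<circ> i\<^sub>1"
  have g: "g \<in> Arr C" "Src C g = A" "Tgt C g = A" using w s by (simp_all add: g_def)
  have ipw: "i\<^sub>1 \<^bold>\<circ> p\<^sub>1 \<^bold>\<circ> w = w" using bc(5)[of w] pw w s by simp
  have wip: "w \<^bold>\<circ> i\<^sub>1 \<^bold>\<circ> p\<^sub>1 = w" using bc(6)[of w] comp_cong_left[OF wi, of p\<^sub>2] w s by simp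
  have igp: "i\<^sub>1 \<^bold>\<circ> g \<^bold>\<circ> p\<^sub>1 = w" using wip ipw w s by (simp add: g_def)
  have gp: "g \<^bold>\<circ> p\<^sub>1 = p\<^sub>1 \<^bold>\<circ> w" using wip w s by (simp add: g_def)
  have ig: "i\<^sub>1 \<^bold>\<circ> g = w \<^bold>\<circ> i\<^sub>1"
    using comp_cong_left[OF ipw, of "i\<^sub>1"] comp_cong_left[OF wip, of "i\<^sub>1"] ipw w s
      assoc[of i\<^sub>1 w p\<^sub>1] assoc[of i\<^sub>1 "p\<^sub>1 \<^bold>\<circ> w" i\<^sub>1] by (simp add: g_def)
  have gg: "g \<^bold>\<circ> g = g"
  proof -
    have "g \<^bold>\<circ> g = (g \<^bold>\<circ> p\<^sub>1) \<^bold>\<circ> w \<^bold>\<circ> i\<^sub>1" using g w s by (simp add: g_def)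
    also have "\<dots> = p\<^sub>1 \<^bold>\<circ> w \<^bold>\<circ> w \<^bold>\<circ> i\<^sub>1" unfolding gp using w s by simp
    also have "\<dots> = g" using comp_cong_left[OF ww, of i\<^sub>1] w s by (simp add: g_def)
    finally show ?thesis .
  qed
  have "e = u \<^bold>\<circ> v \<^bold>+ w" using e uv by (simp add: w_def)
  then have e_eq: "e = u \<^bold>\<circ> v \<^bold>+ i\<^sub>1 \<^bold>\<circ> g \<^bold>\<circ> p\<^sub>1" unfolding igp .
  have gpu: "g \<^bold>\<circ> p\<^sub>1 \<^bold>\<circ> u = Zero C B A" using comp_cong_left[OF gp, of u] wu w g uv s by simp
  have vig: "v \<^bold>\<circ> i\<^sub>1 \<^bold>\<circ> g = Zero C A B" unfolding ig using comp_cong_left[OF vw, of i\<^sub>1] w uv s by simp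
  show thesis by (rule that[OF uv g d vu eu ve gg e_eq gpu vig pud dpu])
qed

text \<open>The pivot is the B-corner of \<open>e\<close> or of 1 - \<open>e\<close>. In the first
  case B is part of the image of \<open>e\<close>, which splits through the biproduct of B with a
  splitting of \<open>g\<close>. In the second case B belongs to the complement, and
  \<open>e\<close> splits through a splitting of 1 - \<open>g\<close> alone.\<close>

lemma idempotents_split_on_biproduct:
  assumes S: "is_biproduct C A B S i\<^sub>1 i\<^sub>2 p\<^sub>1 p\<^sub>2" and A: "idempotents_split_on C A"
    and B: "\<And>d. d \<in> Hom C B B \<Longrightarrow> is_unit B d \<or> is_unit B (Ident C B \<^bold>+ neg d)"
    and sums: "\<And>G. G \<in> Obj C \<Longrightarrow> \<exists>T m\<^sub>1 m\<^sub>2 n\<^sub>1 n\<^sub>2. is_biproduct C G B T m\<^sub>1 m\<^sub>2 n\<^sub>1 n\<^sub>2"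
  shows "idempotents_split_on C S"
  unfolding idempotents_split_on_def
proof (intro ballI impI)
  note s = biproductD(1-15)[OF S] and bc = biproduct_comp[OF S]
  fix e assume "e \<in> Hom C S S" and ee: "e \<^bold>\<circ> e = e"
  then have e: "e \<in> Arr C" "Src C e = S" "Tgt C e = S" by (auto simp: in_Hom)
  have "p\<^sub>2 \<^bold>\<circ> e \<^bold>\<circ> i\<^sub>2 \<in> Hom C B B" using s e by (simp add: in_Hom)
  from B[OF this] show "\<exists>G\<in>Obj C. \<exists>r\<in>Hom C S G. \<exists>s\<in>Hom C G S. r \<^bold>\<circ> s = Ident C G \<and> s \<^bold>\<circ> r = e"
  proof
    assume "is_unit B (p\<^sub>2 \<^bold>\<circ> e \<^bold>\<circ> i\<^sub>2)"
    then obtain u v g d where uv: "u \<in> Arr C" "Src C u = B" "Tgt C u = S" "v \<in> Arr C" "Src C v = S" "Tgt C v = B"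
      and g: "g \<in> Arr C" "Src C g = A" "Tgt C g = A"
      and vu: "v \<^bold>\<circ> u = Ident C B" and gg: "g \<^bold>\<circ> g = g"
      and e_eq: "e = u \<^bold>\<circ> v \<^bold>+ i\<^sub>1 \<^bold>\<circ> g \<^bold>\<circ> p\<^sub>1" and gpu: "g \<^bold>\<circ> p\<^sub>1 \<^bold>\<circ> u = Zero C B A"
      and vig: "v \<^bold>\<circ> i\<^sub>1 \<^bold>\<circ> g = Zero C A B"
      by (rule split_off_corner[OF S e ee])
    obtain G r t where G: "G \<in> Obj C" and rt: "r \<in> Arr C" "Src C r = A" "Tgt C r = G"
      "t \<in> Arr C" "Src C t = G" "Tgt C t = A" "r \<^bold>\<circ> t = Ident C G" "t \<^bold>\<circ> r = g"
      by (rule idempotents_split_onE[OF A g gg])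
    obtain T m\<^sub>1 m\<^sub>2 n\<^sub>1 n\<^sub>2 where T: "is_biproduct C G B T m\<^sub>1 m\<^sub>2 n\<^sub>1 n\<^sub>2" using sums[OF G] by blast
    note t = biproductD(1-15)[OF T] and tc = biproduct_comp[OF T] and t1 = biproductD(20)[OF T]
    have "r \<^bold>\<circ> g = r" unfolding rt(8)[symmetric] using comp_cong_left[OF rt(7), of r] rt by simp
    then have rg: "r \<^bold>\<circ> p\<^sub>1 \<^bold>\<circ> u = (r \<^bold>\<circ> g) \<^bold>\<circ> p\<^sub>1 \<^bold>\<circ> u" by simp
    have rpu: "r \<^bold>\<circ> p\<^sub>1 \<^bold>\<circ> u = Zero C B G" unfolding rg using gpu rt(1-6) g s uv by simp
    have "g \<^bold>\<circ> t = t" unfolding rt(8)[symmetric] using rt(1-7) by simp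
    then have gt: "v \<^bold>\<circ> i\<^sub>1 \<^bold>\<circ> t = v \<^bold>\<circ> i\<^sub>1 \<^bold>\<circ> g \<^bold>\<circ> t" by simp
    have "v \<^bold>\<circ> i\<^sub>1 \<^bold>\<circ> g \<^bold>\<circ> t = (v \<^bold>\<circ> i\<^sub>1 \<^bold>\<circ> g) \<^bold>\<circ> t" using rt(1-6) g s uv by simp
    also have "\<dots> = Zero C G B" unfolding vig using rt(1-6) s by simp
    finally have vit: "v \<^bold>\<circ> i\<^sub>1 \<^bold>\<circ> t = Zero C G B" unfolding gt .
    have h1: "r \<^bold>\<circ> p\<^sub>1 \<^bold>\<circ> u \<^bold>\<circ> n\<^sub>2 = Zero C T G"
      using comp_cong_left[OF rpu, of n\<^sub>2] rt(1-6) s uv t by simp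
    have h2: "v \<^bold>\<circ> i\<^sub>1 \<^bold>\<circ> t \<^bold>\<circ> n\<^sub>1 = Zero C T B"
      using comp_cong_left[OF vit, of n\<^sub>1] rt(1-6) s uv t by simp
    have h3: "r \<^bold>\<circ> t \<^bold>\<circ> n\<^sub>1 = n\<^sub>1" using comp_cong_left[OF rt(7), of n\<^sub>1] rt(1-6) t by simp
    have h4: "v \<^bold>\<circ> u \<^bold>\<circ> n\<^sub>2 = n\<^sub>2" using comp_cong_left[OF vu, of n\<^sub>2] uv t by simp
    have h5: "t \<^bold>\<circ> r \<^bold>\<circ> p\<^sub>1 = g \<^bold>\<circ> p\<^sub>1" using comp_cong_left[OF rt(8), of p\<^sub>1] rt(1-6) s by simp
    \<comment> \<open>The splitting passes through the biproduct \<open>T\<close> of G and B: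
      \<open>r p\<^sub>1\<close> and \<open>v\<close> are the components into it,
      \<open>i\<^sub>1 t\<close> and \<open>u\<close> those out of it.\<close>
    let ?R = "m\<^sub>1 \<^bold>\<circ> r \<^bold>\<circ> p\<^sub>1 \<^bold>+ m\<^sub>2 \<^bold>\<circ> v" and ?S = "i\<^sub>1 \<^bold>\<circ> t \<^bold>\<circ> n\<^sub>1 \<^bold>+ u \<^bold>\<circ> n\<^sub>2"
    have "?R \<^bold>\<circ> ?S = Ident C T"
      using rt(1-6) s uv t bc h1 h2 h3 h4 t1 by (simp add: distrib)
    moreover have "?S \<^bold>\<circ> ?R = i\<^sub>1 \<^bold>\<circ> g \<^bold>\<circ> p\<^sub>1 \<^bold>+ u \<^bold>\<circ> v"
      using rt(1-6) g s uv t tc h5 by (simp add: distrib)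
    moreover have "\<dots> = e" unfolding e_eq using g s uv by (simp add: plus_comm)
    ultimately show ?thesis using rt(1-6) s uv t
      by (intro bexI[of _ T] bexI[of _ ?R] bexI[of _ ?S]) (simp_all add: in_Hom)
  next
    define e' where "e' = Ident C S \<^bold>+ neg e"
    have e': "e' \<in> Arr C" "Src C e' = S" "Tgt C e' = S" using e s by (simp_all add: e'_def)
    have e'e': "e' \<^bold>\<circ> e' = e'" using e s ee by (simp add: e'_def distrib)
    have ee'0: "e \<^bold>\<circ> e' = Zero C S S" using e s ee by (simp add: e'_def distrib)
    assume "is_unit B (Ident C B \<^bold>+ neg (p\<^sub>2 \<^bold>\<circ> e \<^bold>\<circ> i\<^sub>2))"
    moreover have "Ident C B \<^bold>+ neg (p\<^sub>2 \<^bold>\<circ> e \<^bold>\<circ> i\<^sub>2) = p\<^sub>2 \<^bold>\<circ> e' \<^bold>\<circ> i\<^sub>2"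
      using e s biproductD(17)[OF S] by (simp add: e'_def distrib)
    ultimately have "is_unit B (p\<^sub>2 \<^bold>\<circ> e' \<^bold>\<circ> i\<^sub>2)" by simp
    then obtain u v g d where uv: "u \<in> Arr C" "Src C u = B" "Tgt C u = S" "v \<in> Arr C" "Src C v = S" "Tgt C v = B"
      and g: "g \<in> Arr C" "Src C g = A" "Tgt C g = A" and d: "d \<in> Arr C" "Src C d = B" "Tgt C d = B"
      and e'u: "e' \<^bold>\<circ> u = u" and gg: "g \<^bold>\<circ> g = g"
      and e_eq: "e' = u \<^bold>\<circ> v \<^bold>+ i\<^sub>1 \<^bold>\<circ> g \<^bold>\<circ> p\<^sub>1" and dpu: "d \<^bold>\<circ> p\<^sub>2 \<^bold>\<circ> u = Ident C B"
      and pud: "p\<^sub>2 \<^bold>\<circ> u \<^bold>\<circ> d = Ident C B"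
      by (rule split_off_corner[OF S e' e'e'])
    \<comment> \<open>The complement \<open>e'\<close> takes up B and the image of \<open>g\<close>,
      so the image of 1 - \<open>g\<close> in A is what remains for \<open>e\<close>.\<close>
    define g' where "g' = Ident C A \<^bold>+ neg g"
    have g': "g' \<in> Arr C" "Src C g' = A" "Tgt C g' = A" using g s by (simp_all add: g'_def)
    have gg': "g' \<^bold>\<circ> g' = g'" using g s gg by (simp add: g'_def distrib)
    obtain G r t where G: "G \<in> Obj C" and rt: "r \<in> Arr C" "Src C r = A" "Tgt C r = G"
      "t \<in> Arr C" "Src C t = G" "Tgt C t = A" "r \<^bold>\<circ> t = Ident C G" "t \<^bold>\<circ> r = g'"
      by (rule idempotents_split_onE[OF A g' gg'])
    have eu: "e \<^bold>\<circ> u = Zero C B S"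
    proof -
      have "e \<^bold>\<circ> u = e \<^bold>\<circ> e' \<^bold>\<circ> u" unfolding e'u ..
      also have "\<dots> = Zero C B S" using comp_cong_left[OF ee'0, of u] e e' uv s by simp
      finally show ?thesis .
    qed
    have eig: "e \<^bold>\<circ> i\<^sub>1 \<^bold>\<circ> g = Zero C A S"
    proof -
      have "Zero C S S = e \<^bold>\<circ> u \<^bold>\<circ> v \<^bold>+ e \<^bold>\<circ> i\<^sub>1 \<^bold>\<circ> g \<^bold>\<circ> p\<^sub>1"
        using ee'0 unfolding e_eq using e uv g s by (simp add: distrib)
      also have "\<dots> = e \<^bold>\<circ> i\<^sub>1 \<^bold>\<circ> g \<^bold>\<circ> p\<^sub>1" using comp_cong_left[OF eu, of v] e uv g s by simp
      finally have z: "e \<^bold>\<circ> i\<^sub>1 \<^bold>\<circ> g \<^bold>\<circ> p\<^sub>1 = Zero C S S" ..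
      have "e \<^bold>\<circ> i\<^sub>1 \<^bold>\<circ> g = (e \<^bold>\<circ> i\<^sub>1 \<^bold>\<circ> g \<^bold>\<circ> p\<^sub>1) \<^bold>\<circ> i\<^sub>1" using biproductD(16)[OF S] e g s by simp
      also have "\<dots> = Zero C A S" unfolding z using s by simp
      finally show ?thesis .
    qed
    have eit: "e \<^bold>\<circ> i\<^sub>1 \<^bold>\<circ> t \<^bold>\<circ> r = e \<^bold>\<circ> i\<^sub>1" unfolding rt(8) g'_def using eig e g s by (simp add: distrib)
    \<comment> \<open>the projection onto \<open>A\<close> along the image of \<open>u\<close>\<close>
    define q where "q = p\<^sub>1 \<^bold>+ neg (p\<^sub>1 \<^bold>\<circ> u \<^bold>\<circ> d \<^bold>\<circ> p\<^sub>2)"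
    have q: "q \<in> Arr C" "Src C q = S" "Tgt C q = A" using s uv d by (simp_all add: q_def)
    have qu: "q \<^bold>\<circ> u = Zero C B A" using dpu s uv d by (simp add: q_def distrib)
    have qi: "q \<^bold>\<circ> i\<^sub>1 = Ident C A"
      using biproductD(16,19)[OF S] s uv d by (simp add: q_def distrib)
    have one: "i\<^sub>1 \<^bold>\<circ> q \<^bold>+ u \<^bold>\<circ> d \<^bold>\<circ> p\<^sub>2 = Ident C S"
    proof (rule biproduct_arr_eqI[OF S])
      show "p\<^sub>1 \<^bold>\<circ> (i\<^sub>1 \<^bold>\<circ> q \<^bold>+ u \<^bold>\<circ> d \<^bold>\<circ> p\<^sub>2) = p\<^sub>1 \<^bold>\<circ> Ident C S"
        using bc q s uv d by (simp add: distrib) (simp add: q_def plus_assoc s uv d)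
      show "p\<^sub>2 \<^bold>\<circ> (i\<^sub>1 \<^bold>\<circ> q \<^bold>+ u \<^bold>\<circ> d \<^bold>\<circ> p\<^sub>2) = p\<^sub>2 \<^bold>\<circ> Ident C S"
        using bc q s uv d comp_cong_left[OF pud, of p\<^sub>2] by (simp add: distrib)
    qed (use q s uv d in simp_all)
    have eiq: "e \<^bold>\<circ> i\<^sub>1 \<^bold>\<circ> q = e"
    proof -
      have "e = e \<^bold>\<circ> (i\<^sub>1 \<^bold>\<circ> q \<^bold>+ u \<^bold>\<circ> d \<^bold>\<circ> p\<^sub>2)" unfolding one using e by simp
      also have "\<dots> = e \<^bold>\<circ> i\<^sub>1 \<^bold>\<circ> q \<^bold>+ e \<^bold>\<circ> u \<^bold>\<circ> d \<^bold>\<circ> p\<^sub>2" using e q s uv d by (simp add: distrib)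
      also have "\<dots> = e \<^bold>\<circ> i\<^sub>1 \<^bold>\<circ> q" using comp_cong_left[OF eu, of "d \<^bold>\<circ> p\<^sub>2"] e q s uv d by simp
      finally show ?thesis ..
    qed
    \<comment> \<open>Compressed to A along the image of \<open>u\<close>, the idempotent
      \<open>e\<close> is 1 - \<open>g\<close>.\<close>
    have qei: "q \<^bold>\<circ> e \<^bold>\<circ> i\<^sub>1 = g'"
    proof -
      have "e = Ident C S \<^bold>+ neg e'" using e s by (simp add: e'_def)
      then have "q \<^bold>\<circ> e \<^bold>\<circ> i\<^sub>1 = q \<^bold>\<circ> (Ident C S \<^bold>+ neg e') \<^bold>\<circ> i\<^sub>1" by simp
      also have "\<dots> = Ident C A \<^bold>+ neg (q \<^bold>\<circ> e' \<^bold>\<circ> i\<^sub>1)" using e' s q qi by (simp add: distrib)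
      also have "q \<^bold>\<circ> e' \<^bold>\<circ> i\<^sub>1 = g"
        unfolding e_eq using comp_cong_left[OF qu, of "v \<^bold>\<circ> i\<^sub>1"] comp_cong_left[OF qi, of g]
          biproductD(16)[OF S] g s q uv by (simp add: distrib)
      finally show ?thesis unfolding g'_def .
    qed
    \<comment> \<open>One composite is \<open>e\<close> by \<open>eit\<close> and
      \<open>eiq\<close>; the other is the identity of G by \<open>qei\<close> and the splitting of
      1 - \<open>g\<close>.\<close>
    let ?R = "r \<^bold>\<circ> q \<^bold>\<circ> e" and ?S = "e \<^bold>\<circ> i\<^sub>1 \<^bold>\<circ> t"
    have "?S \<^bold>\<circ> ?R = (e \<^bold>\<circ> i\<^sub>1 \<^bold>\<circ> t \<^bold>\<circ> r) \<^bold>\<circ> q \<^bold>\<circ> e" using rt(1-6) q e s by simp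
    also have "\<dots> = (e \<^bold>\<circ> i\<^sub>1 \<^bold>\<circ> q) \<^bold>\<circ> e" unfolding eit using q e s by simp
    also have "\<dots> = e" unfolding eiq ee ..
    finally have SR: "?S \<^bold>\<circ> ?R = e" .
    have "?R \<^bold>\<circ> ?S = r \<^bold>\<circ> (q \<^bold>\<circ> e \<^bold>\<circ> i\<^sub>1) \<^bold>\<circ> t"
      using rt(1-6) q e s comp_cong_left[OF ee, of "i\<^sub>1 \<^bold>\<circ> t"] by simp
    also have "\<dots> = (r \<^bold>\<circ> t) \<^bold>\<circ> r \<^bold>\<circ> t" unfolding qei rt(8)[symmetric] using rt(1-6) by simp
    also have "\<dots> = Ident C G" unfolding rt(7) using G by simp
    finally have "?R \<^bold>\<circ> ?S = Ident C G" .
    with SR show ?thesis using rt(1-6) q e s G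
      by (intro bexI[of _ G] bexI[of _ ?R] bexI[of _ ?S]) (simp_all add: in_Hom)
  qed
qed

end

section \<open>Finite direct sums as iterated biproducts\<close>

lemma (in preadditive_category) finprod_sandwich:
  fixes n :: nat
  assumes "k \<in> Hom C T S" "r \<in> Hom C S T" "\<And>j. j < n \<Longrightarrow> f j \<in> Hom C S S"
  shows "finprod (hom_group C S S) f {..<n} \<in> Hom C S S \<and>
    finprod (hom_group C T T) (\<lambda>j. r \<^bold>\<circ> f j \<^bold>\<circ> k) {..<n} = r \<^bold>\<circ> finprod (hom_group C S S) f {..<n} \<^bold>\<circ> k"
proof -
  have o: "S \<in> Obj C" "T \<in> Obj C" using Hom_objs[OF assms(1)] by auto
  interpret GS: comm_group "hom_group C S S" by (rule hom_comm_group[OF o(1) o(1)])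
  interpret GT: comm_group "hom_group C T T" by (rule hom_comm_group[OF o(2) o(2)])
  have kr: "k \<in> Arr C" "Src C k = T" "Tgt C k = S" "r \<in> Arr C" "Src C r = S" "Tgt C r = T"
    using assms by (auto simp: in_Hom)
  have hg: "\<one>\<^bsub>hom_group C A B\<^esub> = Zero C A B" "carrier (hom_group C A B) = Hom C A B"
    "x \<otimes>\<^bsub>hom_group C A B\<^esub> y = x \<^bold>+ y" for A B x y by (simp_all add: hom_group_def)
  show ?thesis using assms(3)
  proof (induction n)
    case 0
    show ?case using o kr by (simp add: hg in_Hom)
  next
    case (Suc n)
    let ?s = "finprod (hom_group C S S) f {..<n}"
    have IH: "?s \<in> Hom C S S" "finprod (hom_group C T T) (\<lambda>j. r \<^bold>\<circ> f j \<^bold>\<circ> k) {..<n} = r \<^bold>\<circ> ?s \<^bold>\<circ> k"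
      using Suc.IH Suc.prems by simp_all
    have f: "f j \<in> Hom C S S" if "j \<le> n" for j using Suc.prems[of j] that by simp
    have f': "f j \<in> Arr C" "Src C (f j) = S" "Tgt C (f j) = S" if "j \<le> n" for j
      using f[OF that] by (simp_all add: in_Hom)
    have s: "?s \<in> Arr C" "Src C ?s = S" "Tgt C ?s = S" using IH by (auto simp: in_Hom)
    have 1: "finprod (hom_group C S S) f {..<Suc n} = f n \<^bold>+ ?s"
      unfolding lessThan_Suc using f by (subst GS.finprod_insert) (auto simp: hg)
    have 2: "finprod (hom_group C T T) (\<lambda>j. r \<^bold>\<circ> f j \<^bold>\<circ> k) {..<Suc n} = r \<^bold>\<circ> f n \<^bold>\<circ> k \<^bold>+ r \<^bold>\<circ> ?s \<^bold>\<circ> k"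
      unfolding lessThan_Suc IH(2)[symmetric] using f' kr
      by (subst GT.finprod_insert) (auto simp: hg in_Hom)
    show ?case unfolding 1 2 using s f'[of n] kr by (simp add: in_Hom distrib)
  qed
qed

text \<open>A partial sum is not among the given data, so T is taken as the kernel of the last
  projection. The arrow \<open>1 - i n p n\<close> factors through it and makes it a complement of
  \<open>B n\<close>; the other injections and projections restrict to T.\<close>

lemma (in abelian_category) finite_direct_sum_Suc:
  assumes "is_finite_direct_sum C (Suc n) B S"
  obtains T i\<^sub>1 i\<^sub>2 p\<^sub>1 p\<^sub>2 where "is_finite_direct_sum C n B T" "is_biproduct C T (B n) S i\<^sub>1 i\<^sub>2 p\<^sub>1 p\<^sub>2"
proof -
  obtain i p where S: "S \<in> Obj C" and Bo: "\<forall>k<Suc n. B k \<in> Obj C"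
    and ip: "\<forall>k<Suc n. i k \<in> Hom C (B k) S \<and> p k \<in> Hom C S (B k)"
    and orth: "\<forall>j<Suc n. \<forall>k<Suc n. p j \<^bold>\<circ> i k = (if j = k then Ident C (B k) else Zero C (B k) (B j))"
    and sum: "finprod (hom_group C S S) (\<lambda>k. i k \<^bold>\<circ> p k) {..<Suc n} = Ident C S"
    using assms unfolding is_finite_direct_sum_def by blast
  have ip': "i k \<in> Arr C" "Src C (i k) = B k" "Tgt C (i k) = S" "p k \<in> Arr C" "Src C (p k) = S" "Tgt C (p k) = B k"
    "B k \<in> Obj C" if "k \<le> n" for k
    using ip Bo that by (auto simp: in_Hom)
  note n = ip'[OF order_refl]
  have pin: "p n \<^bold>\<circ> i n = Ident C (B n)" using orth by simp
  obtain \<kappa> where \<kappa>: "is_kernel C \<kappa> (p n)" using ex_kernel n by blast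
  define T where "T = Src C \<kappa>"
  have k: "\<kappa> \<in> Arr C" "Src C \<kappa> = T" "Tgt C \<kappa> = S" "p n \<^bold>\<circ> \<kappa> = Zero C T (B n)" "T \<in> Obj C"
    using is_kernelD[OF \<kappa>] n src_obj unfolding T_def by auto
  let ?c = "Ident C S \<^bold>+ neg (i n \<^bold>\<circ> p n)"
  have pc: "p n \<^bold>\<circ> ?c = Zero C S (B n)"
    using n S comp_cong_left[OF pin, of "p n"] by (simp add: distrib)
  obtain \<rho> where r: "\<rho> \<in> Arr C" "Src C \<rho> = S" "Tgt C \<rho> = T" "\<kappa> \<^bold>\<circ> \<rho> = ?c"
    using kernelE[OF \<kappa>, of ?c S] pc n S k by auto
  note mono = kernel_mono[OF \<kappa>]
  have kr: "\<kappa> \<^bold>\<circ> \<rho> \<^bold>\<circ> h = h \<^bold>+ neg (i n \<^bold>\<circ> p n \<^bold>\<circ> h)" if "h \<in> Arr C" "Tgt C h = S" for h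
    using comp_cong_left[OF r(4), of h] r(1-3) k that n S by (simp add: distrib)
  have "\<kappa> \<^bold>\<circ> \<rho> \<^bold>\<circ> \<kappa> = \<kappa> \<^bold>\<circ> Ident C T" using kr[of \<kappa>] k n S by simp
  then have rk: "\<rho> \<^bold>\<circ> \<kappa> = Ident C T" by (rule monoD[OF mono]) (use k r(1-3) in simp_all)
  have "\<kappa> \<^bold>\<circ> \<rho> \<^bold>\<circ> i n = \<kappa> \<^bold>\<circ> Zero C (B n) T" using kr[of "i n"] k n pin S by simp
  then have rin: "\<rho> \<^bold>\<circ> i n = Zero C (B n) T" by (rule monoD[OF mono]) (use k n r(1-3) in simp_all)
  have bip: "is_biproduct C T (B n) S \<kappa> (i n) \<rho> (p n)"
    unfolding is_biproduct_def
  proof (intro conjI)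
    show "\<kappa> \<^bold>\<circ> \<rho> \<^bold>+ i n \<^bold>\<circ> p n = Ident C S" unfolding r(4) using n S by (simp add: plus_assoc)
  qed (use k r(1-3) n rk rin pin S in \<open>simp_all add: in_Hom\<close>)
  have kH: "\<kappa> \<in> Hom C T S" and rH: "\<rho> \<in> Hom C S T" using k r by (auto simp: in_Hom)
  have f: "i k \<^bold>\<circ> p k \<in> Hom C S S" if "k \<le> n" for k using ip'[OF that] by (simp add: in_Hom)
  have sandwich: "finprod (hom_group C S S) (\<lambda>k. i k \<^bold>\<circ> p k) {..<n} \<in> Hom C S S"
    "finprod (hom_group C T T) (\<lambda>k. \<rho> \<^bold>\<circ> (i k \<^bold>\<circ> p k) \<^bold>\<circ> \<kappa>) {..<n}
       = \<rho> \<^bold>\<circ> finprod (hom_group C S S) (\<lambda>k. i k \<^bold>\<circ> p k) {..<n} \<^bold>\<circ> \<kappa>"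
    using finprod_sandwich[OF kH rH, of n "\<lambda>k. i k \<^bold>\<circ> p k"] f by auto
  let ?s = "finprod (hom_group C S S) (\<lambda>k. i k \<^bold>\<circ> p k) {..<n}"
  have s: "?s \<in> Arr C" "Src C ?s = S" "Tgt C ?s = S" using sandwich(1) by (auto simp: in_Hom)
  interpret GS: comm_group "hom_group C S S" by (rule hom_comm_group[OF S S])
  interpret GT: comm_group "hom_group C T T" by (rule hom_comm_group[OF k(5) k(5)])
  have hg: "carrier (hom_group C A B) = Hom C A B" "x \<otimes>\<^bsub>hom_group C A B\<^esub> y = x \<^bold>+ y" for A B x y
    by (simp_all add: hom_group_def)
  have "finprod (hom_group C S S) (\<lambda>k. i k \<^bold>\<circ> p k) {..<Suc n} = i n \<^bold>\<circ> p n \<^bold>+ ?s"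
    unfolding lessThan_Suc using f by (subst GS.finprod_insert) (auto simp: hg)
  then have "i n \<^bold>\<circ> p n \<^bold>+ ?s = Ident C S" using sum by simp
  then have "?s \<^bold>+ i n \<^bold>\<circ> p n = Ident C S" using plus_comm[of ?s "i n \<^bold>\<circ> p n"] s n by simp
  \<comment> \<open>The first n terms add up to the idempotent \<open>\<kappa> \<rho>\<close>, whose
    compression to T is the identity.\<close>
  then have "?s = ?c" using eq_minus_iff[of ?s "Ident C S" "i n \<^bold>\<circ> p n"] s n S by simp
  then have "\<rho> \<^bold>\<circ> ?s \<^bold>\<circ> \<kappa> = \<rho> \<^bold>\<circ> (\<kappa> \<^bold>\<circ> \<rho>) \<^bold>\<circ> \<kappa>" unfolding r(4) by simp
  also have "\<dots> = Ident C T" using rk k r(1-3) comp_cong_left[OF rk, of "\<rho> \<^bold>\<circ> \<kappa>"] by simp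
  finally have sumT: "\<rho> \<^bold>\<circ> ?s \<^bold>\<circ> \<kappa> = Ident C T" .
  have "is_finite_direct_sum C n B T"
    unfolding is_finite_direct_sum_def
  proof (rule conjI[OF k(5)], rule conjI[rotated], rule exI[of _ "\<lambda>k. \<rho> \<^bold>\<circ> i k"],
      rule exI[of _ "\<lambda>k. p k \<^bold>\<circ> \<kappa>"]; intro conjI allI impI)
    show "B j \<in> Obj C" "\<rho> \<^bold>\<circ> i j \<in> Hom C (B j) T" "p j \<^bold>\<circ> \<kappa> \<in> Hom C T (B j)" if "j < n" for j
      using ip'[of j] that k r(1-3) by (simp_all add: in_Hom)
    show "(p j \<^bold>\<circ> \<kappa>) \<^bold>\<circ> \<rho> \<^bold>\<circ> i l = (if j = l then Ident C (B l) else Zero C (B l) (B j))"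
      if jl: "j < n" "l < n" for j l
    proof -
      have z: "p n \<^bold>\<circ> i l = Zero C (B l) (B n)" using orth jl by simp
      have "(p j \<^bold>\<circ> \<kappa>) \<^bold>\<circ> \<rho> \<^bold>\<circ> i l = p j \<^bold>\<circ> (i l \<^bold>+ neg (i n \<^bold>\<circ> p n \<^bold>\<circ> i l))"
        using kr[of "i l"] ip'[of j] ip'[of l] jl k r(1-3) by simp
      also have "\<dots> = p j \<^bold>\<circ> i l" unfolding z using ip'[of j] ip'[of l] jl n S by simp
      finally show ?thesis using orth jl by simp
    qed
    have "finprod (hom_group C T T) (\<lambda>j. (\<rho> \<^bold>\<circ> i j) \<^bold>\<circ> p j \<^bold>\<circ> \<kappa>) {..<n}
      = finprod (hom_group C T T) (\<lambda>j. \<rho> \<^bold>\<circ> (i j \<^bold>\<circ> p j) \<^bold>\<circ> \<kappa>) {..<n}"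
      by (rule GT.finprod_cong') (use ip' k r(1-3) in \<open>auto simp: hg in_Hom\<close>)
    then show "finprod (hom_group C T T) (\<lambda>j. (\<rho> \<^bold>\<circ> i j) \<^bold>\<circ> p j \<^bold>\<circ> \<kappa>) {..<n} = Ident C T"
      unfolding sandwich(2) sumT .
  qed
  then show thesis using bip by (rule that)
qed

text \<open>Since \<open>d\<close> and 1 - \<open>d\<close> add up to the identity, they are not
  both non-units. This consequence of locality passes to quotients, even to the zero ring.\<close>

lemma (in preadditive_category) local_ring_unit:
  assumes "local_ring (end_ring C B)" "B \<in> Obj C" "d \<in> Hom C B B"
  shows "is_unit B d \<or> is_unit B (Ident C B \<^bold>+ neg d)"
proof -
  have U: "x \<in> Units (end_ring C B) \<longleftrightarrow> x \<in> Hom C B B \<and> is_unit B x" for x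
    by (auto simp: Units_def is_unit_def end_ring_def)
  have d: "d \<in> Arr C" "Src C d = B" "Tgt C d = B" using assms(3) by (auto simp: in_Hom)
  have 1: "Ident C B \<^bold>+ neg d \<in> Hom C B B" using d assms(2) by (simp add: in_Hom)
  have "Ident C B \<in> Units (end_ring C B)"
    unfolding U is_unit_def using assms(2) by (auto simp: in_Hom intro!: bexI[of _ "Ident C B"])
  moreover have "d \<^bold>+ (Ident C B \<^bold>+ neg d) = Ident C B" using d assms(2) by simp
  ultimately have "d \<oplus>\<^bsub>end_ring C B\<^esub> (Ident C B \<^bold>+ neg d) \<in> Units (end_ring C B)" by (simp add: end_ring_def)
  then have "d \<in> Units (end_ring C B) \<or> Ident C B \<^bold>+ neg d \<in> Units (end_ring C B)"
    using assms(1,3) 1 unfolding local_ring_def by (auto simp: end_ring_def)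
  then show ?thesis unfolding U by blast
qed

text \<open>Biproducts and units of C remain such after passing to classes, so
  \<open>idempotents_split_on_biproduct\<close> can be applied to the stable category itself. Its
  hypotheses on A and B are supplied by the induction and by locality in C.\<close>

lemma (in stable_ideal) krull_schmidt_stable_split:
  assumes "krull_schmidt C"
  shows "has_split_idempotents (stable_cat C (Obj C) \<P>)"
proof -
  let ?D = "stable_cat C (Obj C) \<P>"
  note simps = stable_simps[OF subset_refl]
  note D = stable_preadditive[OF subset_refl]
  interpret D: preadditive_category ?D by (rule D)
  have main: "is_finite_direct_sum C n B S \<Longrightarrow> \<forall>k<n. local_ring (end_ring C (B k)) \<Longrightarrow> idempotents_split_on ?D S" for n B S
  proof (induction n arbitrary: S)
    case 0
    then obtain i p where S: "S \<in> Obj C"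
      and sum: "finprod (hom_group C S S) (\<lambda>k. i k \<^bold>\<circ> p k) {..<0::nat} = Ident C S"
      unfolding is_finite_direct_sum_def by blast
    interpret GS: comm_group "hom_group C S S" by (rule hom_comm_group[OF S S])
    \<comment> \<open>The empty sum is zero, so the identity of \<open>S\<close> is zero and
      \<open>S\<close> has a single stable endomorphism.\<close>
    have "Ident C S = \<one>\<^bsub>hom_group C S S\<^esub>" using sum by simp
    then have "Ident C S = Zero C S S" by (simp add: hom_group_def)
    note S = S this
    have SD: "S \<in> Obj ?D" "Ident ?D S = Zero ?D S S" using S by (simp_all add: simps)
    have "\<exists>B\<in>Obj ?D. \<exists>r\<in>Hom ?D S B. \<exists>s\<in>Hom ?D B S. r \<^bold>\<circ>\<^bsub>?D\<^esub> s = Ident ?D B \<and> s \<^bold>\<circ>\<^bsub>?D\<^esub> r = e"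
      if e: "e \<in> Hom ?D S S" for e
    proof -
      have e': "e \<in> Arr ?D" "Src ?D e = S" "Tgt ?D e = S" using e by (auto simp: in_Hom)
      have "e = e \<^bold>\<circ>\<^bsub>?D\<^esub> Ident ?D S" using e' by simp
      also have "\<dots> = Ident ?D S" unfolding SD(2) using e' SD(1) by simp
      finally have "e = Ident ?D S" .
      then show ?thesis using SD(1) e by (intro bexI[of _ S] bexI[of _ "Ident ?D S"]) simp_all
    qed
    then show ?case unfolding idempotents_split_on_def by blast
  next
    case (Suc n)
    obtain T i\<^sub>1 i\<^sub>2 p\<^sub>1 p\<^sub>2 where T: "is_finite_direct_sum C n B T" and bip: "is_biproduct C T (B n) S i\<^sub>1 i\<^sub>2 p\<^sub>1 p\<^sub>2"
      using finite_direct_sum_Suc[OF Suc.prems(1)] .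
    note b = biproductD(1-3)[OF bip]
    have loc: "local_ring (end_ring C (B n))" using Suc.prems(2) by simp
    show ?case
    proof (rule D.idempotents_split_on_biproduct[OF stable_biproduct[OF subset_refl bip b]])
      show "idempotents_split_on ?D T" using Suc.IH[OF T] Suc.prems(2) by simp
      show "\<exists>T' m\<^sub>1 m\<^sub>2 n\<^sub>1 n\<^sub>2. is_biproduct ?D G (B n) T' m\<^sub>1 m\<^sub>2 n\<^sub>1 n\<^sub>2" if "G \<in> Obj ?D" for G
      proof -
        have G: "G \<in> Obj C" using that by (simp add: simps)
        obtain T' m\<^sub>1 m\<^sub>2 n\<^sub>1 n\<^sub>2 where T': "is_biproduct C G (B n) T' m\<^sub>1 m\<^sub>2 n\<^sub>1 n\<^sub>2"
          using ex_biproduct[OF G b(2)] by blast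
        show ?thesis using stable_biproduct[OF subset_refl T' biproductD(1-3)[OF T']] by blast
      qed
      have unit: "D.is_unit (B n) (cl f)" if f: "f \<in> Hom C (B n) (B n)" and u: "is_unit (B n) f" for f
      proof -
        obtain f' where f': "f' \<in> Hom C (B n) (B n)" "f' \<^bold>\<circ> f = Ident C (B n)" "f \<^bold>\<circ> f' = Ident C (B n)"
          using u unfolding is_unit_def by blast
        have "cl f' \<in> Hom ?D (B n) (B n)"
          by (rule stable_HomI) (use f' b in \<open>simp_all add: in_Hom\<close>)
        moreover have "cl f' \<^bold>\<circ>\<^bsub>?D\<^esub> cl f = Ident ?D (B n)" "cl f \<^bold>\<circ>\<^bsub>?D\<^esub> cl f' = Ident ?D (B n)"
          using f f' by (simp_all add: simps in_Hom)
        ultimately show ?thesis unfolding D.is_unit_def by blast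
      qed
      show "D.is_unit (B n) d \<or> D.is_unit (B n) (Ident ?D (B n) \<^bold>+\<^bsub>?D\<^esub> D.neg d)"
        if d: "d \<in> Hom ?D (B n) (B n)" for d
      proof -
        obtain f where f: "d = cl f" "f \<in> Arr C" "Src C f = B n" "Tgt C f = B n"
          using stable_HomE[OF subset_refl d] .
        have fH: "f \<in> Hom C (B n) (B n)" using f by (simp add: in_Hom)
        have nH: "Ident C (B n) \<^bold>+ neg f \<in> Hom C (B n) (B n)" using f b by (simp add: in_Hom)
        have "cl f \<in> Hom ?D (B n) (B n)" "cl (neg f) \<in> Hom ?D (B n) (B n)"
          by (rule stable_HomI; use f b in simp)+
        then have Df: "cl f \<in> Arr ?D" "cl (neg f) \<in> Arr ?D" by (simp_all add: in_Hom)
        have "cl f \<^bold>+\<^bsub>?D\<^esub> cl (neg f) = Zero ?D (Src ?D (cl f)) (Tgt ?D (cl f))"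
          using f(2-4) by (simp add: simps)
        then have n: "D.neg (cl f) = cl (neg f)"
          by (intro D.neg_unique[symmetric] Df) (use f(2-4) in \<open>simp_all add: simps\<close>)
        have "Ident ?D (B n) \<^bold>+\<^bsub>?D\<^esub> D.neg d = cl (Ident C (B n) \<^bold>+ neg f)"
          unfolding f(1) n using f(2-4) b by (simp add: simps)
        then show ?thesis
          using local_ring_unit[OF loc b(2) fH] unit[OF fH] unit[OF nH] f(1) by auto
      qed
    qed
  qed
  show ?thesis
    unfolding has_split_idempotents_def
  proof
    fix A assume "A \<in> Obj ?D"
    then have "A \<in> Obj C" by (simp add: simps)
    then have "idempotents_split_on ?D A" using assms main unfolding krull_schmidt_def by blast
    then show "\<forall>e\<in>Hom ?D A A. e \<^bold>\<circ>\<^bsub>?D\<^esub> e = e \<longrightarrow>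
      (\<exists>B\<in>Obj ?D. \<exists>r\<in>Hom ?D A B. \<exists>s\<in>Hom ?D B A. r \<^bold>\<circ>\<^bsub>?D\<^esub> s = Ident ?D B \<and> s \<^bold>\<circ>\<^bsub>?D\<^esub> r = e)"
      unfolding idempotents_split_on_def .
  qed
qed


section \<open>Duality\<close>

lemma functor_iso_trans:
  assumes "functor_iso C X F G" "functor_iso C X G H"
  shows "functor_iso C X F H"
proof -
  obtain \<sigma> where s: "\<forall>A \<in> X. \<sigma> A \<in> iso (FObj F A) (FObj G A)"
    "\<forall>A \<in> X. \<forall>B \<in> X. \<forall>f \<in> Hom C A B. \<forall>x \<in> carrier (FObj F A). \<sigma> B (FMap F f x) = FMap G f (\<sigma> A x)"
    using assms(1) unfolding functor_iso_def by blast
  obtain \<tau> where t: "\<forall>A \<in> X. \<tau> A \<in> iso (FObj G A) (FObj H A)"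
    "\<forall>A \<in> X. \<forall>B \<in> X. \<forall>f \<in> Hom C A B. \<forall>x \<in> carrier (FObj G A). \<tau> B (FMap G f x) = FMap H f (\<tau> A x)"
    using assms(2) unfolding functor_iso_def by blast
  have c: "\<sigma> A x \<in> carrier (FObj G A)" if "A \<in> X" "x \<in> carrier (FObj F A)" for A x
    using s(1) that by (auto simp: iso_def hom_def)
  show ?thesis
    unfolding functor_iso_def
  proof (intro exI[of _ "\<lambda>A. \<tau> A \<circ> \<sigma> A"] conjI ballI)
    fix A assume "A \<in> X"
    then have "\<sigma> A \<in> iso (FObj F A) (FObj G A)" "\<tau> A \<in> iso (FObj G A) (FObj H A)" using s t by auto
    then show "\<tau> A \<circ> \<sigma> A \<in> iso (FObj F A) (FObj H A)"
      unfolding iso_def by (auto intro: hom_compose bij_betw_trans)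
  qed (use s(2) t(2) c in auto)
qed

lemma factors_through_op [simp]: "factors_through (op_cat C) \<P> h \<longleftrightarrow> factors_through C \<P> h"
  unfolding factors_through_def by auto

lemma stable_class_op [simp]: "stable_class (op_cat C) \<P> f = stable_class C \<P> f"
  by (simp add: stable_class_def)

text \<open>The classes are the same sets for C and for its opposite, so \<open>SOME\<close> picks
  the same representatives and the two categories are equal, not merely isomorphic.\<close>

lemma stable_cat_op: "stable_cat (op_cat C) X \<P> = op_cat (stable_cat C X \<P>)"
proof -
  have "{f \<in> Arr C. Tgt C f \<in> X \<and> Src C f \<in> X} = {f \<in> Arr C. Src C f \<in> X \<and> Tgt C f \<in> X}" by auto
  then show ?thesis unfolding stable_cat_def by (simp add: op_cat_def[of "\<lparr>Obj = X, Arr = _, Src = _, Tgt = _, Ident = _, Comp = _, Plus = _, Zero = _\<rparr>"] fun_eq_iff)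
qed

lemma has_split_idempotents_op [simp]: "has_split_idempotents (op_cat D) \<longleftrightarrow> has_split_idempotents D"
  unfolding has_split_idempotents_def by (simp, blast)

section \<open>Extensions in the opposite category\<close>

context abelian_category begin

text \<open>Duality turns a morphism out of \<open>x\<close> into one into its swap;
  \<open>ext_map_sym\<close> turns it round.\<close>

lemma swap_ext_class:
  assumes "x \<in> extensions (op_cat C) A Y"
  shows "prod.swap ` ext_class (op_cat C) A Y x = ext_class C Y A (prod.swap x)"
proof -
  have x: "prod.swap x \<in> extensions C Y A" using assms swap_extensions[of "prod.swap x" A Y] by simp
  show ?thesis
  proof (intro Set.set_eqI iffI)
    fix z assume "z \<in> prod.swap ` ext_class (op_cat C) A Y x"
    then have z: "prod.swap z \<in> extensions (op_cat C) A Y" "ext_map (op_cat C) x (prod.swap z) (Ident C Y) (Ident C A)"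
      by (auto simp: ext_class_def)
    have z': "z \<in> extensions C Y A" using z(1) swap_extensions by simp
    have "ext_map C z (prod.swap x) (Ident C A) (Ident C Y)" using z(2) swap_ext_map[OF z' x] by simp
    then show "z \<in> ext_class C Y A (prod.swap x)" using ext_map_sym[OF z' x] z' by (simp add: ext_class_def)
  next
    fix z assume "z \<in> ext_class C Y A (prod.swap x)"
    then have z: "z \<in> extensions C Y A" "ext_map C (prod.swap x) z (Ident C A) (Ident C Y)" by (auto simp: ext_class_def)
    have "ext_map (op_cat C) x (prod.swap z) (Ident C Y) (Ident C A)"
      using swap_ext_map[OF z(1) x] ext_map_sym[OF x z] by simp
    then have "prod.swap z \<in> ext_class (op_cat C) A Y x" using z by (simp add: ext_class_def swap_extensions)
    then show "z \<in> prod.swap ` ext_class (op_cat C) A Y x" by (intro image_eqI[of _ _ "prod.swap z"]) simp_all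
  qed
qed

text \<open>Seen in C, the swapped \<open>z\<close> is a pullback of a pushout \<open>w\<close> of
  the direct sum \<open>?e\<close>. The morphism from the pullback \<open>v\<close> of
  \<open>?e\<close> to \<open>w\<close> factors through \<open>z\<close>, which exhibits
  \<open>z\<close> as a pushout of a pullback. The reverse inclusion is this lemma in the opposite
  category.\<close>

lemma swap_baer_sum:
  assumes z: "z \<in> baer_sum (op_cat C) A Y \<xi> \<eta>"
    and \<xi>: "\<xi> \<subseteq> extensions (op_cat C) A Y" and \<eta>: "\<eta> \<subseteq> extensions (op_cat C) A Y"
  shows "prod.swap z \<in> baer_sum C Y A (prod.swap ` \<xi>) (prod.swap ` \<eta>)"
proof -
  let ?O = "op_cat C"
  interpret O: abelian_category ?O by (rule abelian_op)
  obtain x y S i\<^sub>1 i\<^sub>2 p\<^sub>1 p\<^sub>2 T k\<^sub>1 k\<^sub>2 q\<^sub>1 q\<^sub>2 U j\<^sub>1 j\<^sub>2 r\<^sub>1 r\<^sub>2 where x: "x \<in> \<xi>" and y: "y \<in> \<eta>"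
    and S: "is_biproduct ?O Y Y S i\<^sub>1 i\<^sub>2 p\<^sub>1 p\<^sub>2" and T: "is_biproduct ?O A A T k\<^sub>1 k\<^sub>2 q\<^sub>1 q\<^sub>2"
    and U: "is_biproduct ?O (Tgt ?O (fst x)) (Tgt ?O (fst y)) U j\<^sub>1 j\<^sub>2 r\<^sub>1 r\<^sub>2"
    and z': "z \<in> ext_push ?O (p\<^sub>1 \<^bold>+\<^bsub>?O\<^esub> p\<^sub>2) (ext_pull ?O (k\<^sub>1 \<^bold>+\<^bsub>?O\<^esub> k\<^sub>2)
       {((j\<^sub>1 \<^bold>\<circ>\<^bsub>?O\<^esub> fst x \<^bold>\<circ>\<^bsub>?O\<^esub> p\<^sub>1) \<^bold>+\<^bsub>?O\<^esub> (j\<^sub>2 \<^bold>\<circ>\<^bsub>?O\<^esub> fst y \<^bold>\<circ>\<^bsub>?O\<^esub> p\<^sub>2),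
         (k\<^sub>1 \<^bold>\<circ>\<^bsub>?O\<^esub> snd x \<^bold>\<circ>\<^bsub>?O\<^esub> r\<^sub>1) \<^bold>+\<^bsub>?O\<^esub> (k\<^sub>2 \<^bold>\<circ>\<^bsub>?O\<^esub> snd y \<^bold>\<circ>\<^bsub>?O\<^esub> r\<^sub>2))})"
    (is "_ \<in> ext_push _ _ (ext_pull _ _ {?d})")
    using z unfolding baer_sum_def by blast
  have xe: "x \<in> extensions ?O A Y" and ye: "y \<in> extensions ?O A Y" using x y \<xi> \<eta> by auto
  have xc: "prod.swap x \<in> extensions C Y A" and yc: "prod.swap y \<in> extensions C Y A"
    using xe ye swap_extensions[of "prod.swap x" A Y] swap_extensions[of "prod.swap y" A Y] by simp_all
  note X' = extensionsD(1-8)[OF xc, simplified] and Y' = extensionsD(1-8)[OF yc, simplified]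
  have S': "is_biproduct C Y Y S p\<^sub>1 p\<^sub>2 i\<^sub>1 i\<^sub>2" and T': "is_biproduct C A A T q\<^sub>1 q\<^sub>2 k\<^sub>1 k\<^sub>2"
    and U': "is_biproduct C (Src C (fst x)) (Src C (fst y)) U r\<^sub>1 r\<^sub>2 j\<^sub>1 j\<^sub>2" using S T U by simp_all
  note s = biproductD(1-15)[OF S'] and t = biproductD(1-15)[OF T'] and u = biproductD(1-15)[OF U']
  let ?e = "((r\<^sub>1 \<^bold>\<circ> snd x \<^bold>\<circ> k\<^sub>1) \<^bold>+ (r\<^sub>2 \<^bold>\<circ> snd y \<^bold>\<circ> k\<^sub>2), (p\<^sub>1 \<^bold>\<circ> fst x \<^bold>\<circ> j\<^sub>1) \<^bold>+ (p\<^sub>2 \<^bold>\<circ> fst y \<^bold>\<circ> j\<^sub>2))"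
  have d: "?d = prod.swap ?e" using X' Y' s t u by simp
  have dO: "?d \<in> extensions ?O T S" by (rule O.biproduct_extension[OF S T U xe ye])
  then have e: "?e \<in> extensions C S T" unfolding d swap_extensions .
  have kH: "k\<^sub>1 \<^bold>+ k\<^sub>2 \<in> Hom C T A" and pH: "p\<^sub>1 \<^bold>+ p\<^sub>2 \<in> Hom C Y S" using s t by (simp_all add: in_Hom)
  obtain w where zO: "z \<in> extensions ?O A Y" and w: "w \<in> extensions ?O A S"
    "ext_map ?O w ?d (Ident C S) (k\<^sub>1 \<^bold>+ k\<^sub>2)" "ext_map ?O w z (p\<^sub>1 \<^bold>+ p\<^sub>2) (Ident C A)"
    using z' O.in_ext_push_pull_iff[OF dO, of "k\<^sub>1 \<^bold>+ k\<^sub>2" A "p\<^sub>1 \<^bold>+ p\<^sub>2" Y z] kH pH by auto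
  have wc: "prod.swap w \<in> extensions C S A" and zc: "prod.swap z \<in> extensions C Y A"
    using w(1) zO swap_extensions[of "prod.swap w" A S] swap_extensions[of "prod.swap z" A Y] by simp_all
  have ew: "ext_map C ?e (prod.swap w) (k\<^sub>1 \<^bold>+ k\<^sub>2) (Ident C S)"
    using w(2) swap_ext_map[OF e wc] unfolding d by simp
  have zw: "ext_map C (prod.swap z) (prod.swap w) (Ident C A) (p\<^sub>1 \<^bold>+ p\<^sub>2)"
    using w(3) swap_ext_map[OF zc wc] by simp
  obtain v where v: "v \<in> extensions C Y T" "ext_map C v ?e (Ident C T) (p\<^sub>1 \<^bold>+ p\<^sub>2)"
    using ext_map_pull_ex[OF e pH] by blast
  have vw: "ext_map C v (prod.swap w) (k\<^sub>1 \<^bold>+ k\<^sub>2) (p\<^sub>1 \<^bold>+ p\<^sub>2)"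
    by (rule ext_map_comp'[OF v(1) e wc v(2) ew]) (use s t in simp_all)
  have "ext_map C v (prod.swap z) (k\<^sub>1 \<^bold>+ k\<^sub>2) (Ident C Y)"
    by (rule ext_map_pull_factor[OF wc zc v(1) zw]) (use vw s ident_hom in simp_all)
  then have "prod.swap z \<in> ext_push C (k\<^sub>1 \<^bold>+ k\<^sub>2) (ext_pull C (p\<^sub>1 \<^bold>+ p\<^sub>2) {?e})"
    unfolding in_ext_push_pull_iff[OF e pH kH] using zc v by blast
  then have z'': "prod.swap z \<in> ext_push C (k\<^sub>1 \<^bold>+ k\<^sub>2) (ext_pull C (p\<^sub>1 \<^bold>+ p\<^sub>2)
      {((r\<^sub>1 \<^bold>\<circ> fst (prod.swap x) \<^bold>\<circ> k\<^sub>1) \<^bold>+ (r\<^sub>2 \<^bold>\<circ> fst (prod.swap y) \<^bold>\<circ> k\<^sub>2),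
        (p\<^sub>1 \<^bold>\<circ> snd (prod.swap x) \<^bold>\<circ> j\<^sub>1) \<^bold>+ (p\<^sub>2 \<^bold>\<circ> snd (prod.swap y) \<^bold>\<circ> j\<^sub>2))})"
    unfolding swap_simp fst_swap snd_swap .
  have U'': "is_biproduct C (Tgt C (fst (prod.swap x))) (Tgt C (fst (prod.swap y))) U r\<^sub>1 r\<^sub>2 j\<^sub>1 j\<^sub>2"
    using U' X'(5) Y'(5) by simp
  show ?thesis
    unfolding baer_sum_def
    by (intro CollectI bexI[OF _ imageI[OF x]] bexI[OF _ imageI[OF y]] exI conjI,
        rule T', rule S', rule U'', rule z'')
qed

text \<open>Classes consist of pairs whose order is reversed in the opposite category, so the two
  functors are identified by swapping rather than by equality.\<close>

lemma Ext1_cov_op_iso: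
  "functor_iso (op_cat C) X (Ext1_cov (op_cat C) A) (Ext1_contra C A)"
proof -
  let ?O = "op_cat C"
  interpret O: abelian_category ?O by (rule abelian_op)
  have sub: "\<xi> \<subseteq> extensions ?O A Y" if "\<xi> \<in> carrier (Ext1 ?O A Y)" for \<xi> Y
    using that unfolding O.carrier_Ext1 by (auto simp: ext_class_def)
  have closed: "prod.swap ` \<xi> \<in> carrier (Ext1 C Y A)" if c: "\<xi> \<in> carrier (Ext1 ?O A Y)" for \<xi> Y
  proof -
    obtain x where x: "x \<in> extensions ?O A Y" "\<xi> = ext_class ?O A Y x" using c unfolding O.carrier_Ext1 by blast
    have "prod.swap x \<in> extensions C Y A" using x(1) swap_extensions[of "prod.swap x" A Y] by simp
    then show ?thesis unfolding carrier_Ext1 x(2) swap_ext_class[OF x(1)] by (rule bexI[rotated]) (rule refl)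
  qed
  have closed': "prod.swap ` \<xi> \<in> carrier (Ext1 ?O A Y)" if c: "\<xi> \<in> carrier (Ext1 C Y A)" for \<xi> Y
  proof -
    obtain x where x: "x \<in> extensions C Y A" "\<xi> = ext_class C Y A x" using c unfolding carrier_Ext1 by blast
    have "prod.swap x \<in> extensions ?O A Y" using x(1) unfolding swap_extensions .
    moreover have "prod.swap ` \<xi> = ext_class ?O A Y (prod.swap x)"
      unfolding x(2) using O.swap_ext_class[of x Y A] x(1) by simp
    ultimately show ?thesis unfolding O.carrier_Ext1 by (rule bexI[rotated])
  qed
  have mult: "prod.swap ` baer_sum ?O A Y \<xi> \<eta> = baer_sum C Y A (prod.swap ` \<xi>) (prod.swap ` \<eta>)"
    if "\<xi> \<in> carrier (Ext1 ?O A Y)" "\<eta> \<in> carrier (Ext1 ?O A Y)" for \<xi> \<eta> Y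
  proof (intro Set.set_eqI iffI)
    note \<xi> = sub[OF that(1)] and \<eta> = sub[OF that(2)]
    show "z \<in> baer_sum C Y A (prod.swap ` \<xi>) (prod.swap ` \<eta>)" if "z \<in> prod.swap ` baer_sum ?O A Y \<xi> \<eta>" for z
      using that swap_baer_sum[OF _ \<xi> \<eta>] by auto
    fix z assume z: "z \<in> baer_sum C Y A (prod.swap ` \<xi>) (prod.swap ` \<eta>)"
    have e: "prod.swap ` \<xi> \<subseteq> extensions C Y A" "prod.swap ` \<eta> \<subseteq> extensions C Y A"
      using \<xi> \<eta> swap_extensions[of "prod.swap _" A Y] by auto
    have "prod.swap z \<in> baer_sum ?O A Y (prod.swap ` prod.swap ` \<xi>) (prod.swap ` prod.swap ` \<eta>)"
      using O.swap_baer_sum[of z Y A "prod.swap ` \<xi>" "prod.swap ` \<eta>"] z e by simp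
    then show "z \<in> prod.swap ` baer_sum ?O A Y \<xi> \<eta>"
      by (intro image_eqI[of _ _ "prod.swap z"]) (simp_all add: image_image)
  qed
  show ?thesis
    unfolding functor_iso_def
  proof (intro exI[of _ "\<lambda>Y \<xi>. prod.swap ` \<xi>"] conjI ballI)
    fix Y assume "Y \<in> X"
    have "(\<lambda>\<xi>. prod.swap ` \<xi>) \<in> hom (Ext1 ?O A Y) (Ext1 C Y A)"
      using closed mult by (intro homI) (simp_all add: Ext1_simps O.Ext1_simps)
    moreover have "bij_betw (\<lambda>\<xi>. prod.swap ` \<xi>) (carrier (Ext1 ?O A Y)) (carrier (Ext1 C Y A))"
      by (rule bij_betw_byWitness[where f' = "\<lambda>\<xi>. prod.swap ` \<xi>"])
        (use closed closed' in \<open>auto simp: image_image\<close>)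
    ultimately show "(\<lambda>\<xi>. prod.swap ` \<xi>) \<in> iso (FObj (Ext1_cov ?O A) Y) (FObj (Ext1_contra C A) Y)"
      by (simp add: iso_def Ext1_cov_def Ext1_contra_def)
  next
    fix Y Y' f \<xi> assume Y: "Y \<in> X" "Y' \<in> X" and "f \<in> Hom ?O Y Y'" and "\<xi> \<in> carrier (FObj (Ext1_cov ?O A) Y)"
    then have f: "f \<in> Hom C Y' Y" "f \<in> Hom ?O Y Y'" and "\<xi> \<in> carrier (Ext1 ?O A Y)" by (simp_all add: Ext1_cov_def)
    then obtain x where x: "x \<in> extensions ?O A Y" "\<xi> = ext_class ?O A Y x" unfolding O.carrier_Ext1 by blast
    then have xc: "prod.swap x \<in> extensions C Y A" using swap_extensions[of "prod.swap x" A Y] by simp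
    have "prod.swap ` ext_push ?O f \<xi> = ext_pull C f (prod.swap ` \<xi>)"
      unfolding x(2) swap_ext_class[OF x(1)] ext_pull_class[OF xc f(1)] O.ext_push_class[OF x(1) f(2)]
    proof (intro Set.set_eqI iffI)
      fix z assume "z \<in> prod.swap ` {y \<in> extensions ?O A Y'. ext_map ?O x y f (Ident ?O A)}"
      then have "prod.swap z \<in> extensions ?O A Y'" and m: "ext_map ?O x (prod.swap z) f (Ident C A)" by auto
      then have z: "z \<in> extensions C Y' A" using swap_extensions by simp
      then show "z \<in> {y \<in> extensions C Y' A. ext_map C y (prod.swap x) (Ident C A) f}"
        using m swap_ext_map[OF z xc] by simp
    next
      fix z assume "z \<in> {y \<in> extensions C Y' A. ext_map C y (prod.swap x) (Ident C A) f}"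
      then have z: "z \<in> extensions C Y' A" "ext_map C z (prod.swap x) (Ident C A) f" by auto
      then have "prod.swap z \<in> {y \<in> extensions ?O A Y'. ext_map ?O x y f (Ident ?O A)}"
        using swap_ext_map[OF z(1) xc] swap_extensions by simp
      then show "z \<in> prod.swap ` {y \<in> extensions ?O A Y'. ext_map ?O x y f (Ident ?O A)}"
        by (intro image_eqI[of _ _ "prod.swap z"]) simp_all
    qed
    then show "prod.swap ` FMap (Ext1_cov ?O A) f \<xi> = FMap (Ext1_contra C A) f (prod.swap ` \<xi>)"
      by (simp add: Ext1_cov_def Ext1_contra_def)
  qed
qed

theorem Ext1_contra_summand:
  fixes F :: "('a, 'b, 'g) ab_functor" and G :: "('a, 'b, 'h) ab_functor"
  assumes "enough_injectives C" "X \<subseteq> Obj C" "\<And>I. injective C I \<Longrightarrow> I \<in> X"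
    "closed_cokernels_of_monos C X" "has_split_idempotents (stable_cat C X (injective C))"
    "A \<in> X" "direct_summand_compl (op_cat C) X F G (Ext1_contra C A)"
  shows "\<exists>B \<in> X. functor_iso (op_cat C) X F (Ext1_contra C B)"
proof -
  \<comment> \<open>The decomposition is transported to the covariant functor of the opposite
    category, and the isomorphism found there is transported back below.\<close>
  have "direct_summand_compl (op_cat C) X F G (Ext1_cov (op_cat C) A)"
    using assms(7) functor_iso_trans[OF Ext1_cov_op_iso] unfolding direct_summand_compl_def by blast
  then obtain B where "B \<in> X" "functor_iso (op_cat C) X F (Ext1_cov (op_cat C) B)"
    using abelian_category.Ext1_cov_summand[OF abelian_op, of X A F G] assms(1-6)
    by (auto simp: stable_cat_op)
  then show ?thesis using functor_iso_trans[OF _ Ext1_cov_op_iso] by blast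
qed

end

theorem theorem3p10:
  fixes C :: "('o, 'm) cat" and X :: "'o set"
  assumes "abelian_category C"
    and "enough_projectives C" and "enough_injectives C"
    and "subcategory C X" and "functorially_finite C X"
    and "\<And>P. projective C P \<Longrightarrow> P \<in> X"
    and "\<And>I. injective C I \<Longrightarrow> I \<in> X"
    and "closed_kernels_of_epis C X" and "closed_cokernels_of_monos C X"
  shows
    "(has_split_idempotents (projectively_stable_cat C X) \<longrightarrow>
        (\<forall>A \<in> X. \<forall>(F :: ('o, 'm, 'g) ab_functor) (G :: ('o, 'm, 'h) ab_functor).
           direct_summand_compl C X F G (Ext1_cov C A) \<longrightarrow>
           (\<exists>B \<in> X. functor_iso C X F (Ext1_cov C B)))) \<and>
     (X = Obj C \<and> krull_schmidt C \<longrightarrow>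
        (\<forall>A \<in> Obj C. \<forall>(F :: ('o, 'm, 'g) ab_functor) (G :: ('o, 'm, 'h) ab_functor).
           direct_summand_compl C (Obj C) F G (Ext1_cov C A) \<longrightarrow>
           (\<exists>B \<in> Obj C. functor_iso C (Obj C) F (Ext1_cov C B)))) \<and>
     (has_split_idempotents (injectively_stable_cat C X) \<longrightarrow>
        (\<forall>A \<in> X. \<forall>(F :: ('o, 'm, 'g) ab_functor) (G :: ('o, 'm, 'h) ab_functor).
           direct_summand_compl (op_cat C) X F G (Ext1_contra C A) \<longrightarrow>
           (\<exists>B \<in> X. functor_iso (op_cat C) X F (Ext1_contra C B)))) \<and>
     (X = Obj C \<and> krull_schmidt C \<longrightarrow>
        (\<forall>A \<in> Obj C. \<forall>(F :: ('o, 'm, 'g) ab_functor) (G :: ('o, 'm, 'h) ab_functor).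
           direct_summand_compl (op_cat C) (Obj C) F G (Ext1_contra C A) \<longrightarrow>
           (\<exists>B \<in> Obj C. functor_iso (op_cat C) (Obj C) F (Ext1_contra C B))))"
proof -
  interpret abelian_category C by fact
  have X: "X \<subseteq> Obj C" using assms(4) by (simp add: subcategory_def)
  have proj: "\<exists>B \<in> X. functor_iso C X F (Ext1_cov C B)"
    if "has_split_idempotents (stable_cat C X (projective C))" "A \<in> X" "direct_summand_compl C X F G (Ext1_cov C A)"
    for A and F :: "('o, 'm, 'g) ab_functor" and G :: "('o, 'm, 'h) ab_functor"
    by (rule Ext1_cov_summand[OF assms(2) X assms(6) assms(8) that])
  have inj: "\<exists>B \<in> X. functor_iso (op_cat C) X F (Ext1_contra C B)"
    if "has_split_idempotents (stable_cat C X (injective C))" "A \<in> X" "direct_summand_compl (op_cat C) X F G (Ext1_contra C A)"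
    for A and F :: "('o, 'm, 'g) ab_functor" and G :: "('o, 'm, 'h) ab_functor"
    by (rule Ext1_contra_summand[OF assms(3) X assms(7) assms(9) that])
  \<comment> \<open>The Krull-Schmidt property yields the splitting hypotheses for both stable
    categories, so the special cases are instances of the general ones.\<close>
  have ks: "has_split_idempotents (stable_cat C X (projective C)) \<and> has_split_idempotents (stable_cat C X (injective C))"
    if "X = Obj C \<and> krull_schmidt C"
    using that stable_ideal.krull_schmidt_stable_split[OF projective_stable_ideal]
      stable_ideal.krull_schmidt_stable_split[OF injective_stable_ideal] by blast
  show ?thesis
    unfolding projectively_stable_cat_def injectively_stable_cat_def
    using proj inj ks by blast
qed

end
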